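(* Let $C$ and $D$ be coalgebras over a field $k$ and let $\Psi: C\otimes D\to D\otimes C$ be a twist map which is a morphism in the category ${}^{D}M^{C}$. Then $\Psi$ satisfies $$(\mathrm{id}_D\otimes\mathrm{id}_C\otimes\Psi)(\mathrm{id}_D\otimes\Delta_C\otimes\mathrm{id}_D)(\Psi\otimes\mathrm{id}_D)(\mathrm{id}_C\otimes\Delta_D)=(\Psi\otimes\mathrm{id}_D\otimes\mathrm{id}_C)(\mathrm{id}_C\otimes\Delta_D\otimes\mathrm{id}_C)(\mathrm{id}_C\otimes\Psi)(\Delta_C\otimes\mathrm{id}_D),$$ and hence $\Delta_\Psi:=(\mathrm{id}_C\otimes\Psi\otimes\mathrm{id}_D)\circ(\Delta_C\otimes\Delta_D)$ is a coassociative coproduct on $C\otimes D$.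
   Context: All coalgebras are coassociative and counital over the field $k$, with Sweedler notation $\Delta(c)=c_{(1)}\otimes c_{(2)}$. A twist map is a $k$-linear map $C\otimes D\to D\otimes C$. ${}^{D}M^{C}$ is the category of left $D$- right $C$-comodules with commuting coactions, whose morphisms are linear maps that are both left $D$-colinear and right $C$-colinear. $D\otimes C$ is an object via the left $D$-coaction $\Delta_D\otimes\mathrm{id}_C$ and the right $C$-coaction $\mathrm{id}_D\otimes\Delta_C$. $C\otimes D$ is an object via the left $D$-coaction $c\otimes d\mapsto d_{(1)}\otimes c\otimes d_{(2)}$ and the right $C$-coaction $c\otimes d\mapsto c_{(1)}\otimes d\otimes c_{(2)}$. *)

theory Defs
  imports "HOL-Algebra.AbelCoset" "Jordan_Normal_Form.Missing_VectorSpace"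
begin

section \<open>Tensor products of vector spaces\<close>

text \<open>
  Vector spaces are module records in the sense of \<^locale>\<open>vectorspace\<close>.  The ring
  multiplication fields \<open>mult\<close> and \<open>one\<close> of these records play no role and are left unspecified.
\<close>

definition free_space :: "('k, 'r) ring_scheme \<Rightarrow> 's set \<Rightarrow> ('k, 's \<Rightarrow> 'k) module" where
  "free_space K S =
    \<lparr>carrier = {x. (\<forall>s. x s \<in> carrier K) \<and> (\<forall>s. s \<notin> S \<longrightarrow> x s = \<zero>\<^bsub>K\<^esub>) \<and> finite {s. x s \<noteq> \<zero>\<^bsub>K\<^esub>}},
     mult = undefined, one = undefined,
     zero = (\<lambda>s. \<zero>\<^bsub>K\<^esub>),
     add = (\<lambda>x y s. x s \<oplus>\<^bsub>K\<^esub> y s),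
     smult = (\<lambda>a x s. a \<otimes>\<^bsub>K\<^esub> x s)\<rparr>"

definition free_gen :: "('k, 'r) ring_scheme \<Rightarrow> 's \<Rightarrow> 's \<Rightarrow> 'k" where
  "free_gen K s = (\<lambda>t. if t = s then \<one>\<^bsub>K\<^esub> else \<zero>\<^bsub>K\<^esub>)"

definition quotient_space :: "('k, 'v, 'm) module_scheme \<Rightarrow> 'v set \<Rightarrow> ('k, 'v set) module" where
  "quotient_space V W =
    \<lparr>carrier = a_rcosets\<^bsub>V\<^esub> W,
     mult = undefined, one = undefined,
     zero = W,
     add = set_add V,
     smult = (\<lambda>a X. \<Union>x\<in>X. W +>\<^bsub>V\<^esub> (a \<odot>\<^bsub>V\<^esub> x))\<rparr>"

definition tensor_relations ::
  "('k, 'r) ring_scheme \<Rightarrow> ('k, 'a, 'm) module_scheme \<Rightarrow> ('k, 'b, 'n) module_scheme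
    \<Rightarrow> ('a \<times> 'b \<Rightarrow> 'k) set" where
  "tensor_relations K M N =
    (let F = free_space K (carrier M \<times> carrier N); g = free_gen K in
      {g (m \<oplus>\<^bsub>M\<^esub> m', n) \<ominus>\<^bsub>F\<^esub> (g (m, n) \<oplus>\<^bsub>F\<^esub> g (m', n)) | m m' n.
         m \<in> carrier M \<and> m' \<in> carrier M \<and> n \<in> carrier N} \<union>
      {g (m, n \<oplus>\<^bsub>N\<^esub> n') \<ominus>\<^bsub>F\<^esub> (g (m, n) \<oplus>\<^bsub>F\<^esub> g (m, n')) | m n n'.
         m \<in> carrier M \<and> n \<in> carrier N \<and> n' \<in> carrier N} \<union>
      {g (a \<odot>\<^bsub>M\<^esub> m, n) \<ominus>\<^bsub>F\<^esub> a \<odot>\<^bsub>F\<^esub> g (m, n) | a m n.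
         a \<in> carrier K \<and> m \<in> carrier M \<and> n \<in> carrier N} \<union>
      {g (m, a \<odot>\<^bsub>N\<^esub> n) \<ominus>\<^bsub>F\<^esub> a \<odot>\<^bsub>F\<^esub> g (m, n) | a m n.
         a \<in> carrier K \<and> m \<in> carrier M \<and> n \<in> carrier N})"

definition tensor_kernel ::
  "('k, 'r) ring_scheme \<Rightarrow> ('k, 'a, 'm) module_scheme \<Rightarrow> ('k, 'b, 'n) module_scheme
    \<Rightarrow> ('a \<times> 'b \<Rightarrow> 'k) set" where
  "tensor_kernel K M N =
    module.span K (free_space K (carrier M \<times> carrier N)) (tensor_relations K M N)"

definition tensor ::
  "('k, 'r) ring_scheme \<Rightarrow> ('k, 'a, 'm) module_scheme \<Rightarrow> ('k, 'b, 'n) module_scheme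
    \<Rightarrow> ('k, ('a \<times> 'b \<Rightarrow> 'k) set) module" (infixr \<open>\<boxtimes>\<index>\<close> 70) where
  "tensor K M N = quotient_space (free_space K (carrier M \<times> carrier N)) (tensor_kernel K M N)"

text \<open>\<open>pure_tensor K M N m n\<close> is the class $m \otimes n$ in \<open>tensor K M N\<close>.\<close>

definition pure_tensor ::
  "('k, 'r) ring_scheme \<Rightarrow> ('k, 'a, 'm) module_scheme \<Rightarrow> ('k, 'b, 'n) module_scheme
    \<Rightarrow> 'a \<Rightarrow> 'b \<Rightarrow> ('a \<times> 'b \<Rightarrow> 'k) set" where
  "pure_tensor K M N m n =
    tensor_kernel K M N +>\<^bsub>free_space K (carrier M \<times> carrier N)\<^esub> free_gen K (m, n)"

text \<open>
  \<open>tensor_lift K P \<beta>\<close> is the linear map $t \mapsto \sum \beta(m_i, n_i)$ for $t = \sum m_i \otimes n_i$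
  that a bilinear map \<open>\<beta>\<close> into \<open>P\<close> induces on the tensor product.  It is the common value on
  all representatives of a class, hence meaningful only when \<open>\<beta>\<close> is bilinear.
\<close>

definition tensor_lift ::
  "('k, 'r) ring_scheme \<Rightarrow> ('k, 'p, 'q) module_scheme \<Rightarrow> ('a \<Rightarrow> 'b \<Rightarrow> 'p)
    \<Rightarrow> ('a \<times> 'b \<Rightarrow> 'k) set \<Rightarrow> 'p" where
  "tensor_lift K P \<beta> X =
    the_elem ((\<lambda>x. \<Oplus>\<^bsub>P\<^esub>s\<in>{s. x s \<noteq> \<zero>\<^bsub>K\<^esub>}. x s \<odot>\<^bsub>P\<^esub> \<beta> (fst s) (snd s)) ` X)"

text \<open>\<open>tensor_map K M' N' f g\<close> is $f \otimes g$ for linear maps $f : M \to M'$ and $g : N \to N'$.\<close>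

definition tensor_map ::
  "('k, 'r) ring_scheme \<Rightarrow> ('k, 'c, 'm) module_scheme \<Rightarrow> ('k, 'd, 'n) module_scheme
    \<Rightarrow> ('a \<Rightarrow> 'c) \<Rightarrow> ('b \<Rightarrow> 'd) \<Rightarrow> ('a \<times> 'b \<Rightarrow> 'k) set \<Rightarrow> ('c \<times> 'd \<Rightarrow> 'k) set" where
  "tensor_map K M' N' f g =
    tensor_lift K (tensor K M' N') (\<lambda>m n. pure_tensor K M' N' (f m) (g n))"

text \<open>The canonical isomorphisms $(L \otimes M) \otimes N \cong L \otimes (M \otimes N)$.\<close>

definition assoc_right ::
  "('k, 'r) ring_scheme \<Rightarrow> ('k, 'a, 'l) module_scheme \<Rightarrow> ('k, 'b, 'm) module_scheme
    \<Rightarrow> ('k, 'c, 'n) module_scheme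
    \<Rightarrow> (('a \<times> 'b \<Rightarrow> 'k) set \<times> 'c \<Rightarrow> 'k) set \<Rightarrow> ('a \<times> ('b \<times> 'c \<Rightarrow> 'k) set \<Rightarrow> 'k) set" where
  "assoc_right K L M N =
    (let P = tensor K L (tensor K M N) in
      tensor_lift K P (\<lambda>t n. tensor_lift K P
        (\<lambda>l m. pure_tensor K L (tensor K M N) l (pure_tensor K M N m n)) t))"

definition assoc_left ::
  "('k, 'r) ring_scheme \<Rightarrow> ('k, 'a, 'l) module_scheme \<Rightarrow> ('k, 'b, 'm) module_scheme
    \<Rightarrow> ('k, 'c, 'n) module_scheme
    \<Rightarrow> ('a \<times> ('b \<times> 'c \<Rightarrow> 'k) set \<Rightarrow> 'k) set \<Rightarrow> (('a \<times> 'b \<Rightarrow> 'k) set \<times> 'c \<Rightarrow> 'k) set" where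
  "assoc_left K L M N =
    (let P = tensor K (tensor K L M) N in
      tensor_lift K P (\<lambda>l t. tensor_lift K P
        (\<lambda>m n. pure_tensor K (tensor K L M) N (pure_tensor K L M l m) n) t))"


section \<open>Coalgebras and comodules\<close>

definition coassociative_coproduct ::
  "('k, 'r) ring_scheme \<Rightarrow> ('k, 'c, 'm) module_scheme \<Rightarrow> ('c \<Rightarrow> ('c \<times> 'c \<Rightarrow> 'k) set) \<Rightarrow> bool" where
  "coassociative_coproduct K C \<Delta> \<longleftrightarrow>
    \<Delta> \<in> module_hom K C (tensor K C C) \<and>
    (\<forall>c\<in>carrier C.
      assoc_right K C C C (tensor_map K (tensor K C C) C \<Delta> id (\<Delta> c)) =
      tensor_map K C (tensor K C C) id \<Delta> (\<Delta> c))"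

definition ground_space :: "('k, 'r) ring_scheme \<Rightarrow> ('k, 'k) module" where
  "ground_space K =
    \<lparr>carrier = carrier K, mult = mult K, one = one K, zero = zero K, add = add K, smult = mult K\<rparr>"

text \<open>The counit laws are $\varepsilon(c_{(1)}) c_{(2)} = c = c_{(1)} \varepsilon(c_{(2)})$.\<close>

locale coalgebra = vectorspace K C for K (structure) and C (structure) +
  fixes \<Delta> \<epsilon>
  assumes coassociative: "coassociative_coproduct K C \<Delta>"
    and counit_hom: "\<epsilon> \<in> module_hom K C (ground_space K)"
    and counit_left: "c \<in> carrier C \<Longrightarrow> tensor_lift K C (\<lambda>a b. \<epsilon> a \<odot>\<^bsub>C\<^esub> b) (\<Delta> c) = c"
    and counit_right: "c \<in> carrier C \<Longrightarrow> tensor_lift K C (\<lambda>a b. \<epsilon> b \<odot>\<^bsub>C\<^esub> a) (\<Delta> c) = c"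


definition left_comodule ::
  "('k, 'r) ring_scheme \<Rightarrow> ('k, 'd, 'n) module_scheme \<Rightarrow> ('d \<Rightarrow> ('d \<times> 'd \<Rightarrow> 'k) set) \<Rightarrow> ('d \<Rightarrow> 'k)
    \<Rightarrow> ('k, 'v, 'm) module_scheme \<Rightarrow> ('v \<Rightarrow> ('d \<times> 'v \<Rightarrow> 'k) set) \<Rightarrow> bool" where
  "left_comodule K D \<Delta> \<epsilon> M l \<longleftrightarrow>
    vectorspace K M \<and> l \<in> module_hom K M (D \<boxtimes>\<^bsub>K\<^esub> M) \<and>
    (\<forall>x\<in>carrier M.
      assoc_right K D D M (tensor_map K (D \<boxtimes>\<^bsub>K\<^esub> D) M \<Delta> id (l x)) =
        tensor_map K D (D \<boxtimes>\<^bsub>K\<^esub> M) id l (l x) \<and>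
      tensor_lift K M (\<lambda>d y. \<epsilon> d \<odot>\<^bsub>M\<^esub> y) (l x) = x)"

definition right_comodule ::
  "('k, 'r) ring_scheme \<Rightarrow> ('k, 'c, 'n) module_scheme \<Rightarrow> ('c \<Rightarrow> ('c \<times> 'c \<Rightarrow> 'k) set) \<Rightarrow> ('c \<Rightarrow> 'k)
    \<Rightarrow> ('k, 'v, 'm) module_scheme \<Rightarrow> ('v \<Rightarrow> ('v \<times> 'c \<Rightarrow> 'k) set) \<Rightarrow> bool" where
  "right_comodule K C \<Delta> \<epsilon> M r \<longleftrightarrow>
    vectorspace K M \<and> r \<in> module_hom K M (M \<boxtimes>\<^bsub>K\<^esub> C) \<and>
    (\<forall>x\<in>carrier M.
      assoc_right K M C C (tensor_map K (M \<boxtimes>\<^bsub>K\<^esub> C) C r id (r x)) =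
        tensor_map K M (C \<boxtimes>\<^bsub>K\<^esub> C) id \<Delta> (r x) \<and>
      tensor_lift K M (\<lambda>y c. \<epsilon> c \<odot>\<^bsub>M\<^esub> y) (r x) = x)"

definition bicomodule ::
  "('k, 'r) ring_scheme
    \<Rightarrow> ('k, 'd, 'n) module_scheme \<Rightarrow> ('d \<Rightarrow> ('d \<times> 'd \<Rightarrow> 'k) set) \<Rightarrow> ('d \<Rightarrow> 'k)
    \<Rightarrow> ('k, 'c, 'p) module_scheme \<Rightarrow> ('c \<Rightarrow> ('c \<times> 'c \<Rightarrow> 'k) set) \<Rightarrow> ('c \<Rightarrow> 'k)
    \<Rightarrow> ('k, 'v, 'm) module_scheme
    \<Rightarrow> ('v \<Rightarrow> ('d \<times> 'v \<Rightarrow> 'k) set) \<Rightarrow> ('v \<Rightarrow> ('v \<times> 'c \<Rightarrow> 'k) set) \<Rightarrow> bool" where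
  "bicomodule K D \<Delta>\<^sub>D \<epsilon>\<^sub>D C \<Delta>\<^sub>C \<epsilon>\<^sub>C M l r \<longleftrightarrow>
    left_comodule K D \<Delta>\<^sub>D \<epsilon>\<^sub>D M l \<and> right_comodule K C \<Delta>\<^sub>C \<epsilon>\<^sub>C M r \<and>
    (\<forall>x\<in>carrier M.
      assoc_right K D M C (tensor_map K (D \<boxtimes>\<^bsub>K\<^esub> M) C l id (r x)) =
        tensor_map K D (M \<boxtimes>\<^bsub>K\<^esub> C) id r (l x))"

definition bicomodule_hom ::
  "('k, 'r) ring_scheme \<Rightarrow> ('k, 'd, 'n) module_scheme \<Rightarrow> ('k, 'c, 'p) module_scheme
    \<Rightarrow> ('k, 'v, 'm) module_scheme
    \<Rightarrow> ('v \<Rightarrow> ('d \<times> 'v \<Rightarrow> 'k) set) \<Rightarrow> ('v \<Rightarrow> ('v \<times> 'c \<Rightarrow> 'k) set)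
    \<Rightarrow> ('k, 'w, 'q) module_scheme
    \<Rightarrow> ('w \<Rightarrow> ('d \<times> 'w \<Rightarrow> 'k) set) \<Rightarrow> ('w \<Rightarrow> ('w \<times> 'c \<Rightarrow> 'k) set) \<Rightarrow> ('v \<Rightarrow> 'w) set" where
  "bicomodule_hom K D C M l r N l' r' =
    {f \<in> module_hom K M N.
      (\<forall>x\<in>carrier M. l' (f x) = tensor_map K D N id f (l x)) \<and>
      (\<forall>x\<in>carrier M. r' (f x) = tensor_map K N C f id (r x))}"


section \<open>Coactions on the two tensor products\<close>

definition left_coaction_DC ::
  "('k, 'r) ring_scheme \<Rightarrow> ('k, 'd, 'n) module_scheme \<Rightarrow> ('k, 'c, 'm) module_scheme
    \<Rightarrow> ('d \<Rightarrow> ('d \<times> 'd \<Rightarrow> 'k) set)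
    \<Rightarrow> ('d \<times> 'c \<Rightarrow> 'k) set \<Rightarrow> ('d \<times> ('d \<times> 'c \<Rightarrow> 'k) set \<Rightarrow> 'k) set" where
  "left_coaction_DC K D C \<Delta>\<^sub>D = assoc_right K D D C \<circ> tensor_map K (D \<boxtimes>\<^bsub>K\<^esub> D) C \<Delta>\<^sub>D id"

definition right_coaction_DC ::
  "('k, 'r) ring_scheme \<Rightarrow> ('k, 'd, 'n) module_scheme \<Rightarrow> ('k, 'c, 'm) module_scheme
    \<Rightarrow> ('c \<Rightarrow> ('c \<times> 'c \<Rightarrow> 'k) set)
    \<Rightarrow> ('d \<times> 'c \<Rightarrow> 'k) set \<Rightarrow> (('d \<times> 'c \<Rightarrow> 'k) set \<times> 'c \<Rightarrow> 'k) set" where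
  "right_coaction_DC K D C \<Delta>\<^sub>C = assoc_left K D C C \<circ> tensor_map K D (C \<boxtimes>\<^bsub>K\<^esub> C) id \<Delta>\<^sub>C"

text \<open>On $C \otimes D$: $c \otimes d \mapsto d_{(1)} \otimes (c \otimes d_{(2)})$ and
  $c \otimes d \mapsto (c_{(1)} \otimes d) \otimes c_{(2)}$.\<close>

definition left_coaction_CD ::
  "('k, 'r) ring_scheme \<Rightarrow> ('k, 'c, 'm) module_scheme \<Rightarrow> ('k, 'd, 'n) module_scheme
    \<Rightarrow> ('d \<Rightarrow> ('d \<times> 'd \<Rightarrow> 'k) set)
    \<Rightarrow> ('c \<times> 'd \<Rightarrow> 'k) set \<Rightarrow> ('d \<times> ('c \<times> 'd \<Rightarrow> 'k) set \<Rightarrow> 'k) set" where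
  "left_coaction_CD K C D \<Delta>\<^sub>D =
    (let P = D \<boxtimes>\<^bsub>K\<^esub> (C \<boxtimes>\<^bsub>K\<^esub> D) in
      tensor_lift K P (\<lambda>c d. tensor_lift K P
        (\<lambda>d\<^sub>1 d\<^sub>2. pure_tensor K D (C \<boxtimes>\<^bsub>K\<^esub> D) d\<^sub>1 (pure_tensor K C D c d\<^sub>2)) (\<Delta>\<^sub>D d)))"

definition right_coaction_CD ::
  "('k, 'r) ring_scheme \<Rightarrow> ('k, 'c, 'm) module_scheme \<Rightarrow> ('k, 'd, 'n) module_scheme
    \<Rightarrow> ('c \<Rightarrow> ('c \<times> 'c \<Rightarrow> 'k) set)
    \<Rightarrow> ('c \<times> 'd \<Rightarrow> 'k) set \<Rightarrow> (('c \<times> 'd \<Rightarrow> 'k) set \<times> 'c \<Rightarrow> 'k) set" where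
  "right_coaction_CD K C D \<Delta>\<^sub>C =
    (let P = (C \<boxtimes>\<^bsub>K\<^esub> D) \<boxtimes>\<^bsub>K\<^esub> C in
      tensor_lift K P (\<lambda>c d. tensor_lift K P
        (\<lambda>c\<^sub>1 c\<^sub>2. pure_tensor K (C \<boxtimes>\<^bsub>K\<^esub> D) C (pure_tensor K C D c\<^sub>1 d) c\<^sub>2) (\<Delta>\<^sub>C c)))"

text \<open>
  $(\mathrm{id}_C \otimes \Psi \otimes \mathrm{id}_D) \circ (\Delta_C \otimes \Delta_D)$, rebracketed
  from $(C \otimes C) \otimes (D \otimes D)$ to $C \otimes ((C \otimes D) \otimes D)$ and from
  $C \otimes ((D \otimes C) \otimes D)$ to $(C \otimes D) \otimes (C \otimes D)$.
\<close>

definition twisted_coproduct ::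
  "('k, 'r) ring_scheme \<Rightarrow> ('k, 'c, 'm) module_scheme \<Rightarrow> ('k, 'd, 'n) module_scheme
    \<Rightarrow> ('c \<Rightarrow> ('c \<times> 'c \<Rightarrow> 'k) set) \<Rightarrow> ('d \<Rightarrow> ('d \<times> 'd \<Rightarrow> 'k) set)
    \<Rightarrow> (('c \<times> 'd \<Rightarrow> 'k) set \<Rightarrow> ('d \<times> 'c \<Rightarrow> 'k) set)
    \<Rightarrow> ('c \<times> 'd \<Rightarrow> 'k) set \<Rightarrow> (('c \<times> 'd \<Rightarrow> 'k) set \<times> ('c \<times> 'd \<Rightarrow> 'k) set \<Rightarrow> 'k) set" where
  "twisted_coproduct K C D \<Delta>\<^sub>C \<Delta>\<^sub>D \<Psi> =
    assoc_left K C D (C \<boxtimes>\<^bsub>K\<^esub> D) \<circ>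
    tensor_map K C (D \<boxtimes>\<^bsub>K\<^esub> (C \<boxtimes>\<^bsub>K\<^esub> D)) id (assoc_right K D C D) \<circ>
    tensor_map K C ((D \<boxtimes>\<^bsub>K\<^esub> C) \<boxtimes>\<^bsub>K\<^esub> D) id (tensor_map K (D \<boxtimes>\<^bsub>K\<^esub> C) D \<Psi> id) \<circ>
    tensor_map K C ((C \<boxtimes>\<^bsub>K\<^esub> D) \<boxtimes>\<^bsub>K\<^esub> D) id (assoc_left K C D D) \<circ>
    assoc_right K C C (D \<boxtimes>\<^bsub>K\<^esub> D) \<circ>
    tensor_map K (C \<boxtimes>\<^bsub>K\<^esub> C) (D \<boxtimes>\<^bsub>K\<^esub> D) \<Delta>\<^sub>C \<Delta>\<^sub>D"


section \<open>The two tensor products are bicomodules\<close>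

text \<open>
  The universal property of \<^const>\<open>tensor\<close> (\<open>pure_bilinear\<close>, \<open>lift_hom\<close>, \<open>lift_pure\<close>,
  \<open>tensor_ext\<close>), and the fact that the coactions above make $C \otimes D$ and $D \otimes C$ objects of
  ${}^D M^C$ (\<open>bicomodule_CD\<close>, \<open>bicomodule_DC\<close>); this is why \<^const>\<open>bicomodule_hom\<close> only has
  to ask for linearity and colinearity.
\<close>


lemma free_space_simps:
  "carrier (free_space K S) = {x. (\<forall>s. x s \<in> carrier K) \<and> (\<forall>s. s \<notin> S \<longrightarrow> x s = \<zero>\<^bsub>K\<^esub>) \<and> finite {s. x s \<noteq> \<zero>\<^bsub>K\<^esub>}}"
  "\<zero>\<^bsub>free_space K S\<^esub> = (\<lambda>s. \<zero>\<^bsub>K\<^esub>)"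
  "x \<oplus>\<^bsub>free_space K S\<^esub> y = (\<lambda>s. x s \<oplus>\<^bsub>K\<^esub> y s)"
  "a \<odot>\<^bsub>free_space K S\<^esub> x = (\<lambda>s. a \<otimes>\<^bsub>K\<^esub> x s)"
  by (simp_all add: free_space_def)

lemma (in field) free_space_module: "module R (free_space R S)"
proof (rule moduleI)
  show "cring R" by (rule is_cring)
  show "abelian_group (free_space R S)"
  proof (rule abelian_groupI, goal_cases)
    case (1 x y)
    have "{s. x s \<oplus> y s \<noteq> \<zero>} \<subseteq> {s. x s \<noteq> \<zero>} \<union> {s. y s \<noteq> \<zero>}" by auto
    with 1 show ?case by (auto simp: free_space_simps intro: finite_subset)
  next
    case 2 then show ?case by (auto simp: free_space_simps)
  next
    case (3 x y z) then show ?case by (auto simp: free_space_simps a_assoc)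
  next
    case (4 x y) then show ?case by (auto simp: free_space_simps a_comm)
  next
    case (5 x) then show ?case by (auto simp: free_space_simps)
  next
    case (6 x)
    have "{s. \<ominus> x s \<noteq> \<zero>} \<subseteq> {s. x s \<noteq> \<zero>}" by auto
    with 6 have "(\<lambda>s. \<ominus> x s) \<in> carrier (free_space R S)"
      by (auto simp: free_space_simps intro: finite_subset)
    moreover have "(\<lambda>s. \<ominus> x s) \<oplus>\<^bsub>free_space R S\<^esub> x = \<zero>\<^bsub>free_space R S\<^esub>"
      using 6 by (auto simp: free_space_simps l_neg)
    ultimately show ?case by blast
  qed
next
  fix a x assume "a \<in> carrier R" "x \<in> carrier (free_space R S)"
  moreover have "{s. a \<otimes> x s \<noteq> \<zero>} \<subseteq> {s. x s \<noteq> \<zero>}" using \<open>a \<in> carrier R\<close> by auto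
  ultimately show "a \<odot>\<^bsub>free_space R S\<^esub> x \<in> carrier (free_space R S)"
    by (auto simp: free_space_simps intro: finite_subset)
qed (auto simp: free_space_simps l_distr r_distr m_assoc)

lemma (in field) free_gen_closed: "s \<in> S \<Longrightarrow> free_gen R s \<in> carrier (free_space R S)"
  by (auto simp: free_space_simps free_gen_def)

lemma (in field) free_induct [consumes 1, case_names zero add]:
  assumes x: "x \<in> carrier (free_space R S)"
    and z: "P (\<zero>\<^bsub>free_space R S\<^esub>)"
    and add: "\<And>a s y. a \<in> carrier R \<Longrightarrow> s \<in> S \<Longrightarrow> y \<in> carrier (free_space R S) \<Longrightarrow> P y \<Longrightarrow>
        P (a \<odot>\<^bsub>free_space R S\<^esub> free_gen R s \<oplus>\<^bsub>free_space R S\<^esub> y)"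
  shows "P x"
proof -
  have "finite A \<Longrightarrow> x \<in> carrier (free_space R S) \<Longrightarrow> {s. x s \<noteq> \<zero>} = A \<Longrightarrow> P x" for A x
  proof (induction A arbitrary: x rule: finite_induct)
    case empty
    then have "x = \<zero>\<^bsub>free_space R S\<^esub>" by (auto simp: free_space_simps)
    with z show ?case by simp
  next
    case (insert s A)
    have xs: "x s \<noteq> \<zero>" using insert.prems by auto
    have sS: "s \<in> S" and xc: "\<And>t. x t \<in> carrier R" using xs insert.prems by (auto simp: free_space_simps)
    let ?y = "x(s := \<zero>)"
    have supp: "{t. ?y t \<noteq> \<zero>} = A" using insert by auto
    have y: "?y \<in> carrier (free_space R S)"
      using insert.prems insert.hyps supp by (auto simp: free_space_simps simp del: fun_upd_apply) (auto)
    have "x = x s \<odot>\<^bsub>free_space R S\<^esub> free_gen R s \<oplus>\<^bsub>free_space R S\<^esub> ?y"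
      using xc by (auto simp: free_space_simps free_gen_def)
    with add[OF xc sS y insert.IH[OF y supp]] show ?case by metis
  qed
  with x show ?thesis by (auto simp: free_space_simps)
qed

lemma quotient_space_simps:
  "carrier (quotient_space V W) = a_rcosets\<^bsub>V\<^esub> W"
  "\<zero>\<^bsub>quotient_space V W\<^esub> = W"
  "X \<oplus>\<^bsub>quotient_space V W\<^esub> Y = X <+>\<^bsub>V\<^esub> Y"
  "a \<odot>\<^bsub>quotient_space V W\<^esub> X = (\<Union>x\<in>X. W +>\<^bsub>V\<^esub> (a \<odot>\<^bsub>V\<^esub> x))"
  by (simp_all add: quotient_space_def)

lemma submodule_subgroup:
  assumes "module R V" "LinearCombinations.submodule R W V"
  shows "abelian_subgroup W V"
proof -
  interpret V: module R V by fact
  interpret W: LinearCombinations.submodule R W V by fact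
  have inv: "inv\<^bsub>add_monoid V\<^esub> a \<in> W" if a: "a \<in> W" for a
  proof -
    have "\<ominus>\<^bsub>V\<^esub> a = (\<ominus>\<^bsub>R\<^esub> \<one>\<^bsub>R\<^esub>) \<odot>\<^bsub>V\<^esub> a"
      using a W.subset by (simp add: V.smult_l_minus subset_iff)
    moreover have "(\<ominus>\<^bsub>R\<^esub> \<one>\<^bsub>R\<^esub>) \<odot>\<^bsub>V\<^esub> a \<in> W" using a by (simp add: W.smult_closed)
    ultimately show ?thesis by (simp add: a_inv_def)
  qed
  have "additive_subgroup W V"
  proof (rule additive_subgroupI, rule V.add.subgroupI)
    show "W \<subseteq> carrier V" by (rule W.subset)
    show "W \<noteq> {}" using W.zero_closed by blast
    show "\<ominus>\<^bsub>V\<^esub> a \<in> W" if "a \<in> W" for a using inv[OF that] by (simp add: a_inv_def)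
    show "a \<oplus>\<^bsub>V\<^esub> b \<in> W" if "a \<in> W" "b \<in> W" for a b using W.m_closed[OF that] by simp
  qed
  then show ?thesis by (rule abelian_subgroupI3) (rule V.abelian_group_axioms)
qed

lemma 
  assumes "module R V" "LinearCombinations.submodule R W V"
  shows quotient_module: "module R (quotient_space V W)"
    and quotient_proj: "(\<lambda>v. W +>\<^bsub>V\<^esub> v) \<in> module_hom R V (quotient_space V W)"
    and quotient_carrier: "carrier (quotient_space V W) = (\<lambda>v. W +>\<^bsub>V\<^esub> v) ` carrier V"
proof -
  interpret V: module R V by fact
  interpret W: LinearCombinations.submodule R W V by fact
  interpret S: abelian_subgroup W V by (rule submodule_subgroup) fact+
  let ?Q = "quotient_space V W"
  have car: "carrier ?Q = (\<lambda>v. W +>\<^bsub>V\<^esub> v) ` carrier V"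
    by (auto simp: quotient_space_simps A_RCOSETS_def')
  have sum: "(W +>\<^bsub>V\<^esub> x) \<oplus>\<^bsub>?Q\<^esub> (W +>\<^bsub>V\<^esub> y) = W +>\<^bsub>V\<^esub> (x \<oplus>\<^bsub>V\<^esub> y)" if "x \<in> carrier V" "y \<in> carrier V" for x y
    using that by (simp add: quotient_space_simps S.a_rcos_sum)
  have sm: "a \<odot>\<^bsub>?Q\<^esub> (W +>\<^bsub>V\<^esub> x) = W +>\<^bsub>V\<^esub> (a \<odot>\<^bsub>V\<^esub> x)" if a: "a \<in> carrier R" and x: "x \<in> carrier V" for a x
  proof -
    have "W +>\<^bsub>V\<^esub> (a \<odot>\<^bsub>V\<^esub> y) = W +>\<^bsub>V\<^esub> (a \<odot>\<^bsub>V\<^esub> x)" if y: "y \<in> W +>\<^bsub>V\<^esub> x" for y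
    proof -
      obtain w where w: "w \<in> W" "y = w \<oplus>\<^bsub>V\<^esub> x" using y by (auto simp: a_r_coset_def')
      have "a \<odot>\<^bsub>V\<^esub> y = a \<odot>\<^bsub>V\<^esub> w \<oplus>\<^bsub>V\<^esub> a \<odot>\<^bsub>V\<^esub> x" using w a x W.subset by (auto simp: V.smult_r_distr)
      moreover have "a \<odot>\<^bsub>V\<^esub> w \<in> W" using a w by auto
      ultimately have "a \<odot>\<^bsub>V\<^esub> y \<in> W +>\<^bsub>V\<^esub> (a \<odot>\<^bsub>V\<^esub> x)" by (auto simp: a_r_coset_def')
      then show ?thesis
        by (rule V.a_repr_independence[symmetric]) (use a x S.a_subgroup in simp_all)
    qed
    moreover have "x \<in> W +>\<^bsub>V\<^esub> x" using x by (rule S.a_rcos_self)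
    ultimately show ?thesis unfolding quotient_space_simps(4) by blast
  qed
  have z: "\<zero>\<^bsub>?Q\<^esub> = W +>\<^bsub>V\<^esub> \<zero>\<^bsub>V\<^esub>" using W.subset by (simp add: quotient_space_simps)
  have el: "X \<in> carrier ?Q \<Longrightarrow> \<exists>x\<in>carrier V. X = W +>\<^bsub>V\<^esub> x" for X by (auto simp: car)
  have cl: "x \<in> carrier V \<Longrightarrow> W +>\<^bsub>V\<^esub> x \<in> carrier ?Q" for x by (auto simp: car)
  show "module R ?Q"
  proof (rule moduleI)
    show "cring R" by (rule V.is_cring)
    show "abelian_group ?Q"
    proof (rule abelian_groupI, goal_cases)
      case (1 X Y) then show ?case by (auto dest!: el intro!: cl simp: sum)
    next
      case 2 then show ?case unfolding z by (auto intro!: cl)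
    next
      case (3 X Y Z) then show ?case by (auto dest!: el simp: sum V.a_assoc)
    next
      case (4 X Y) then show ?case by (auto dest!: el simp: sum V.a_comm)
    next
      case (5 X) then show ?case unfolding z by (auto dest!: el simp: sum)
    next
      case (6 X)
      then obtain x where x: "x \<in> carrier V" "X = W +>\<^bsub>V\<^esub> x" by (auto dest!: el)
      show ?case unfolding z
        by (rule bexI[of _ "W +>\<^bsub>V\<^esub> (\<ominus>\<^bsub>V\<^esub> x)"]) (use x in \<open>auto intro!: cl simp: sum V.l_neg\<close>)
    qed
  next
    fix a X assume "a \<in> carrier R" "X \<in> carrier ?Q"
    then show "a \<odot>\<^bsub>?Q\<^esub> X \<in> carrier ?Q" by (auto dest!: el intro!: cl simp: sm)
  next
    fix a b X assume "a \<in> carrier R" "b \<in> carrier R" "X \<in> carrier ?Q"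
    then show "(a \<oplus>\<^bsub>R\<^esub> b) \<odot>\<^bsub>?Q\<^esub> X = a \<odot>\<^bsub>?Q\<^esub> X \<oplus>\<^bsub>?Q\<^esub> b \<odot>\<^bsub>?Q\<^esub> X"
      by (auto dest!: el simp: sm sum V.smult_l_distr)
  next
    fix a X Y assume "a \<in> carrier R" "X \<in> carrier ?Q" "Y \<in> carrier ?Q"
    then show "a \<odot>\<^bsub>?Q\<^esub> (X \<oplus>\<^bsub>?Q\<^esub> Y) = a \<odot>\<^bsub>?Q\<^esub> X \<oplus>\<^bsub>?Q\<^esub> a \<odot>\<^bsub>?Q\<^esub> Y"
      by (auto dest!: el simp: sm sum V.smult_r_distr)
  next
    fix a b X assume "a \<in> carrier R" "b \<in> carrier R" "X \<in> carrier ?Q"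
    then show "(a \<otimes>\<^bsub>R\<^esub> b) \<odot>\<^bsub>?Q\<^esub> X = a \<odot>\<^bsub>?Q\<^esub> (b \<odot>\<^bsub>?Q\<^esub> X)"
      by (auto dest!: el simp: sm V.smult_assoc1)
  next
    fix X assume "X \<in> carrier ?Q"
    then show "\<one>\<^bsub>R\<^esub> \<odot>\<^bsub>?Q\<^esub> X = X" by (auto dest!: el simp: sm)
  qed
  show "(\<lambda>v. W +>\<^bsub>V\<^esub> v) \<in> module_hom R V ?Q"
    by (auto simp: module_hom_def cl sum sm)
  show "carrier ?Q = (\<lambda>v. W +>\<^bsub>V\<^esub> v) ` carrier V" by (rule car)
qed

lemma lin_closed: "f \<in> module_hom K M N \<Longrightarrow> x \<in> carrier M \<Longrightarrow> f x \<in> carrier N"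
  by (auto simp: module_hom_def)
lemma lin_add: "f \<in> module_hom K M N \<Longrightarrow> x \<in> carrier M \<Longrightarrow> y \<in> carrier M \<Longrightarrow> f (x \<oplus>\<^bsub>M\<^esub> y) = f x \<oplus>\<^bsub>N\<^esub> f y"
  by (auto simp: module_hom_def)
lemma lin_smult: "f \<in> module_hom K M N \<Longrightarrow> a \<in> carrier K \<Longrightarrow> x \<in> carrier M \<Longrightarrow> f (a \<odot>\<^bsub>M\<^esub> x) = a \<odot>\<^bsub>N\<^esub> f x"
  by (auto simp: module_hom_def)
lemma linI: "(\<And>x. x \<in> carrier M \<Longrightarrow> f x \<in> carrier N) \<Longrightarrow>
  (\<And>x y. x \<in> carrier M \<Longrightarrow> y \<in> carrier M \<Longrightarrow> f (x \<oplus>\<^bsub>M\<^esub> y) = f x \<oplus>\<^bsub>N\<^esub> f y) \<Longrightarrow>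
  (\<And>a x. a \<in> carrier K \<Longrightarrow> x \<in> carrier M \<Longrightarrow> f (a \<odot>\<^bsub>M\<^esub> x) = a \<odot>\<^bsub>N\<^esub> f x) \<Longrightarrow> f \<in> module_hom K M N"
  by (auto simp: module_hom_def)
lemma lin_comp: "f \<in> module_hom K M N \<Longrightarrow> g \<in> module_hom K N P \<Longrightarrow> (\<lambda>x. g (f x)) \<in> module_hom K M P"
  unfolding module_hom_def by (simp add: Pi_def)
lemma lin_id: "(\<lambda>x. x) \<in> module_hom K M M"
  by (auto simp: module_hom_def)

lemma lin_zero:
  assumes "module K M" "module K N" "f \<in> module_hom K M N" shows "f \<zero>\<^bsub>M\<^esub> = \<zero>\<^bsub>N\<^esub>"
proof -
  interpret mod_hom K M N f using assms by (simp add: mod_hom_def mod_hom_axioms_def)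
  show ?thesis by simp
qed

lemma lin_minus:
  assumes "module K M" "module K N" "f \<in> module_hom K M N" "x \<in> carrier M" "y \<in> carrier M"
  shows "f (x \<ominus>\<^bsub>M\<^esub> y) = f x \<ominus>\<^bsub>N\<^esub> f y"
proof -
  interpret mod_hom K M N f using assms by (simp add: mod_hom_def mod_hom_axioms_def)
  have "\<ominus>\<^bsub>M\<^esub> y = (\<ominus>\<^bsub>K\<^esub> \<one>\<^bsub>K\<^esub>) \<odot>\<^bsub>M\<^esub> y" "\<ominus>\<^bsub>N\<^esub> f y = (\<ominus>\<^bsub>K\<^esub> \<one>\<^bsub>K\<^esub>) \<odot>\<^bsub>N\<^esub> f y"
    using assms by (auto simp: M.smult_l_minus N.smult_l_minus)
  then show ?thesis using assms by (simp add: a_minus_def)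
qed

definition free_eval where "free_eval K P \<beta> x = (\<Oplus>\<^bsub>P\<^esub>s\<in>{s. x s \<noteq> \<zero>\<^bsub>K\<^esub>}. x s \<odot>\<^bsub>P\<^esub> \<beta> s)"

lemma free_eval_superset:
  assumes "module K P" "finite A" "{s. x s \<noteq> \<zero>\<^bsub>K\<^esub>} \<subseteq> A" "A \<subseteq> S"
    "\<And>s. x s \<in> carrier K" "\<And>s. s \<in> S \<Longrightarrow> \<beta> s \<in> carrier P"
  shows "free_eval K P \<beta> x = (\<Oplus>\<^bsub>P\<^esub>s\<in>A. x s \<odot>\<^bsub>P\<^esub> \<beta> s)"
proof -
  interpret P: module K P by fact
  show ?thesis unfolding free_eval_def
    by (rule P.M.add.finprod_mono_neutral_cong_left) (use assms in \<open>auto simp: subset_iff\<close>)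
qed

lemma free_eval_hom:
  assumes "field K" "module K P" and \<beta>: "\<And>s. s \<in> S \<Longrightarrow> \<beta> s \<in> carrier P"
  shows "free_eval K P \<beta> \<in> module_hom K (free_space K S) P"
proof (rule linI)
  interpret K: field K by fact
  interpret P: module K P by fact
  fix x assume x: "x \<in> carrier (free_space K S)"
  then show "free_eval K P \<beta> x \<in> carrier P" unfolding free_eval_def
    by (intro P.M.finsum_closed) (auto simp: free_space_simps intro!: P.smult_closed, metis \<beta>)
  { fix y assume y: "y \<in> carrier (free_space K S)"
    let ?A = "{s. x s \<noteq> \<zero>\<^bsub>K\<^esub>} \<union> {s. y s \<noteq> \<zero>\<^bsub>K\<^esub>}"
    have A: "finite ?A" "?A \<subseteq> S" using x y by (auto simp: free_space_simps)
    have xy: "\<And>s. x s \<in> carrier K" "\<And>s. y s \<in> carrier K" using x y by (auto simp: free_space_simps)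
    have b: "\<And>s. s \<in> ?A \<Longrightarrow> \<beta> s \<in> carrier P" using A \<beta> by auto
    have "free_eval K P \<beta> (x \<oplus>\<^bsub>free_space K S\<^esub> y) = (\<Oplus>\<^bsub>P\<^esub>s\<in>?A. (x s \<oplus>\<^bsub>K\<^esub> y s) \<odot>\<^bsub>P\<^esub> \<beta> s)"
      by (subst free_eval_superset[of K P ?A _ S]) (use assms A xy in \<open>auto simp: free_space_simps\<close>)
    also have "\<dots> = (\<Oplus>\<^bsub>P\<^esub>s\<in>?A. x s \<odot>\<^bsub>P\<^esub> \<beta> s \<oplus>\<^bsub>P\<^esub> y s \<odot>\<^bsub>P\<^esub> \<beta> s)"
      by (rule P.M.finsum_cong') (use b xy in \<open>auto simp: P.smult_l_distr\<close>)
    also have "\<dots> = (\<Oplus>\<^bsub>P\<^esub>s\<in>?A. x s \<odot>\<^bsub>P\<^esub> \<beta> s) \<oplus>\<^bsub>P\<^esub> (\<Oplus>\<^bsub>P\<^esub>s\<in>?A. y s \<odot>\<^bsub>P\<^esub> \<beta> s)"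
      by (rule P.M.finsum_addf) (use b xy in auto)
    also have "(\<Oplus>\<^bsub>P\<^esub>s\<in>?A. x s \<odot>\<^bsub>P\<^esub> \<beta> s) = free_eval K P \<beta> x"
      by (rule free_eval_superset[symmetric, of K P _ _ S]) (use assms A xy in auto)
    also have "(\<Oplus>\<^bsub>P\<^esub>s\<in>?A. y s \<odot>\<^bsub>P\<^esub> \<beta> s) = free_eval K P \<beta> y"
      by (rule free_eval_superset[symmetric, of K P _ _ S]) (use assms A xy in auto)
    finally show "free_eval K P \<beta> (x \<oplus>\<^bsub>free_space K S\<^esub> y) = free_eval K P \<beta> x \<oplus>\<^bsub>P\<^esub> free_eval K P \<beta> y" . }
  { fix a assume a: "a \<in> carrier K"
    let ?A = "{s. x s \<noteq> \<zero>\<^bsub>K\<^esub>}"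
    have A: "finite ?A" "?A \<subseteq> S" using x by (auto simp: free_space_simps)
    have xy: "\<And>s. x s \<in> carrier K" using x by (auto simp: free_space_simps)
    have b: "\<And>s. s \<in> ?A \<Longrightarrow> \<beta> s \<in> carrier P" using A \<beta> by auto
    have "free_eval K P \<beta> (a \<odot>\<^bsub>free_space K S\<^esub> x) = (\<Oplus>\<^bsub>P\<^esub>s\<in>?A. (a \<otimes>\<^bsub>K\<^esub> x s) \<odot>\<^bsub>P\<^esub> \<beta> s)"
      by (subst free_eval_superset[of K P ?A _ S]) (use assms A xy a in \<open>auto simp: free_space_simps\<close>)
    also have "\<dots> = (\<Oplus>\<^bsub>P\<^esub>s\<in>?A. a \<odot>\<^bsub>P\<^esub> (x s \<odot>\<^bsub>P\<^esub> \<beta> s))"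
      by (rule P.M.finsum_cong') (use b xy a in \<open>auto simp: P.smult_assoc1\<close>)
    also have "\<dots> = a \<odot>\<^bsub>P\<^esub> free_eval K P \<beta> x" unfolding free_eval_def
      by (rule P.finsum_smult_ldistr[symmetric]) (use b xy a A in auto)
    finally show "free_eval K P \<beta> (a \<odot>\<^bsub>free_space K S\<^esub> x) = a \<odot>\<^bsub>P\<^esub> free_eval K P \<beta> x" . }
qed

lemma free_eval_gen:
  assumes "field K" "module K P" and \<beta>: "s \<in> S" "\<And>s. s \<in> S \<Longrightarrow> \<beta> s \<in> carrier P"
  shows "free_eval K P \<beta> (free_gen K s) = \<beta> s"
proof -
  interpret K: field K by fact
  interpret P: module K P by fact
  have "{t. free_gen K s t \<noteq> \<zero>\<^bsub>K\<^esub>} = {s}" by (auto simp: free_gen_def)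
  then show ?thesis using \<beta> by (simp add: free_eval_def free_gen_def)
qed

definition "bilinear_on K M N P \<beta> \<longleftrightarrow> (\<forall>n\<in>carrier N. (\<lambda>m. \<beta> m n) \<in> module_hom K M P) \<and> (\<forall>m\<in>carrier M. \<beta> m \<in> module_hom K N P)"

lemma tensor_relations_closed:
  assumes "vectorspace K M" "vectorspace K N"
  shows "tensor_relations K M N \<subseteq> carrier (free_space K (carrier M \<times> carrier N))"
proof -
  interpret M: vectorspace K M by fact
  interpret N: vectorspace K N by fact
  interpret F: module K "free_space K (carrier M \<times> carrier N)" by (rule M.free_space_module)
  show ?thesis unfolding tensor_relations_def Let_def
    by (auto intro!: M.free_gen_closed F.minus_closed F.M.add.m_closed F.smult_closed)
qed

lemma tensor_kernel_submodule:
  assumes "vectorspace K M" "vectorspace K N"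
  shows "LinearCombinations.submodule K (tensor_kernel K M N) (free_space K (carrier M \<times> carrier N))"
proof -
  interpret M: vectorspace K M by fact
  interpret F: module K "free_space K (carrier M \<times> carrier N)" by (rule M.free_space_module)
  show ?thesis unfolding tensor_kernel_def
    by (rule F.span_is_submodule) (rule tensor_relations_closed assms)+
qed

lemma tensor_vs [intro, simp]:
  assumes "vectorspace K M" "vectorspace K N"
  shows "vectorspace K (M \<boxtimes>\<^bsub>K\<^esub> N)"
proof -
  interpret M: vectorspace K M by fact
  have "module K (M \<boxtimes>\<^bsub>K\<^esub> N)" unfolding tensor_def
    by (rule quotient_module[OF M.free_space_module tensor_kernel_submodule[OF assms]])
  then show ?thesis by (simp add: vectorspace_def M.field_axioms)
qed

lemma proj_hom:
  assumes "vectorspace K M" "vectorspace K N"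
  shows "(\<lambda>x. tensor_kernel K M N +>\<^bsub>free_space K (carrier M \<times> carrier N)\<^esub> x)
    \<in> module_hom K (free_space K (carrier M \<times> carrier N)) (M \<boxtimes>\<^bsub>K\<^esub> N)"
proof -
  interpret M: vectorspace K M by fact
  show ?thesis unfolding tensor_def
    by (rule quotient_proj[OF M.free_space_module tensor_kernel_submodule[OF assms]])
qed

lemma coset_eqI:
  assumes "module K V" "LinearCombinations.submodule K W V" "x \<in> carrier V" "y \<in> carrier V" "x \<ominus>\<^bsub>V\<^esub> y \<in> W"
  shows "W +>\<^bsub>V\<^esub> x = W +>\<^bsub>V\<^esub> y"
proof -
  interpret V: module K V by fact
  interpret S: abelian_subgroup W V by (rule submodule_subgroup) fact+
  have "x \<in> W +>\<^bsub>V\<^esub> y" using assms S.a_rcos_module[of y x] by (simp add: a_minus_def)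
  then show ?thesis using V.a_repr_independence[of x W y] S.a_subgroup assms by auto
qed

lemma pure_bilinear:
  assumes "vectorspace K M" "vectorspace K N"
  shows "bilinear_on K M N (M \<boxtimes>\<^bsub>K\<^esub> N) (pure_tensor K M N)"
proof -
  interpret M: vectorspace K M by fact
  interpret N: vectorspace K N by fact
  let ?F = "free_space K (carrier M \<times> carrier N)" and ?W = "tensor_kernel K M N"
  interpret F: module K ?F by (rule M.free_space_module)
  note sm = tensor_kernel_submodule[OF assms]
  note p = proj_hom[OF assms]
  have rel: "tensor_relations K M N \<subseteq> ?W" unfolding tensor_kernel_def
    by (rule F.in_own_span) (rule tensor_relations_closed assms)+
  note g = M.free_gen_closed
  note q = coset_eqI[OF M.free_space_module sm]
  have gc: "free_gen K (m, n) \<in> carrier ?F" if "m \<in> carrier M" "n \<in> carrier N" for m n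
    using that by (simp add: g)
  note cl = F.M.add.m_closed[simplified] F.smult_closed gc M.M.add.m_closed[simplified] N.M.add.m_closed[simplified] M.smult_closed N.smult_closed
  let ?g = "free_gen K"
  have r1: "?g (m \<oplus>\<^bsub>M\<^esub> m', n) \<ominus>\<^bsub>?F\<^esub> (?g (m, n) \<oplus>\<^bsub>?F\<^esub> ?g (m', n)) \<in> ?W"
    if "m \<in> carrier M" "m' \<in> carrier M" "n \<in> carrier N" for m m' n
    by (rule subsetD[OF rel]) (use that in \<open>unfold tensor_relations_def Let_def, blast\<close>)
  have r2: "?g (m, n \<oplus>\<^bsub>N\<^esub> n') \<ominus>\<^bsub>?F\<^esub> (?g (m, n) \<oplus>\<^bsub>?F\<^esub> ?g (m, n')) \<in> ?W"
    if "m \<in> carrier M" "n \<in> carrier N" "n' \<in> carrier N" for m n n'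
    by (rule subsetD[OF rel]) (use that in \<open>unfold tensor_relations_def Let_def, blast\<close>)
  have r3: "?g (a \<odot>\<^bsub>M\<^esub> m, n) \<ominus>\<^bsub>?F\<^esub> a \<odot>\<^bsub>?F\<^esub> ?g (m, n) \<in> ?W"
    if "a \<in> carrier K" "m \<in> carrier M" "n \<in> carrier N" for a m n
    by (rule subsetD[OF rel]) (use that in \<open>unfold tensor_relations_def Let_def, blast\<close>)
  have r4: "?g (m, a \<odot>\<^bsub>N\<^esub> n) \<ominus>\<^bsub>?F\<^esub> a \<odot>\<^bsub>?F\<^esub> ?g (m, n) \<in> ?W"
    if "a \<in> carrier K" "m \<in> carrier M" "n \<in> carrier N" for a m n
    by (rule subsetD[OF rel]) (use that in \<open>unfold tensor_relations_def Let_def, blast\<close>)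
  note pa = lin_add[OF p, symmetric] and ps = lin_smult[OF p, symmetric]
  show ?thesis
    unfolding bilinear_on_def
  proof (intro conjI ballI linI)
    fix m n m' assume *: "n \<in> carrier N" "m \<in> carrier M" "m' \<in> carrier M"
    show "pure_tensor K M N (m \<oplus>\<^bsub>M\<^esub> m') n = pure_tensor K M N m n \<oplus>\<^bsub>M \<boxtimes>\<^bsub>K\<^esub> N\<^esub> pure_tensor K M N m' n"
      unfolding pure_tensor_def pa[OF gc[OF *(2,1)] gc[OF *(3,1)]]
      by (intro q r1 cl *)
  next
    fix a m n assume *: "a \<in> carrier K" "n \<in> carrier N" "m \<in> carrier M"
    show "pure_tensor K M N (a \<odot>\<^bsub>M\<^esub> m) n = a \<odot>\<^bsub>M \<boxtimes>\<^bsub>K\<^esub> N\<^esub> pure_tensor K M N m n"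
      unfolding pure_tensor_def ps[OF *(1) gc[OF *(3,2)]]
      by (intro q r3 cl *)
  next
    fix m n n' assume *: "n \<in> carrier N" "n' \<in> carrier N" "m \<in> carrier M"
    show "pure_tensor K M N m (n \<oplus>\<^bsub>N\<^esub> n') = pure_tensor K M N m n \<oplus>\<^bsub>M \<boxtimes>\<^bsub>K\<^esub> N\<^esub> pure_tensor K M N m n'"
      unfolding pure_tensor_def pa[OF gc[OF *(3,1)] gc[OF *(3,2)]]
      by (intro q r2 cl *)
  next
    fix a m n assume *: "a \<in> carrier K" "n \<in> carrier N" "m \<in> carrier M"
    show "pure_tensor K M N m (a \<odot>\<^bsub>N\<^esub> n) = a \<odot>\<^bsub>M \<boxtimes>\<^bsub>K\<^esub> N\<^esub> pure_tensor K M N m n"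
      unfolding pure_tensor_def ps[OF *(1) gc[OF *(3,2)]]
      by (intro q r4 cl *)
  qed (auto simp: pure_tensor_def intro!: lin_closed[OF p] gc)
qed

lemma vs_module: "vectorspace K M \<Longrightarrow> module K M" by (simp add: vectorspace_def)
lemma vs_field: "vectorspace K M \<Longrightarrow> field K" by (simp add: vectorspace_def)

definition lin_ker where "lin_ker M N f = {x \<in> carrier M. f x = \<zero>\<^bsub>N\<^esub>}"

lemma lin_ker_submodule:
  assumes "module K M" "module K N" "f \<in> module_hom K M N"
  shows "LinearCombinations.submodule K (lin_ker M N f) M"
proof -
  interpret mod_hom K M N f using assms by (simp add: mod_hom_def mod_hom_axioms_def)
  show ?thesis using ker_is_submodule by (simp add: ker_def lin_ker_def)
qed

lemma lin_ker_minus: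
  assumes "module K M" "module K N" "f \<in> module_hom K M N"
    "x \<in> carrier M" "y \<in> carrier M" "f x = f y"
  shows "x \<ominus>\<^bsub>M\<^esub> y \<in> lin_ker M N f"
proof -
  interpret M: module K M by fact
  interpret N: module K N by fact
  have "f y \<ominus>\<^bsub>N\<^esub> f y = \<zero>\<^bsub>N\<^esub>" using lin_closed[OF assms(3,5)] by (simp add: a_minus_def N.M.r_neg)
  then show ?thesis using lin_minus[OF assms(1-5)] assms by (simp add: lin_ker_def)
qed

lemma kernel_le_ker:
  assumes "vectorspace K M" "vectorspace K N" "vectorspace K P" and \<beta>: "bilinear_on K M N P \<beta>"
  shows "tensor_kernel K M N \<subseteq> lin_ker (free_space K (carrier M \<times> carrier N)) P (free_eval K P (\<lambda>s. \<beta> (fst s) (snd s)))"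
proof -
  let ?F = "free_space K (carrier M \<times> carrier N)" and ?W = "tensor_kernel K M N"
  let ?e = "free_eval K P (\<lambda>s. \<beta> (fst s) (snd s))"
  note K = vs_field[OF assms(1)]
  note F = field.free_space_module[OF K, of "carrier M \<times> carrier N"] and P = vs_module[OF assms(3)]
  have B1: "(\<lambda>m. \<beta> m n) \<in> module_hom K M P" if "n \<in> carrier N" for n using \<beta> that by (simp add: bilinear_on_def)
  have B2: "\<beta> m \<in> module_hom K N P" if "m \<in> carrier M" for m using \<beta> that by (simp add: bilinear_on_def)
  have bc: "\<beta> (fst s) (snd s) \<in> carrier P" if "s \<in> carrier M \<times> carrier N" for s
    by (rule lin_closed[OF B2]) (use that in auto)
  note b1 = lin_add[OF B1] and b2 = lin_add[OF B2] and b3 = lin_smult[OF B1] and b4 = lin_smult[OF B2]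
  note Mm = vs_module[OF assms(1)] and Nm = vs_module[OF assms(2)]
  have cl: "a \<in> carrier K \<Longrightarrow> m \<in> carrier M \<Longrightarrow> a \<odot>\<^bsub>M\<^esub> m \<in> carrier M"
    "a \<in> carrier K \<Longrightarrow> n \<in> carrier N \<Longrightarrow> a \<odot>\<^bsub>N\<^esub> n \<in> carrier N"
    "m \<in> carrier M \<Longrightarrow> m' \<in> carrier M \<Longrightarrow> m \<oplus>\<^bsub>M\<^esub> m' \<in> carrier M"
    "n \<in> carrier N \<Longrightarrow> n' \<in> carrier N \<Longrightarrow> n \<oplus>\<^bsub>N\<^esub> n' \<in> carrier N"
    "a \<in> carrier K \<Longrightarrow> x \<in> carrier ?F \<Longrightarrow> a \<odot>\<^bsub>?F\<^esub> x \<in> carrier ?F"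
    "x \<in> carrier ?F \<Longrightarrow> y \<in> carrier ?F \<Longrightarrow> x \<oplus>\<^bsub>?F\<^esub> y \<in> carrier ?F" for a m n m' n' x y
    by (rule module.smult_closed[OF Mm] module.smult_closed[OF Nm] module.smult_closed[OF F]
        abelian_monoid.a_closed[OF abelian_group.axioms(1)[OF module.axioms(2)[OF Mm]]]
        abelian_monoid.a_closed[OF abelian_group.axioms(1)[OF module.axioms(2)[OF Nm]]]
        abelian_monoid.a_closed[OF abelian_group.axioms(1)[OF module.axioms(2)[OF F]]]; assumption)+
  have e: "?e \<in> module_hom K ?F P"
    by (rule free_eval_hom[OF K P bc])
  have eg: "?e (free_gen K (m, n)) = \<beta> m n" if "m \<in> carrier M" "n \<in> carrier N" for m n
    using free_eval_gen[OF K P, of "(m,n)" "carrier M \<times> carrier N" "\<lambda>s. \<beta> (fst s) (snd s)"] bc that by simp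
  have ea: "?e (x \<oplus>\<^bsub>?F\<^esub> y) = ?e x \<oplus>\<^bsub>P\<^esub> ?e y" if "x \<in> carrier ?F" "y \<in> carrier ?F" for x y
    by (rule lin_add[OF e that])
  have es: "?e (a \<odot>\<^bsub>?F\<^esub> x) = a \<odot>\<^bsub>P\<^esub> ?e x" if "a \<in> carrier K" "x \<in> carrier ?F" for a x
    by (rule lin_smult[OF e that])
  have gc: "free_gen K (m, n) \<in> carrier ?F" if "m \<in> carrier M" "n \<in> carrier N" for m n
    using that by (simp add: field.free_gen_closed[OF K])
  note kerI = lin_ker_minus[OF F P e]
  have "x \<in> lin_ker ?F P ?e" if "x \<in> tensor_relations K M N" for x
    using that unfolding tensor_relations_def Let_def Un_iff mem_Collect_eq
  proof (elim disjE exE conjE, goal_cases)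
    case (1 m m' n)
    show ?case unfolding 1(1) by (rule kerI) (simp_all add: gc ea eg b1 cl 1(2-))
  next
    case (2 m n n')
    show ?case unfolding 2(1) by (rule kerI) (simp_all add: gc ea eg b2 cl 2(2-))
  next
    case (3 a m n)
    show ?case unfolding 3(1) by (rule kerI) (simp_all add: gc es eg b3 cl 3(2-))
  next
    case (4 a m n)
    show ?case unfolding 4(1) by (rule kerI) (simp_all add: gc es eg b4 cl 4(2-))
  qed
  then have "tensor_relations K M N \<subseteq> lin_ker ?F P ?e" by blast
  then show ?thesis unfolding tensor_kernel_def
    by (rule module.span_is_subset[OF F _ lin_ker_submodule[OF F P e]])
qed

lemma
  assumes "vectorspace K M" "vectorspace K N" "vectorspace K P" and \<beta>: "bilinear_on K M N P \<beta>"
  shows lift_hom: "tensor_lift K P \<beta> \<in> module_hom K (M \<boxtimes>\<^bsub>K\<^esub> N) P"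
    and lift_pure: "m \<in> carrier M \<Longrightarrow> n \<in> carrier N \<Longrightarrow> tensor_lift K P \<beta> (pure_tensor K M N m n) = \<beta> m n"
proof -
  let ?F = "free_space K (carrier M \<times> carrier N)" and ?W = "tensor_kernel K M N"
  let ?e = "free_eval K P (\<lambda>s. \<beta> (fst s) (snd s))"
  note K = vs_field[OF assms(1)]
  note F = field.free_space_module[OF K, of "carrier M \<times> carrier N"] and P = vs_module[OF assms(3)]
  interpret P: module K P by fact
  interpret F: module K ?F by (rule F)
  note sm = tensor_kernel_submodule[OF assms(1,2)]
  note p = proj_hom[OF assms(1,2)]
  have B2: "\<beta> m \<in> module_hom K N P" if "m \<in> carrier M" for m using \<beta> that by (simp add: bilinear_on_def)
  have bc: "\<beta> (fst s) (snd s) \<in> carrier P" if "s \<in> carrier M \<times> carrier N" for s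
    by (rule lin_closed[OF B2]) (use that in auto)
  have e: "?e \<in> module_hom K ?F P"
    by (rule free_eval_hom[OF K P bc])
  have eg: "?e (free_gen K (m, n)) = \<beta> m n" if "m \<in> carrier M" "n \<in> carrier N" for m n
    using free_eval_gen[OF K P, of "(m,n)" "carrier M \<times> carrier N" "\<lambda>s. \<beta> (fst s) (snd s)"] bc that by simp
  note ker = kernel_le_ker[OF assms]
  have L: "tensor_lift K P \<beta> (?W +>\<^bsub>?F\<^esub> x) = ?e x" if x: "x \<in> carrier ?F" for x
  proof -
    have "?e y = ?e x" if y: "y \<in> ?W +>\<^bsub>?F\<^esub> x" for y
    proof -
      obtain w where w: "w \<in> ?W" "y = w \<oplus>\<^bsub>?F\<^esub> x" using y by (auto simp: a_r_coset_def')
      then have w': "w \<in> carrier ?F" "?e w = \<zero>\<^bsub>P\<^esub>" using ker unfolding lin_ker_def by blast+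
      have "?e y = \<zero>\<^bsub>P\<^esub> \<oplus>\<^bsub>P\<^esub> ?e x" unfolding w(2) lin_add[OF e w'(1) x] w'(2) ..
      then show ?thesis using lin_closed[OF e x] by simp
    qed
    moreover have "x \<in> ?W +>\<^bsub>?F\<^esub> x"
      using abelian_subgroup.a_rcos_self[OF submodule_subgroup[OF F sm] x] .
    ultimately have "?e ` (?W +>\<^bsub>?F\<^esub> x) = {?e x}" by blast
    then show ?thesis unfolding tensor_lift_def free_eval_def[symmetric] by (simp add: free_eval_def[abs_def])
  qed
  have car: "carrier (M \<boxtimes>\<^bsub>K\<^esub> N) = (\<lambda>x. ?W +>\<^bsub>?F\<^esub> x) ` carrier ?F"
    unfolding tensor_def by (rule quotient_carrier[OF F sm])
  show "tensor_lift K P \<beta> \<in> module_hom K (M \<boxtimes>\<^bsub>K\<^esub> N) P"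
    unfolding module_hom_def car
    by (auto simp: L lin_closed[OF e] lin_add[OF p, symmetric] lin_smult[OF p, symmetric] lin_add[OF e] lin_smult[OF e])
  show "tensor_lift K P \<beta> (pure_tensor K M N m n) = \<beta> m n" if "m \<in> carrier M" "n \<in> carrier N"
    unfolding pure_tensor_def using L[of "free_gen K (m,n)"] field.free_gen_closed[OF K, of "(m,n)"] that eg by simp
qed

lemma tensor_ext:
  assumes M: "vectorspace K M" and N: "vectorspace K N" and P: "vectorspace K P"
    and f: "f \<in> module_hom K (M \<boxtimes>\<^bsub>K\<^esub> N) P" and g: "g \<in> module_hom K (M \<boxtimes>\<^bsub>K\<^esub> N) P"
    and eq: "\<And>m n. m \<in> carrier M \<Longrightarrow> n \<in> carrier N \<Longrightarrow> f (pure_tensor K M N m n) = g (pure_tensor K M N m n)"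
    and x: "x \<in> carrier (M \<boxtimes>\<^bsub>K\<^esub> N)"
  shows "f x = g x"
proof -
  let ?F = "free_space K (carrier M \<times> carrier N)" and ?W = "tensor_kernel K M N"
  note K = vs_field[OF M]
  note F = field.free_space_module[OF K, of "carrier M \<times> carrier N"] and P = vs_module[OF P]
  interpret F: module K ?F by (rule F)
  note sm = tensor_kernel_submodule[OF M N]
  note p = proj_hom[OF M N]
  have "carrier (M \<boxtimes>\<^bsub>K\<^esub> N) = (\<lambda>x. ?W +>\<^bsub>?F\<^esub> x) ` carrier ?F"
    unfolding tensor_def by (rule quotient_carrier[OF F sm])
  then obtain v where v: "v \<in> carrier ?F" "x = ?W +>\<^bsub>?F\<^esub> v" using x by auto
  note f' = lin_comp[OF p f] and g' = lin_comp[OF p g]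
  have "f (?W +>\<^bsub>?F\<^esub> v) = g (?W +>\<^bsub>?F\<^esub> v)"
    using v(1)
  proof (induction v rule: field.free_induct[OF K, consumes 1, case_names zero add])
    case zero
    show ?case using lin_zero[OF F P f'] lin_zero[OF F P g'] by simp
  next
    case (add a s y)
    obtain m n where s: "s = (m,n)" "m \<in> carrier M" "n \<in> carrier N" using add by auto
    have gs: "free_gen K s \<in> carrier ?F" using add by (simp add: field.free_gen_closed[OF K])
    have "f (?W +>\<^bsub>?F\<^esub> free_gen K s) = g (?W +>\<^bsub>?F\<^esub> free_gen K s)"
      using eq[OF s(2,3)] by (simp add: pure_tensor_def s)
    then show ?case using add gs lin_smult[OF f', of a "free_gen K s"] lin_smult[OF g', of a "free_gen K s"] by (simp add: lin_add[OF f'] lin_add[OF g'])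
  qed
  then show ?thesis using v by simp
qed

lemma lin_id': "id \<in> module_hom K M M"
  by (auto simp: module_hom_def)

lemma
  assumes "vectorspace K M" "vectorspace K N"
  shows pure_hom_left: "n \<in> carrier N \<Longrightarrow> (\<lambda>m. pure_tensor K M N m n) \<in> module_hom K M (M \<boxtimes>\<^bsub>K\<^esub> N)"
    and pure_hom_right: "m \<in> carrier M \<Longrightarrow> pure_tensor K M N m \<in> module_hom K N (M \<boxtimes>\<^bsub>K\<^esub> N)"
    and pure_closed: "m \<in> carrier M \<Longrightarrow> n \<in> carrier N \<Longrightarrow> pure_tensor K M N m n \<in> carrier (M \<boxtimes>\<^bsub>K\<^esub> N)"
  using pure_bilinear[OF assms] by (auto simp: bilinear_on_def intro: lin_closed)

lemma bilinI:
  "(\<And>n. n \<in> carrier N \<Longrightarrow> (\<lambda>m. \<beta> m n) \<in> module_hom K M P) \<Longrightarrow>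
   (\<And>m. m \<in> carrier M \<Longrightarrow> \<beta> m \<in> module_hom K N P) \<Longrightarrow> bilinear_on K M N P \<beta>"
  by (simp add: bilinear_on_def)

context
  fixes K M N M' N' f g
  assumes vs: "vectorspace K M" "vectorspace K N" "vectorspace K M'" "vectorspace K N'"
    and f: "f \<in> module_hom K M M'" and g: "g \<in> module_hom K N N'"
begin

lemma map_bilin: "bilinear_on K M N (M' \<boxtimes>\<^bsub>K\<^esub> N') (\<lambda>m n. pure_tensor K M' N' (f m) (g n))"
  by (rule bilinI) (rule lin_comp[OF f] lin_comp[OF g] pure_hom_left pure_hom_right lin_closed[OF f] lin_closed[OF g] vs; assumption?)+

lemma map_hom: "tensor_map K M' N' f g \<in> module_hom K (M \<boxtimes>\<^bsub>K\<^esub> N) (M' \<boxtimes>\<^bsub>K\<^esub> N')"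
  unfolding tensor_map_def by (rule lift_hom[OF vs(1,2) tensor_vs[OF vs(3,4)] map_bilin])

lemma map_pure: "m \<in> carrier M \<Longrightarrow> n \<in> carrier N \<Longrightarrow>
    tensor_map K M' N' f g (pure_tensor K M N m n) = pure_tensor K M' N' (f m) (g n)"
  unfolding tensor_map_def by (rule lift_pure[OF vs(1,2) tensor_vs[OF vs(3,4)] map_bilin])

end

lemma map_comp:
  assumes vs: "vectorspace K M" "vectorspace K N" "vectorspace K M'" "vectorspace K N'" "vectorspace K M''" "vectorspace K N''"
    and f: "f \<in> module_hom K M M'" and g: "g \<in> module_hom K N N'"
    and f': "f' \<in> module_hom K M' M''" and g': "g' \<in> module_hom K N' N''"
    and x: "x \<in> carrier (M \<boxtimes>\<^bsub>K\<^esub> N)"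
  shows "tensor_map K M'' N'' f' g' (tensor_map K M' N' f g x) = tensor_map K M'' N'' (\<lambda>m. f' (f m)) (\<lambda>n. g' (g n)) x"
  by (rule tensor_ext[OF vs(1,2) tensor_vs[OF vs(5,6)] _ _ _ x])
    (auto intro!: lin_comp[OF map_hom map_hom] map_hom lin_comp[OF f f'] lin_comp[OF g g'] vs f g f' g'
      simp: map_pure vs f g f' g' lin_comp[OF f f'] lin_comp[OF g g'] lin_closed[OF f] lin_closed[OF g])

lemma map_id:
  assumes vs: "vectorspace K M" "vectorspace K N" and x: "x \<in> carrier (M \<boxtimes>\<^bsub>K\<^esub> N)"
  shows "tensor_map K M N id id x = x"
  by (rule tensor_ext[OF vs tensor_vs[OF vs] map_hom[OF vs vs lin_id' lin_id'] lin_id _ x])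
    (simp only: map_pure[OF vs vs lin_id' lin_id'], simp)

lemma map_cong:
  assumes vs: "vectorspace K M" "vectorspace K N" "vectorspace K M'" "vectorspace K N'"
    and f: "f \<in> module_hom K M M'" and g: "g \<in> module_hom K N N'"
    and f': "f' \<in> module_hom K M M'" and g': "g' \<in> module_hom K N N'"
    and eq: "\<And>m. m \<in> carrier M \<Longrightarrow> f m = f' m" "\<And>n. n \<in> carrier N \<Longrightarrow> g n = g' n"
    and x: "x \<in> carrier (M \<boxtimes>\<^bsub>K\<^esub> N)"
  shows "tensor_map K M' N' f g x = tensor_map K M' N' f' g' x"
  by (rule tensor_ext[OF vs(1,2) tensor_vs[OF vs(3,4)] _ _ _ x])
    (auto intro!: map_hom vs f g f' g' simp: map_pure vs f g f' g' eq)

lemma lift_param_left: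
  assumes vs: "vectorspace K A" "vectorspace K B" "vectorspace K N" "vectorspace K P"
    and b: "\<And>n. n \<in> carrier N \<Longrightarrow> bilinear_on K A B P (\<lambda>a b. \<gamma> a b n)"
    and l: "\<And>a b. a \<in> carrier A \<Longrightarrow> b \<in> carrier B \<Longrightarrow> \<gamma> a b \<in> module_hom K N P"
  shows "bilinear_on K (A \<boxtimes>\<^bsub>K\<^esub> B) N P (\<lambda>t n. tensor_lift K P (\<lambda>a b. \<gamma> a b n) t)"
proof (rule bilinI)
  show "(\<lambda>t. tensor_lift K P (\<lambda>a b. \<gamma> a b n) t) \<in> module_hom K (A \<boxtimes>\<^bsub>K\<^esub> B) P" if "n \<in> carrier N" for n
    by (rule lift_hom[OF vs(1,2,4) b[OF that]])
  fix t assume t: "t \<in> carrier (A \<boxtimes>\<^bsub>K\<^esub> B)"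
  interpret P: module K P by (rule vs_module[OF vs(4)])
  note L = lift_hom[OF vs(1,2,4) b] and Lp = lift_pure[OF vs(1,2,4) b]
  have addh: "(\<lambda>x. f x \<oplus>\<^bsub>P\<^esub> g x) \<in> module_hom K (A \<boxtimes>\<^bsub>K\<^esub> B) P"
    if f: "f \<in> module_hom K (A \<boxtimes>\<^bsub>K\<^esub> B) P" and g: "g \<in> module_hom K (A \<boxtimes>\<^bsub>K\<^esub> B) P" for f g
    by (rule linI) (simp_all add: lin_closed[OF f] lin_closed[OF g] lin_add[OF f] lin_add[OF g]
        lin_smult[OF f] lin_smult[OF g] P.smult_r_distr P.M.add.m_ac)
  have smh: "(\<lambda>x. a \<odot>\<^bsub>P\<^esub> f x) \<in> module_hom K (A \<boxtimes>\<^bsub>K\<^esub> B) P"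
    if f: "f \<in> module_hom K (A \<boxtimes>\<^bsub>K\<^esub> B) P" and a: "a \<in> carrier K" for f a
    by (rule linI) (simp_all add: a lin_closed[OF f] lin_add[OF f] lin_smult[OF f] P.smult_r_distr
        P.smult_assoc1[symmetric] P.R.m_comm)
  interpret N: module K N by (rule vs_module[OF vs(3)])
  show "(\<lambda>n. tensor_lift K P (\<lambda>a b. \<gamma> a b n) t) \<in> module_hom K N P"
  proof (rule linI)
    fix n assume n: "n \<in> carrier N"
    show "tensor_lift K P (\<lambda>a b. \<gamma> a b n) t \<in> carrier P" by (rule lin_closed[OF L[OF n] t])
  next
    fix n n' assume n: "n \<in> carrier N" "n' \<in> carrier N"
    then have nn: "n \<oplus>\<^bsub>N\<^esub> n' \<in> carrier N" by simp
    show "tensor_lift K P (\<lambda>a b. \<gamma> a b (n \<oplus>\<^bsub>N\<^esub> n')) t =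
       tensor_lift K P (\<lambda>a b. \<gamma> a b n) t \<oplus>\<^bsub>P\<^esub> tensor_lift K P (\<lambda>a b. \<gamma> a b n') t"
      by (rule tensor_ext[OF vs(1,2,4) L[OF nn] addh[OF L[OF n(1)] L[OF n(2)]] _ t])
        (simp add: Lp nn n lin_add[OF l])
  next
    fix a n assume n: "a \<in> carrier K" "n \<in> carrier N"
    then have nn: "a \<odot>\<^bsub>N\<^esub> n \<in> carrier N" by simp
    show "tensor_lift K P (\<lambda>x y. \<gamma> x y (a \<odot>\<^bsub>N\<^esub> n)) t = a \<odot>\<^bsub>P\<^esub> tensor_lift K P (\<lambda>x y. \<gamma> x y n) t"
      by (rule tensor_ext[OF vs(1,2,4) L[OF nn] smh[OF L[OF n(2)] n(1)] _ t])
        (simp add: Lp nn n lin_smult[OF l])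
  qed
qed

lemma lift_param_right:
  assumes vs: "vectorspace K A" "vectorspace K B" "vectorspace K N" "vectorspace K P"
    and b: "\<And>n. n \<in> carrier N \<Longrightarrow> bilinear_on K A B P (\<lambda>a b. \<gamma> n a b)"
    and l: "\<And>a b. a \<in> carrier A \<Longrightarrow> b \<in> carrier B \<Longrightarrow> (\<lambda>n. \<gamma> n a b) \<in> module_hom K N P"
  shows "bilinear_on K N (A \<boxtimes>\<^bsub>K\<^esub> B) P (\<lambda>n t. tensor_lift K P (\<lambda>a b. \<gamma> n a b) t)"
  using lift_param_left[OF vs, of "\<lambda>a b n. \<gamma> n a b"] b l by (simp add: bilinear_on_def)

context
  fixes K and L :: "('k, 'a, 'l) module_scheme" and M :: "('k, 'b, 'm) module_scheme" and N :: "('k, 'c, 'n) module_scheme"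
  assumes vs: "vectorspace K L" "vectorspace K M" "vectorspace K N"
begin

lemma assoc_right_bilin:
  "n \<in> carrier N \<Longrightarrow> bilinear_on K L M (L \<boxtimes>\<^bsub>K\<^esub> (M \<boxtimes>\<^bsub>K\<^esub> N)) (\<lambda>l m. pure_tensor K L (M \<boxtimes>\<^bsub>K\<^esub> N) l (pure_tensor K M N m n))"
  by (rule bilinI)
    (intro pure_hom_left lin_comp[OF pure_hom_left pure_hom_right] pure_closed tensor_vs vs; assumption)+

lemma assoc_right_bilin2:
  "bilinear_on K (L \<boxtimes>\<^bsub>K\<^esub> M) N (L \<boxtimes>\<^bsub>K\<^esub> (M \<boxtimes>\<^bsub>K\<^esub> N)) (\<lambda>t n. tensor_lift K (L \<boxtimes>\<^bsub>K\<^esub> (M \<boxtimes>\<^bsub>K\<^esub> N))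
        (\<lambda>l m. pure_tensor K L (M \<boxtimes>\<^bsub>K\<^esub> N) l (pure_tensor K M N m n)) t)"
  by (rule lift_param_left[OF vs tensor_vs[OF vs(1) tensor_vs[OF vs(2,3)]] assoc_right_bilin], assumption,
    intro lin_comp[OF pure_hom_right pure_hom_right] tensor_vs vs pure_closed; assumption)

lemma assoc_right_hom: "assoc_right K L M N \<in> module_hom K ((L \<boxtimes>\<^bsub>K\<^esub> M) \<boxtimes>\<^bsub>K\<^esub> N) (L \<boxtimes>\<^bsub>K\<^esub> (M \<boxtimes>\<^bsub>K\<^esub> N))"
  unfolding assoc_right_def Let_def
  by (rule lift_hom[OF tensor_vs[OF vs(1,2)] vs(3) tensor_vs[OF vs(1) tensor_vs[OF vs(2,3)]] assoc_right_bilin2])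

lemma assoc_right_pure:
  assumes "l \<in> carrier L" "m \<in> carrier M" "n \<in> carrier N"
  shows "assoc_right K L M N (pure_tensor K (L \<boxtimes>\<^bsub>K\<^esub> M) N (pure_tensor K L M l m) n) =
    pure_tensor K L (M \<boxtimes>\<^bsub>K\<^esub> N) l (pure_tensor K M N m n)"
  unfolding assoc_right_def Let_def
  by (simp add: assms vs lift_pure[OF tensor_vs[OF vs(1,2)] vs(3) tensor_vs[OF vs(1) tensor_vs[OF vs(2,3)]] assoc_right_bilin2]
      lift_pure[OF vs(1,2) tensor_vs[OF vs(1) tensor_vs[OF vs(2,3)]] assoc_right_bilin] pure_closed)

lemma assoc_left_bilin:
  "l \<in> carrier L \<Longrightarrow> bilinear_on K M N ((L \<boxtimes>\<^bsub>K\<^esub> M) \<boxtimes>\<^bsub>K\<^esub> N) (\<lambda>m n. pure_tensor K (L \<boxtimes>\<^bsub>K\<^esub> M) N (pure_tensor K L M l m) n)"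
  by (rule bilinI)
    (intro pure_hom_right lin_comp[OF pure_hom_right pure_hom_left] pure_closed tensor_vs vs; assumption)+

lemma assoc_left_bilin2:
  "bilinear_on K L (M \<boxtimes>\<^bsub>K\<^esub> N) ((L \<boxtimes>\<^bsub>K\<^esub> M) \<boxtimes>\<^bsub>K\<^esub> N) (\<lambda>l t. tensor_lift K ((L \<boxtimes>\<^bsub>K\<^esub> M) \<boxtimes>\<^bsub>K\<^esub> N)
        (\<lambda>m n. pure_tensor K (L \<boxtimes>\<^bsub>K\<^esub> M) N (pure_tensor K L M l m) n) t)"
  by (rule lift_param_right[OF vs(2,3,1) tensor_vs[OF tensor_vs[OF vs(1,2)] vs(3)] assoc_left_bilin], assumption,
    intro lin_comp[OF pure_hom_left pure_hom_left] tensor_vs vs pure_closed; assumption)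

lemma assoc_left_hom: "assoc_left K L M N \<in> module_hom K (L \<boxtimes>\<^bsub>K\<^esub> (M \<boxtimes>\<^bsub>K\<^esub> N)) ((L \<boxtimes>\<^bsub>K\<^esub> M) \<boxtimes>\<^bsub>K\<^esub> N)"
  unfolding assoc_left_def Let_def
  by (rule lift_hom[OF vs(1) tensor_vs[OF vs(2,3)] tensor_vs[OF tensor_vs[OF vs(1,2)] vs(3)] assoc_left_bilin2])

lemma assoc_left_pure:
  assumes "l \<in> carrier L" "m \<in> carrier M" "n \<in> carrier N"
  shows "assoc_left K L M N (pure_tensor K L (M \<boxtimes>\<^bsub>K\<^esub> N) l (pure_tensor K M N m n)) =
    pure_tensor K (L \<boxtimes>\<^bsub>K\<^esub> M) N (pure_tensor K L M l m) n"
  unfolding assoc_left_def Let_def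
  by (simp add: assms vs lift_pure[OF vs(1) tensor_vs[OF vs(2,3)] tensor_vs[OF tensor_vs[OF vs(1,2)] vs(3)] assoc_left_bilin2]
      lift_pure[OF vs(2,3) tensor_vs[OF tensor_vs[OF vs(1,2)] vs(3)] assoc_left_bilin] pure_closed)

end

lemma tensor_ext3:
  assumes vs: "vectorspace K L" "vectorspace K M" "vectorspace K N" "vectorspace K P"
    and f: "f \<in> module_hom K (L \<boxtimes>\<^bsub>K\<^esub> (M \<boxtimes>\<^bsub>K\<^esub> N)) P" and g: "g \<in> module_hom K (L \<boxtimes>\<^bsub>K\<^esub> (M \<boxtimes>\<^bsub>K\<^esub> N)) P"
    and eq: "\<And>l m n. l \<in> carrier L \<Longrightarrow> m \<in> carrier M \<Longrightarrow> n \<in> carrier N \<Longrightarrow>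
      f (pure_tensor K L (M \<boxtimes>\<^bsub>K\<^esub> N) l (pure_tensor K M N m n)) = g (pure_tensor K L (M \<boxtimes>\<^bsub>K\<^esub> N) l (pure_tensor K M N m n))"
    and x: "x \<in> carrier (L \<boxtimes>\<^bsub>K\<^esub> (M \<boxtimes>\<^bsub>K\<^esub> N))"
  shows "f x = g x"
proof (rule tensor_ext[OF vs(1) tensor_vs[OF vs(2,3)] vs(4) f g _ x])
  fix l t assume l: "l \<in> carrier L" and t: "t \<in> carrier (M \<boxtimes>\<^bsub>K\<^esub> N)"
  note h = pure_hom_right[OF vs(1) tensor_vs[OF vs(2,3)] l]
  show "f (pure_tensor K L (M \<boxtimes>\<^bsub>K\<^esub> N) l t) = g (pure_tensor K L (M \<boxtimes>\<^bsub>K\<^esub> N) l t)"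
    by (rule tensor_ext[OF vs(2,3,4) lin_comp[OF h f] lin_comp[OF h g] _ t]) (rule eq[OF l])
qed

lemma tensor_ext3':
  assumes vs: "vectorspace K L" "vectorspace K M" "vectorspace K N" "vectorspace K P"
    and f: "f \<in> module_hom K ((L \<boxtimes>\<^bsub>K\<^esub> M) \<boxtimes>\<^bsub>K\<^esub> N) P" and g: "g \<in> module_hom K ((L \<boxtimes>\<^bsub>K\<^esub> M) \<boxtimes>\<^bsub>K\<^esub> N) P"
    and eq: "\<And>l m n. l \<in> carrier L \<Longrightarrow> m \<in> carrier M \<Longrightarrow> n \<in> carrier N \<Longrightarrow>
      f (pure_tensor K (L \<boxtimes>\<^bsub>K\<^esub> M) N (pure_tensor K L M l m) n) = g (pure_tensor K (L \<boxtimes>\<^bsub>K\<^esub> M) N (pure_tensor K L M l m) n)"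
    and x: "x \<in> carrier ((L \<boxtimes>\<^bsub>K\<^esub> M) \<boxtimes>\<^bsub>K\<^esub> N)"
  shows "f x = g x"
proof (rule tensor_ext[OF tensor_vs[OF vs(1,2)] vs(3,4) f g _ x])
  fix n t assume n: "n \<in> carrier N" and t: "t \<in> carrier (L \<boxtimes>\<^bsub>K\<^esub> M)"
  note h = pure_hom_left[OF tensor_vs[OF vs(1,2)] vs(3) n]
  show "f (pure_tensor K (L \<boxtimes>\<^bsub>K\<^esub> M) N t n) = g (pure_tensor K (L \<boxtimes>\<^bsub>K\<^esub> M) N t n)"
    by (rule tensor_ext[OF vs(1,2,4) lin_comp[OF h f] lin_comp[OF h g] _ t]) (rule eq[OF _ _ n])
qed

lemma assoc_right_nat:
  assumes vs: "vectorspace K L" "vectorspace K M" "vectorspace K N" "vectorspace K L'" "vectorspace K M'" "vectorspace K N'"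
    and f: "f \<in> module_hom K L L'" and g: "g \<in> module_hom K M M'" and h: "h \<in> module_hom K N N'"
    and x: "x \<in> carrier ((L \<boxtimes>\<^bsub>K\<^esub> M) \<boxtimes>\<^bsub>K\<^esub> N)"
  shows "assoc_right K L' M' N' (tensor_map K (L' \<boxtimes>\<^bsub>K\<^esub> M') N' (tensor_map K L' M' f g) h x) =
    tensor_map K L' (M' \<boxtimes>\<^bsub>K\<^esub> N') f (tensor_map K M' N' g h) (assoc_right K L M N x)"
  by (rule tensor_ext3'[OF vs(1,2,3) _ _ _ _ x, where P="L' \<boxtimes>\<^bsub>K\<^esub> (M' \<boxtimes>\<^bsub>K\<^esub> N')"])
    (auto intro!: lin_comp[OF map_hom assoc_right_hom] lin_comp[OF assoc_right_hom map_hom] map_hom vs f g h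
      simp: map_pure[of K] assoc_right_pure map_hom vs f g h pure_closed lin_closed[OF f] lin_closed[OF g] lin_closed[OF h])

lemma assoc_left_nat:
  assumes vs: "vectorspace K L" "vectorspace K M" "vectorspace K N" "vectorspace K L'" "vectorspace K M'" "vectorspace K N'"
    and f: "f \<in> module_hom K L L'" and g: "g \<in> module_hom K M M'" and h: "h \<in> module_hom K N N'"
    and x: "x \<in> carrier (L \<boxtimes>\<^bsub>K\<^esub> (M \<boxtimes>\<^bsub>K\<^esub> N))"
  shows "assoc_left K L' M' N' (tensor_map K L' (M' \<boxtimes>\<^bsub>K\<^esub> N') f (tensor_map K M' N' g h) x) =
    tensor_map K (L' \<boxtimes>\<^bsub>K\<^esub> M') N' (tensor_map K L' M' f g) h (assoc_left K L M N x)"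
  by (rule tensor_ext3[OF vs(1,2,3) _ _ _ _ x, where P="(L' \<boxtimes>\<^bsub>K\<^esub> M') \<boxtimes>\<^bsub>K\<^esub> N'"])
    (auto intro!: lin_comp[OF map_hom assoc_left_hom] lin_comp[OF assoc_left_hom map_hom] map_hom vs f g h
      simp: map_pure[of K] assoc_left_pure map_hom vs f g h pure_closed lin_closed[OF f] lin_closed[OF g] lin_closed[OF h])

lemma assoc_right_left:
  assumes vs: "vectorspace K L" "vectorspace K M" "vectorspace K N"
    and x: "x \<in> carrier (L \<boxtimes>\<^bsub>K\<^esub> (M \<boxtimes>\<^bsub>K\<^esub> N))"
  shows "assoc_right K L M N (assoc_left K L M N x) = x"
  by (rule tensor_ext3[OF vs tensor_vs[OF vs(1) tensor_vs[OF vs(2,3)]] lin_comp[OF assoc_left_hom assoc_right_hom] lin_id _ x])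
    (auto simp: vs assoc_left_pure assoc_right_pure)

lemma assoc_left_right:
  assumes vs: "vectorspace K L" "vectorspace K M" "vectorspace K N"
    and x: "x \<in> carrier ((L \<boxtimes>\<^bsub>K\<^esub> M) \<boxtimes>\<^bsub>K\<^esub> N)"
  shows "assoc_left K L M N (assoc_right K L M N x) = x"
  by (rule tensor_ext3'[OF vs tensor_vs[OF tensor_vs[OF vs(1,2)] vs(3)] lin_comp[OF assoc_right_hom assoc_left_hom] lin_id _ x])
    (auto simp: vs assoc_left_pure assoc_right_pure)

context
  fixes K and C :: "('k, 'c, 'm) module_scheme" and D :: "('k, 'd, 'n) module_scheme"
    and \<Delta>C \<epsilon>C \<Delta>D \<epsilon>D
  assumes C: "coalgebra K C \<Delta>C \<epsilon>C" and D: "coalgebra K D \<Delta>D \<epsilon>D"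
begin

lemma vC: "vectorspace K C" and vD: "vectorspace K D"
  using C D by (simp_all add: coalgebra_def)

lemma hC: "\<Delta>C \<in> module_hom K C (C \<boxtimes>\<^bsub>K\<^esub> C)" and hD: "\<Delta>D \<in> module_hom K D (D \<boxtimes>\<^bsub>K\<^esub> D)"
  using C D by (simp_all add: coalgebra_def coalgebra_axioms_def coassociative_coproduct_def)

lemma coactL_bilin: "bilinear_on K C D (D \<boxtimes>\<^bsub>K\<^esub> (C \<boxtimes>\<^bsub>K\<^esub> D)) (\<lambda>c d. tensor_lift K (D \<boxtimes>\<^bsub>K\<^esub> (C \<boxtimes>\<^bsub>K\<^esub> D))
        (\<lambda>d\<^sub>1 d\<^sub>2. pure_tensor K D (C \<boxtimes>\<^bsub>K\<^esub> D) d\<^sub>1 (pure_tensor K C D c d\<^sub>2)) (\<Delta>D d))"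
proof -
  let ?P = "D \<boxtimes>\<^bsub>K\<^esub> (C \<boxtimes>\<^bsub>K\<^esub> D)"
  note v = vC vD tensor_vs
  have b: "bilinear_on K C (D \<boxtimes>\<^bsub>K\<^esub> D) ?P (\<lambda>c t. tensor_lift K ?P
        (\<lambda>d\<^sub>1 d\<^sub>2. pure_tensor K D (C \<boxtimes>\<^bsub>K\<^esub> D) d\<^sub>1 (pure_tensor K C D c d\<^sub>2)) t)"
    by (rule lift_param_right)
      (auto intro!: bilinI pure_hom_left lin_comp[OF pure_hom_right pure_hom_right] lin_comp[OF pure_hom_left pure_hom_right] pure_closed v)
  show ?thesis
    by (rule bilinI) (use b in \<open>auto simp: bilinear_on_def intro: lin_comp[OF hD] lin_closed[OF hD]\<close>)
qed

lemma coactR_bilin: "bilinear_on K C D ((C \<boxtimes>\<^bsub>K\<^esub> D) \<boxtimes>\<^bsub>K\<^esub> C) (\<lambda>c d. tensor_lift K ((C \<boxtimes>\<^bsub>K\<^esub> D) \<boxtimes>\<^bsub>K\<^esub> C)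
        (\<lambda>c\<^sub>1 c\<^sub>2. pure_tensor K (C \<boxtimes>\<^bsub>K\<^esub> D) C (pure_tensor K C D c\<^sub>1 d) c\<^sub>2) (\<Delta>C c))"
proof -
  let ?P = "(C \<boxtimes>\<^bsub>K\<^esub> D) \<boxtimes>\<^bsub>K\<^esub> C"
  note v = vC vD tensor_vs
  have b: "bilinear_on K (C \<boxtimes>\<^bsub>K\<^esub> C) D ?P (\<lambda>t d. tensor_lift K ?P
        (\<lambda>c\<^sub>1 c\<^sub>2. pure_tensor K (C \<boxtimes>\<^bsub>K\<^esub> D) C (pure_tensor K C D c\<^sub>1 d) c\<^sub>2) t)"
    by (rule lift_param_left)
      (auto intro!: bilinI pure_hom_right lin_comp[OF pure_hom_left pure_hom_left] lin_comp[OF pure_hom_right pure_hom_left] pure_closed v)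
  show ?thesis
    by (rule bilinI) (use b in \<open>auto simp: bilinear_on_def intro: lin_comp[OF hC] lin_closed[OF hC]\<close>)
qed

end

lemma lift_map:
  assumes vs: "vectorspace K M" "vectorspace K N" "vectorspace K M'" "vectorspace K N'" "vectorspace K P"
    and f: "f \<in> module_hom K M M'" and g: "g \<in> module_hom K N N'" and b: "bilinear_on K M' N' P \<beta>"
    and x: "x \<in> carrier (M \<boxtimes>\<^bsub>K\<^esub> N)"
  shows "tensor_lift K P \<beta> (tensor_map K M' N' f g x) = tensor_lift K P (\<lambda>m n. \<beta> (f m) (g n)) x"
proof -
  have b': "bilinear_on K M N P (\<lambda>m n. \<beta> (f m) (g n))"
    by (rule bilinI) (use b in \<open>auto simp: bilinear_on_def intro: lin_comp[OF f] lin_comp[OF g] lin_closed[OF f] lin_closed[OF g]\<close>)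
  show ?thesis
    by (rule tensor_ext[OF vs(1,2,5) lin_comp[OF map_hom[OF vs(1-4) f g] lift_hom[OF vs(3-5) b]] lift_hom[OF vs(1,2,5) b'] _ x])
      (simp add: map_pure[OF vs(1-4) f g] lift_pure[OF vs(3-5) b] lift_pure[OF vs(1,2,5) b'] lin_closed[OF f] lin_closed[OF g])
qed

lemma hom_lift:
  assumes vs: "vectorspace K M" "vectorspace K N" "vectorspace K P" "vectorspace K Q"
    and b: "bilinear_on K M N P \<beta>" and h: "h \<in> module_hom K P Q"
    and x: "x \<in> carrier (M \<boxtimes>\<^bsub>K\<^esub> N)"
  shows "h (tensor_lift K P \<beta> x) = tensor_lift K Q (\<lambda>m n. h (\<beta> m n)) x"
proof -
  have b': "bilinear_on K M N Q (\<lambda>m n. h (\<beta> m n))"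
    by (rule bilinI) (use b in \<open>auto simp: bilinear_on_def intro: lin_comp[OF _ h]\<close>)
  show ?thesis
    by (rule tensor_ext[OF vs(1,2,4) lin_comp[OF lift_hom[OF vs(1-3) b] h] lift_hom[OF vs(1,2,4) b'] _ x])
      (simp add: lift_pure[OF vs(1-3) b] lift_pure[OF vs(1,2,4) b'])
qed

lemma lift_cong:
  assumes vs: "vectorspace K M" "vectorspace K N" "vectorspace K P"
    and b: "bilinear_on K M N P \<beta>" and b': "bilinear_on K M N P \<gamma>"
    and eq: "\<And>m n. m \<in> carrier M \<Longrightarrow> n \<in> carrier N \<Longrightarrow> \<beta> m n = \<gamma> m n"
    and x: "x \<in> carrier (M \<boxtimes>\<^bsub>K\<^esub> N)"
  shows "tensor_lift K P \<beta> x = tensor_lift K P \<gamma> x"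
  by (rule tensor_ext[OF vs lift_hom[OF vs b] lift_hom[OF vs b'] _ x])
    (simp add: eq lift_pure[OF vs b] lift_pure[OF vs b'])

lemma counit_bilin:
  assumes "\<epsilon> \<in> module_hom K C (ground_space K)" "vectorspace K M"
  shows "bilinear_on K C M M (\<lambda>c y. \<epsilon> c \<odot>\<^bsub>M\<^esub> y)" "bilinear_on K M C M (\<lambda>y c. \<epsilon> c \<odot>\<^bsub>M\<^esub> y)"
proof -
  interpret M: module K M by (rule vs_module) fact
  have e: "\<And>c. c \<in> carrier C \<Longrightarrow> \<epsilon> c \<in> carrier K"
    "\<And>c d. c \<in> carrier C \<Longrightarrow> d \<in> carrier C \<Longrightarrow> \<epsilon> (c \<oplus>\<^bsub>C\<^esub> d) = \<epsilon> c \<oplus>\<^bsub>K\<^esub> \<epsilon> d"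
    "\<And>a c. a \<in> carrier K \<Longrightarrow> c \<in> carrier C \<Longrightarrow> \<epsilon> (a \<odot>\<^bsub>C\<^esub> c) = a \<otimes>\<^bsub>K\<^esub> \<epsilon> c"
    using assms(1) by (auto simp: module_hom_def ground_space_def)
  show "bilinear_on K C M M (\<lambda>c y. \<epsilon> c \<odot>\<^bsub>M\<^esub> y)" "bilinear_on K M C M (\<lambda>y c. \<epsilon> c \<odot>\<^bsub>M\<^esub> y)"
    by (auto simp: bilinear_on_def e M.smult_l_distr M.smult_r_distr M.smult_assoc1[symmetric] M.R.m_comm intro!: linI)
qed

lemma assoc_right_nat_right:
  assumes vs: "vectorspace K L" "vectorspace K M" "vectorspace K N" "vectorspace K N'"
    and h: "h \<in> module_hom K N N'"
    and x: "x \<in> carrier ((L \<boxtimes>\<^bsub>K\<^esub> M) \<boxtimes>\<^bsub>K\<^esub> N)"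
  shows "assoc_right K L M N' (tensor_map K (L \<boxtimes>\<^bsub>K\<^esub> M) N' id h x) =
    tensor_map K L (M \<boxtimes>\<^bsub>K\<^esub> N') id (tensor_map K M N' id h) (assoc_right K L M N x)"
proof -
  have m: "tensor_map K L M id id \<in> module_hom K (L \<boxtimes>\<^bsub>K\<^esub> M) (L \<boxtimes>\<^bsub>K\<^esub> M)"
    by (rule map_hom[OF vs(1,2,1,2) lin_id' lin_id'])
  have "tensor_map K (L \<boxtimes>\<^bsub>K\<^esub> M) N' id h x = tensor_map K (L \<boxtimes>\<^bsub>K\<^esub> M) N' (tensor_map K L M id id) h x"
    by (rule map_cong[OF tensor_vs[OF vs(1,2)] vs(3) tensor_vs[OF vs(1,2)] vs(4) lin_id' h m h _ _ x])
      (simp_all only: map_id[OF vs(1,2)] id_apply)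
  then show ?thesis using assoc_right_nat[OF vs(1-3) vs(1,2,4) lin_id' lin_id' h x] by simp
qed

lemma left_crit:
  assumes D: "coalgebra K D \<Delta> \<epsilon>" and M: "vectorspace K M" and l: "l \<in> module_hom K M (D \<boxtimes>\<^bsub>K\<^esub> M)"
    and h: "h \<in> module_hom K D M" and eq: "\<And>d. d \<in> carrier D \<Longrightarrow> l (h d) = tensor_map K D M id h (\<Delta> d)"
    and d: "d \<in> carrier D"
  shows "assoc_right K D D M (tensor_map K (D \<boxtimes>\<^bsub>K\<^esub> D) M \<Delta> id (l (h d))) =
        tensor_map K D (D \<boxtimes>\<^bsub>K\<^esub> M) id l (l (h d))"
    "tensor_lift K M (\<lambda>d y. \<epsilon> d \<odot>\<^bsub>M\<^esub> y) (l (h d)) = h d"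
proof -
  have v: "vectorspace K D" using D by (simp add: coalgebra_def)
  have De: "\<Delta> \<in> module_hom K D (D \<boxtimes>\<^bsub>K\<^esub> D)" "assoc_right K D D D (tensor_map K (D \<boxtimes>\<^bsub>K\<^esub> D) D \<Delta> id (\<Delta> d)) =
      tensor_map K D (D \<boxtimes>\<^bsub>K\<^esub> D) id \<Delta> (\<Delta> d)" "\<epsilon> \<in> module_hom K D (ground_space K)"
      "tensor_lift K D (\<lambda>a b. \<epsilon> a \<odot>\<^bsub>D\<^esub> b) (\<Delta> d) = d"
    using D d by (simp_all add: coalgebra_def coalgebra_axioms_def coassociative_coproduct_def)
  have t: "\<Delta> d \<in> carrier (D \<boxtimes>\<^bsub>K\<^esub> D)" by (rule lin_closed[OF De(1) d])
  have t2: "tensor_map K (D \<boxtimes>\<^bsub>K\<^esub> D) D \<Delta> id (\<Delta> d) \<in> carrier ((D \<boxtimes>\<^bsub>K\<^esub> D) \<boxtimes>\<^bsub>K\<^esub> D)"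
    by (rule lin_closed[OF map_hom t]) (auto simp: v De lin_id')
  note s = v M h l De(1) lin_id' lin_id map_hom
  have "tensor_map K (D \<boxtimes>\<^bsub>K\<^esub> D) M \<Delta> id (tensor_map K D M id h (\<Delta> d)) =
     tensor_map K (D \<boxtimes>\<^bsub>K\<^esub> D) M id h (tensor_map K (D \<boxtimes>\<^bsub>K\<^esub> D) D \<Delta> id (\<Delta> d))"
    by (simp add: map_comp[where M=D and N=D] s t id_def[symmetric])
  then have "assoc_right K D D M (tensor_map K (D \<boxtimes>\<^bsub>K\<^esub> D) M \<Delta> id (l (h d))) =
     tensor_map K D (D \<boxtimes>\<^bsub>K\<^esub> M) id (tensor_map K D M id h) (tensor_map K D (D \<boxtimes>\<^bsub>K\<^esub> D) id \<Delta> (\<Delta> d))"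
    by (simp add: eq d assoc_right_nat_right[OF v v v M h t2] De(2))
  also have "\<dots> = tensor_map K D (D \<boxtimes>\<^bsub>K\<^esub> M) id (\<lambda>x. tensor_map K D M id h (\<Delta> x)) (\<Delta> d)"
    by (simp add: map_comp[where M=D and N=D] s t id_def[symmetric])
  also have "\<dots> = tensor_map K D (D \<boxtimes>\<^bsub>K\<^esub> M) id (\<lambda>x. l (h x)) (\<Delta> d)"
    by (rule map_cong[OF _ _ _ _ _ _ _ _ _ _ t]) (auto simp: s eq intro: lin_comp[OF De(1) map_hom] lin_comp[OF h l])
  also have "\<dots> = tensor_map K D (D \<boxtimes>\<^bsub>K\<^esub> M) id l (tensor_map K D M id h (\<Delta> d))"
    by (simp add: map_comp[where M=D and N=D] s t id_def[symmetric])
  finally show "assoc_right K D D M (tensor_map K (D \<boxtimes>\<^bsub>K\<^esub> D) M \<Delta> id (l (h d))) =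
        tensor_map K D (D \<boxtimes>\<^bsub>K\<^esub> M) id l (l (h d))" by (simp add: eq d)
  note b = counit_bilin(1)[OF De(3) M] counit_bilin(1)[OF De(3) v]
  have "tensor_lift K M (\<lambda>d y. \<epsilon> d \<odot>\<^bsub>M\<^esub> y) (l (h d)) = tensor_lift K M (\<lambda>a b. \<epsilon> a \<odot>\<^bsub>M\<^esub> h b) (\<Delta> d)"
    by (simp add: eq d lift_map[OF v v v M M lin_id' h b(1) t])
  also have "\<dots> = tensor_lift K M (\<lambda>a b. h (\<epsilon> a \<odot>\<^bsub>D\<^esub> b)) (\<Delta> d)"
  proof (rule lift_cong[OF v v M _ _ _ t])
    have e: "\<And>c. c \<in> carrier D \<Longrightarrow> \<epsilon> c \<in> carrier K"
      using De(3) by (auto simp: module_hom_def ground_space_def)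
    show "bilinear_on K D D M (\<lambda>a b. \<epsilon> a \<odot>\<^bsub>M\<^esub> h b)"
      using b(1) by (auto simp: bilinear_on_def intro: lin_comp[OF h] lin_closed[OF h])
    show "bilinear_on K D D M (\<lambda>a b. h (\<epsilon> a \<odot>\<^bsub>D\<^esub> b))"
      using b(2) by (auto simp: bilinear_on_def intro: lin_comp[OF _ h])
    show "\<And>m n. m \<in> carrier D \<Longrightarrow> n \<in> carrier D \<Longrightarrow> \<epsilon> m \<odot>\<^bsub>M\<^esub> h n = h (\<epsilon> m \<odot>\<^bsub>D\<^esub> n)"
      by (simp add: e lin_smult[OF h])
  qed
  also have "\<dots> = h d" by (simp add: hom_lift[OF v v v M b(2) h t, symmetric] De(4))
  finally show "tensor_lift K M (\<lambda>d y. \<epsilon> d \<odot>\<^bsub>M\<^esub> y) (l (h d)) = h d" .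
qed

lemma right_crit:
  assumes D: "coalgebra K D \<Delta> \<epsilon>" and M: "vectorspace K M" and l: "l \<in> module_hom K M (M \<boxtimes>\<^bsub>K\<^esub> D)"
    and h: "h \<in> module_hom K D M" and eq: "\<And>d. d \<in> carrier D \<Longrightarrow> l (h d) = tensor_map K M D h id (\<Delta> d)"
    and d: "d \<in> carrier D"
  shows "assoc_right K M D D (tensor_map K (M \<boxtimes>\<^bsub>K\<^esub> D) D l id (l (h d))) =
        tensor_map K M (D \<boxtimes>\<^bsub>K\<^esub> D) id \<Delta> (l (h d))"
    "tensor_lift K M (\<lambda>y d. \<epsilon> d \<odot>\<^bsub>M\<^esub> y) (l (h d)) = h d"
proof -
  have v: "vectorspace K D" using D by (simp add: coalgebra_def)
  have De: "\<Delta> \<in> module_hom K D (D \<boxtimes>\<^bsub>K\<^esub> D)" "assoc_right K D D D (tensor_map K (D \<boxtimes>\<^bsub>K\<^esub> D) D \<Delta> id (\<Delta> d)) =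
      tensor_map K D (D \<boxtimes>\<^bsub>K\<^esub> D) id \<Delta> (\<Delta> d)" "\<epsilon> \<in> module_hom K D (ground_space K)"
      "tensor_lift K D (\<lambda>a b. \<epsilon> b \<odot>\<^bsub>D\<^esub> a) (\<Delta> d) = d"
    using D d by (simp_all add: coalgebra_def coalgebra_axioms_def coassociative_coproduct_def)
  have t: "\<Delta> d \<in> carrier (D \<boxtimes>\<^bsub>K\<^esub> D)" by (rule lin_closed[OF De(1) d])
  have t2: "tensor_map K (D \<boxtimes>\<^bsub>K\<^esub> D) D \<Delta> id (\<Delta> d) \<in> carrier ((D \<boxtimes>\<^bsub>K\<^esub> D) \<boxtimes>\<^bsub>K\<^esub> D)"
    by (rule lin_closed[OF map_hom t]) (auto simp: v De lin_id')
  note s = v M h l De(1) lin_id' lin_id map_hom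
  have i: "tensor_map K D D id id \<in> module_hom K (D \<boxtimes>\<^bsub>K\<^esub> D) (D \<boxtimes>\<^bsub>K\<^esub> D)" by (rule map_hom[OF v v v v lin_id' lin_id'])
  have "tensor_map K (M \<boxtimes>\<^bsub>K\<^esub> D) D l id (tensor_map K M D h id (\<Delta> d)) =
     tensor_map K (M \<boxtimes>\<^bsub>K\<^esub> D) D (\<lambda>x. l (h x)) id (\<Delta> d)"
    by (simp add: map_comp[where M=D and N=D] s t id_def[symmetric])
  also have "\<dots> = tensor_map K (M \<boxtimes>\<^bsub>K\<^esub> D) D (\<lambda>x. tensor_map K M D h id (\<Delta> x)) id (\<Delta> d)"
    by (rule map_cong[OF _ _ _ _ _ _ _ _ _ _ t]) (auto simp: s eq intro: lin_comp[OF De(1) map_hom] lin_comp[OF h l])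
  also have "\<dots> = tensor_map K (M \<boxtimes>\<^bsub>K\<^esub> D) D (tensor_map K M D h id) id (tensor_map K (D \<boxtimes>\<^bsub>K\<^esub> D) D \<Delta> id (\<Delta> d))"
    by (simp add: map_comp[where M=D and N=D] s t id_def[symmetric])
  finally have "assoc_right K M D D (tensor_map K (M \<boxtimes>\<^bsub>K\<^esub> D) D l id (l (h d))) =
     tensor_map K M (D \<boxtimes>\<^bsub>K\<^esub> D) h (tensor_map K D D id id) (tensor_map K D (D \<boxtimes>\<^bsub>K\<^esub> D) id \<Delta> (\<Delta> d))"
    by (simp add: eq d assoc_right_nat[OF v v v M v v h lin_id' lin_id' t2] De(2))
  also have "\<dots> = tensor_map K M (D \<boxtimes>\<^bsub>K\<^esub> D) h (\<lambda>x. tensor_map K D D id id (\<Delta> x)) (\<Delta> d)"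
    by (simp add: map_comp[where M=D and N=D] s t id_def[symmetric])
  also have "\<dots> = tensor_map K M (D \<boxtimes>\<^bsub>K\<^esub> D) h \<Delta> (\<Delta> d)"
    by (rule map_cong[OF v v M tensor_vs[OF v v] h lin_comp[OF De(1) i] h De(1) refl map_id[OF v v lin_closed[OF De(1)]] t])
  also have "\<dots> = tensor_map K M (D \<boxtimes>\<^bsub>K\<^esub> D) id \<Delta> (tensor_map K M D h id (\<Delta> d))"
    by (simp add: map_comp[where M=D and N=D] s t id_def[symmetric])
  finally show "assoc_right K M D D (tensor_map K (M \<boxtimes>\<^bsub>K\<^esub> D) D l id (l (h d))) =
        tensor_map K M (D \<boxtimes>\<^bsub>K\<^esub> D) id \<Delta> (l (h d))" by (simp add: eq d)
  note b = counit_bilin(2)[OF De(3) M] counit_bilin(2)[OF De(3) v]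
  have "tensor_lift K M (\<lambda>y d. \<epsilon> d \<odot>\<^bsub>M\<^esub> y) (l (h d)) = tensor_lift K M (\<lambda>b a. \<epsilon> a \<odot>\<^bsub>M\<^esub> h b) (\<Delta> d)"
    by (simp add: eq d lift_map[OF v v M v M h lin_id' b(1) t])
  also have "\<dots> = tensor_lift K M (\<lambda>b a. h (\<epsilon> a \<odot>\<^bsub>D\<^esub> b)) (\<Delta> d)"
  proof (rule lift_cong[OF v v M _ _ _ t])
    have e: "\<And>c. c \<in> carrier D \<Longrightarrow> \<epsilon> c \<in> carrier K"
      using De(3) by (auto simp: module_hom_def ground_space_def)
    show "bilinear_on K D D M (\<lambda>b a. \<epsilon> a \<odot>\<^bsub>M\<^esub> h b)"
      using b(1) by (auto simp: bilinear_on_def intro: lin_comp[OF h] lin_closed[OF h])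
    show "bilinear_on K D D M (\<lambda>b a. h (\<epsilon> a \<odot>\<^bsub>D\<^esub> b))"
      using b(2) by (auto simp: bilinear_on_def intro: lin_comp[OF _ h])
    show "\<And>n m. n \<in> carrier D \<Longrightarrow> m \<in> carrier D \<Longrightarrow> \<epsilon> m \<odot>\<^bsub>M\<^esub> h n = h (\<epsilon> m \<odot>\<^bsub>D\<^esub> n)"
      by (simp add: e lin_smult[OF h])
  qed
  also have "\<dots> = h d" by (simp add: hom_lift[OF v v v M b(2) h t, symmetric] De(4))
  finally show "tensor_lift K M (\<lambda>y d. \<epsilon> d \<odot>\<^bsub>M\<^esub> y) (l (h d)) = h d" .
qed

context
  fixes K and C :: "('k, 'c, 'm) module_scheme" and D :: "('k, 'd, 'n) module_scheme"
    and \<Delta>C \<epsilon>C \<Delta>D \<epsilon>D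
  assumes C: "coalgebra K C \<Delta>C \<epsilon>C" and D: "coalgebra K D \<Delta>D \<epsilon>D"
begin

lemmas vs' = vC[OF C D] vD[OF C D]
lemmas hC' = hC[OF C D] and hD' = hD[OF C D]
lemma left_CD_hom: "left_coaction_CD K C D \<Delta>D \<in> module_hom K (C \<boxtimes>\<^bsub>K\<^esub> D) (D \<boxtimes>\<^bsub>K\<^esub> (C \<boxtimes>\<^bsub>K\<^esub> D))"
  unfolding left_coaction_CD_def Let_def
  by (rule lift_hom[OF _ _ _ coactL_bilin[OF C D]]) (simp_all add: vs')

lemma right_CD_hom: "right_coaction_CD K C D \<Delta>C \<in> module_hom K (C \<boxtimes>\<^bsub>K\<^esub> D) ((C \<boxtimes>\<^bsub>K\<^esub> D) \<boxtimes>\<^bsub>K\<^esub> C)"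
  unfolding right_coaction_CD_def Let_def
  by (rule lift_hom[OF _ _ _ coactR_bilin[OF C D]]) (simp_all add: vs')

lemma left_CD_pure: "c \<in> carrier C \<Longrightarrow> d \<in> carrier D \<Longrightarrow>
  left_coaction_CD K C D \<Delta>D (pure_tensor K C D c d) = tensor_map K D (C \<boxtimes>\<^bsub>K\<^esub> D) id (pure_tensor K C D c) (\<Delta>D d)"
  unfolding left_coaction_CD_def Let_def tensor_map_def id_apply
  by (subst lift_pure[OF _ _ _ coactL_bilin[OF C D]]) (simp_all add: vs')

lemma right_CD_pure: "c \<in> carrier C \<Longrightarrow> d \<in> carrier D \<Longrightarrow>
  right_coaction_CD K C D \<Delta>C (pure_tensor K C D c d) = tensor_map K (C \<boxtimes>\<^bsub>K\<^esub> D) C (\<lambda>c. pure_tensor K C D c d) id (\<Delta>C c)"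
  unfolding right_coaction_CD_def Let_def tensor_map_def id_apply
  by (subst lift_pure[OF _ _ _ coactR_bilin[OF C D]]) (simp_all add: vs')

lemma left_DC_hom: "left_coaction_DC K D C \<Delta>D \<in> module_hom K (D \<boxtimes>\<^bsub>K\<^esub> C) (D \<boxtimes>\<^bsub>K\<^esub> (D \<boxtimes>\<^bsub>K\<^esub> C))"
  unfolding left_coaction_DC_def comp_def
  by (rule lin_comp[OF map_hom assoc_right_hom]) (simp_all add: vs' hD' lin_id')

lemma right_DC_hom: "right_coaction_DC K D C \<Delta>C \<in> module_hom K (D \<boxtimes>\<^bsub>K\<^esub> C) ((D \<boxtimes>\<^bsub>K\<^esub> C) \<boxtimes>\<^bsub>K\<^esub> C)"
  unfolding right_coaction_DC_def comp_def
  by (rule lin_comp[OF map_hom assoc_left_hom]) (simp_all add: vs' hC' lin_id')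

lemma left_DC_pure:
  assumes c: "c \<in> carrier C" and d: "d \<in> carrier D"
  shows "left_coaction_DC K D C \<Delta>D (pure_tensor K D C d c) = tensor_map K D (D \<boxtimes>\<^bsub>K\<^esub> C) id (\<lambda>d. pure_tensor K D C d c) (\<Delta>D d)"
proof -
  have t: "\<Delta>D d \<in> carrier (D \<boxtimes>\<^bsub>K\<^esub> D)" by (rule lin_closed[OF hD' d])
  have h: "(\<lambda>d. pure_tensor K D C d c) \<in> module_hom K D (D \<boxtimes>\<^bsub>K\<^esub> C)" by (rule pure_hom_left[OF vs'(2,1) c])
  have "assoc_right K D D C (pure_tensor K (D \<boxtimes>\<^bsub>K\<^esub> D) C x c) = tensor_map K D (D \<boxtimes>\<^bsub>K\<^esub> C) id (\<lambda>d. pure_tensor K D C d c) x"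
    if "x \<in> carrier (D \<boxtimes>\<^bsub>K\<^esub> D)" for x
    by (rule tensor_ext[OF vs'(2) vs'(2) _ lin_comp[OF pure_hom_left assoc_right_hom] map_hom _ that])
      (simp_all add: vs' h lin_id' c assoc_right_pure map_pure[where M=D and N=D])
  from this[OF t] show ?thesis
    by (simp add: left_coaction_DC_def map_pure[where M=D and N=C] vs' hD' lin_id' c d)
qed

lemma right_DC_pure:
  assumes c: "c \<in> carrier C" and d: "d \<in> carrier D"
  shows "right_coaction_DC K D C \<Delta>C (pure_tensor K D C d c) = tensor_map K (D \<boxtimes>\<^bsub>K\<^esub> C) C (pure_tensor K D C d) id (\<Delta>C c)"
proof -
  have t: "\<Delta>C c \<in> carrier (C \<boxtimes>\<^bsub>K\<^esub> C)" by (rule lin_closed[OF hC' c])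
  have h: "pure_tensor K D C d \<in> module_hom K C (D \<boxtimes>\<^bsub>K\<^esub> C)" by (rule pure_hom_right[OF vs'(2,1) d])
  have "assoc_left K D C C (pure_tensor K D (C \<boxtimes>\<^bsub>K\<^esub> C) d x) = tensor_map K (D \<boxtimes>\<^bsub>K\<^esub> C) C (pure_tensor K D C d) id x"
    if "x \<in> carrier (C \<boxtimes>\<^bsub>K\<^esub> C)" for x
    by (rule tensor_ext[OF vs'(1) vs'(1) _ lin_comp[OF pure_hom_right assoc_left_hom] map_hom _ that])
      (simp_all add: vs' h lin_id' d assoc_left_pure map_pure[where M=C and N=C])
  from this[OF t] show ?thesis
    by (simp add: right_coaction_DC_def map_pure[where M=D and N=C] vs' hC' lin_id' c d)
qed

end

lemma left_comodule_ext:
  assumes vs: "vectorspace K M" "vectorspace K N" and D: "coalgebra K D \<Delta> \<epsilon>"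
    and l: "l \<in> module_hom K (M \<boxtimes>\<^bsub>K\<^esub> N) (D \<boxtimes>\<^bsub>K\<^esub> (M \<boxtimes>\<^bsub>K\<^esub> N))"
    and p: "\<And>m n. m \<in> carrier M \<Longrightarrow> n \<in> carrier N \<Longrightarrow>
      (\<exists>h\<in>module_hom K D (M \<boxtimes>\<^bsub>K\<^esub> N). \<exists>d\<in>carrier D. pure_tensor K M N m n = h d \<and>
         (\<forall>d\<in>carrier D. l (h d) = tensor_map K D (M \<boxtimes>\<^bsub>K\<^esub> N) id h (\<Delta> d)))"
  shows "left_comodule K D \<Delta> \<epsilon> (M \<boxtimes>\<^bsub>K\<^esub> N) l"
proof -
  let ?P = "M \<boxtimes>\<^bsub>K\<^esub> N"
  have v: "vectorspace K D" using D by (simp add: coalgebra_def)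
  have hs: "\<Delta> \<in> module_hom K D (D \<boxtimes>\<^bsub>K\<^esub> D)" "\<epsilon> \<in> module_hom K D (ground_space K)"
    using D by (simp_all add: coalgebra_def coalgebra_axioms_def coassociative_coproduct_def)
  have vP: "vectorspace K ?P" using vs by simp
  show ?thesis unfolding left_comodule_def
  proof (intro conjI ballI vP l)
    fix x assume x: "x \<in> carrier ?P"
    show "assoc_right K D D ?P (tensor_map K (D \<boxtimes>\<^bsub>K\<^esub> D) ?P \<Delta> id (l x)) =
        tensor_map K D (D \<boxtimes>\<^bsub>K\<^esub> ?P) id l (l x)"
    proof (rule tensor_ext[OF vs _ lin_comp[OF l lin_comp[OF map_hom assoc_right_hom]] lin_comp[OF l map_hom] _ x])
      fix m n assume mn: "m \<in> carrier M" "n \<in> carrier N"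
      obtain h d where *: "h \<in> module_hom K D ?P" "d \<in> carrier D" "pure_tensor K M N m n = h d"
         "\<And>d. d\<in>carrier D \<Longrightarrow> l (h d) = tensor_map K D (M \<boxtimes>\<^bsub>K\<^esub> N) id h (\<Delta> d)" using p[OF mn] by blast
      show "assoc_right K D D ?P (tensor_map K (D \<boxtimes>\<^bsub>K\<^esub> D) ?P \<Delta> id (l (pure_tensor K M N m n))) =
        tensor_map K D (D \<boxtimes>\<^bsub>K\<^esub> ?P) id l (l (pure_tensor K M N m n))"
        unfolding *(3) by (rule left_crit(1)[OF D vP l *(1,4,2)])
    qed (simp_all add: v vP hs l lin_id')
    show "tensor_lift K ?P (\<lambda>d y. \<epsilon> d \<odot>\<^bsub>?P\<^esub> y) (l x) = x"
    proof (rule tensor_ext[OF vs vP lin_comp[OF l lift_hom[OF v vP vP counit_bilin(1)[OF hs(2) vP]]] lin_id _ x])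
      fix m n assume mn: "m \<in> carrier M" "n \<in> carrier N"
      obtain h d where *: "h \<in> module_hom K D ?P" "d \<in> carrier D" "pure_tensor K M N m n = h d"
         "\<And>d. d\<in>carrier D \<Longrightarrow> l (h d) = tensor_map K D (M \<boxtimes>\<^bsub>K\<^esub> N) id h (\<Delta> d)" using p[OF mn] by blast
      show "tensor_lift K ?P (\<lambda>d y. \<epsilon> d \<odot>\<^bsub>?P\<^esub> y) (l (pure_tensor K M N m n)) = pure_tensor K M N m n"
        unfolding *(3) by (rule left_crit(2)[OF D vP l *(1,4,2)])
    qed
  qed
qed

lemma right_comodule_ext:
  assumes vs: "vectorspace K M" "vectorspace K N" and D: "coalgebra K D \<Delta> \<epsilon>"
    and l: "l \<in> module_hom K (M \<boxtimes>\<^bsub>K\<^esub> N) ((M \<boxtimes>\<^bsub>K\<^esub> N) \<boxtimes>\<^bsub>K\<^esub> D)"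
    and p: "\<And>m n. m \<in> carrier M \<Longrightarrow> n \<in> carrier N \<Longrightarrow>
      (\<exists>h\<in>module_hom K D (M \<boxtimes>\<^bsub>K\<^esub> N). \<exists>d\<in>carrier D. pure_tensor K M N m n = h d \<and>
         (\<forall>d\<in>carrier D. l (h d) = tensor_map K (M \<boxtimes>\<^bsub>K\<^esub> N) D h id (\<Delta> d)))"
  shows "right_comodule K D \<Delta> \<epsilon> (M \<boxtimes>\<^bsub>K\<^esub> N) l"
proof -
  let ?P = "M \<boxtimes>\<^bsub>K\<^esub> N"
  have v: "vectorspace K D" using D by (simp add: coalgebra_def)
  have hs: "\<Delta> \<in> module_hom K D (D \<boxtimes>\<^bsub>K\<^esub> D)" "\<epsilon> \<in> module_hom K D (ground_space K)"
    using D by (simp_all add: coalgebra_def coalgebra_axioms_def coassociative_coproduct_def)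
  have vP: "vectorspace K ?P" using vs by simp
  show ?thesis unfolding right_comodule_def
  proof (intro conjI ballI vP l)
    fix x assume x: "x \<in> carrier ?P"
    show "assoc_right K ?P D D (tensor_map K (?P \<boxtimes>\<^bsub>K\<^esub> D) D l id (l x)) =
        tensor_map K ?P (D \<boxtimes>\<^bsub>K\<^esub> D) id \<Delta> (l x)"
    proof (rule tensor_ext[OF vs _ lin_comp[OF l lin_comp[OF map_hom assoc_right_hom]] lin_comp[OF l map_hom] _ x])
      fix m n assume mn: "m \<in> carrier M" "n \<in> carrier N"
      obtain h d where *: "h \<in> module_hom K D ?P" "d \<in> carrier D" "pure_tensor K M N m n = h d"
         "\<And>d. d\<in>carrier D \<Longrightarrow> l (h d) = tensor_map K (M \<boxtimes>\<^bsub>K\<^esub> N) D h id (\<Delta> d)" using p[OF mn] by blast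
      show "assoc_right K ?P D D (tensor_map K (?P \<boxtimes>\<^bsub>K\<^esub> D) D l id (l (pure_tensor K M N m n))) =
        tensor_map K ?P (D \<boxtimes>\<^bsub>K\<^esub> D) id \<Delta> (l (pure_tensor K M N m n))"
        unfolding *(3) by (rule right_crit(1)[OF D vP l *(1,4,2)])
    qed (simp_all add: v vP hs l lin_id')
    show "tensor_lift K ?P (\<lambda>y d. \<epsilon> d \<odot>\<^bsub>?P\<^esub> y) (l x) = x"
    proof (rule tensor_ext[OF vs vP lin_comp[OF l lift_hom[OF vP v vP counit_bilin(2)[OF hs(2) vP]]] lin_id _ x])
      fix m n assume mn: "m \<in> carrier M" "n \<in> carrier N"
      obtain h d where *: "h \<in> module_hom K D ?P" "d \<in> carrier D" "pure_tensor K M N m n = h d"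
         "\<And>d. d\<in>carrier D \<Longrightarrow> l (h d) = tensor_map K (M \<boxtimes>\<^bsub>K\<^esub> N) D h id (\<Delta> d)" using p[OF mn] by blast
      show "tensor_lift K ?P (\<lambda>y d. \<epsilon> d \<odot>\<^bsub>?P\<^esub> y) (l (pure_tensor K M N m n)) = pure_tensor K M N m n"
        unfolding *(3) by (rule right_crit(2)[OF D vP l *(1,4,2)])
    qed
  qed
qed

lemma map_param_right:
  assumes vs: "vectorspace K A" "vectorspace K B" "vectorspace K X" "vectorspace K N"
    and b: "bilinear_on K N B X \<kappa>" and s: "s \<in> carrier (A \<boxtimes>\<^bsub>K\<^esub> B)"
  shows "(\<lambda>n. tensor_map K A X id (\<kappa> n) s) \<in> module_hom K N (A \<boxtimes>\<^bsub>K\<^esub> X)"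
proof -
  have b1: "\<And>y. y \<in> carrier B \<Longrightarrow> (\<lambda>n. \<kappa> n y) \<in> module_hom K N X"
    and b2: "\<And>n. n \<in> carrier N \<Longrightarrow> \<kappa> n \<in> module_hom K B X" using b by (simp_all add: bilinear_on_def)
  have "bilinear_on K N (A \<boxtimes>\<^bsub>K\<^esub> B) (A \<boxtimes>\<^bsub>K\<^esub> X) (\<lambda>n t. tensor_lift K (A \<boxtimes>\<^bsub>K\<^esub> X) (\<lambda>a b. pure_tensor K A X a (\<kappa> n b)) t)"
  proof (rule lift_param_right[OF vs(1,2,4) tensor_vs[OF vs(1,3)]])
    fix n assume n: "n \<in> carrier N"
    show "bilinear_on K A B (A \<boxtimes>\<^bsub>K\<^esub> X) (\<lambda>a b. pure_tensor K A X a (\<kappa> n b))"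
      by (rule bilinI, rule pure_hom_left[OF vs(1,3) lin_closed[OF b2[OF n]]], assumption,
          rule lin_comp[OF b2[OF n] pure_hom_right[OF vs(1,3)]])
  next
    fix a y assume "a \<in> carrier A" "y \<in> carrier B"
    then show "(\<lambda>n. pure_tensor K A X a (\<kappa> n y)) \<in> module_hom K N (A \<boxtimes>\<^bsub>K\<^esub> X)"
      by (intro lin_comp[OF b1 pure_hom_right[OF vs(1,3)]])
  qed
  then show ?thesis using s by (simp add: bilinear_on_def tensor_map_def)
qed

lemma map_param_left:
  assumes vs: "vectorspace K A" "vectorspace K B" "vectorspace K X" "vectorspace K N"
    and b: "bilinear_on K A N X \<kappa>" and s: "s \<in> carrier (A \<boxtimes>\<^bsub>K\<^esub> B)"
  shows "(\<lambda>n. tensor_map K X B (\<lambda>a. \<kappa> a n) id s) \<in> module_hom K N (X \<boxtimes>\<^bsub>K\<^esub> B)"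
proof -
  have b1: "\<And>n. n \<in> carrier N \<Longrightarrow> (\<lambda>a. \<kappa> a n) \<in> module_hom K A X"
    and b2: "\<And>a. a \<in> carrier A \<Longrightarrow> \<kappa> a \<in> module_hom K N X" using b by (simp_all add: bilinear_on_def)
  have "bilinear_on K N (A \<boxtimes>\<^bsub>K\<^esub> B) (X \<boxtimes>\<^bsub>K\<^esub> B) (\<lambda>n t. tensor_lift K (X \<boxtimes>\<^bsub>K\<^esub> B) (\<lambda>a b. pure_tensor K X B (\<kappa> a n) b) t)"
  proof (rule lift_param_right[OF vs(1,2,4) tensor_vs[OF vs(3,2)]])
    fix n assume n: "n \<in> carrier N"
    show "bilinear_on K A B (X \<boxtimes>\<^bsub>K\<^esub> B) (\<lambda>a b. pure_tensor K X B (\<kappa> a n) b)"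
      by (rule bilinI, rule lin_comp[OF b1[OF n] pure_hom_left[OF vs(3,2)]], assumption,
          rule pure_hom_right[OF vs(3,2) lin_closed[OF b1[OF n]]])
  next
    fix a y assume "a \<in> carrier A" "y \<in> carrier B"
    then show "(\<lambda>n. pure_tensor K X B (\<kappa> a n) y) \<in> module_hom K N (X \<boxtimes>\<^bsub>K\<^esub> B)"
      by (intro lin_comp[OF b2 pure_hom_left[OF vs(3,2)]])
  qed
  then show ?thesis using s by (simp add: bilinear_on_def tensor_map_def)
qed

lemma coaction_swap:
  assumes vs: "vectorspace K C" "vectorspace K D" "vectorspace K M" and b: "bilinear_on K C D M \<kappa>"
    and t: "t \<in> carrier (C \<boxtimes>\<^bsub>K\<^esub> C)" and s: "s \<in> carrier (D \<boxtimes>\<^bsub>K\<^esub> D)"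
  shows "assoc_right K D M C (tensor_map K (D \<boxtimes>\<^bsub>K\<^esub> M) C (\<lambda>c. tensor_map K D M id (\<kappa> c) s) id t) =
    tensor_map K D (M \<boxtimes>\<^bsub>K\<^esub> C) id (\<lambda>d. tensor_map K M C (\<lambda>c. \<kappa> c d) id t) s"
proof -
  have b1: "\<And>d. d \<in> carrier D \<Longrightarrow> (\<lambda>c. \<kappa> c d) \<in> module_hom K C M"
    and b2: "\<And>c. c \<in> carrier C \<Longrightarrow> \<kappa> c \<in> module_hom K D M" using b by (simp_all add: bilinear_on_def)
  note MC = tensor_vs[OF vs(3,1)] and DM = tensor_vs[OF vs(2,3)]
  have k: "(\<lambda>c. tensor_map K D M id (\<kappa> c) s) \<in> module_hom K C (D \<boxtimes>\<^bsub>K\<^esub> M)" if "s \<in> carrier (D \<boxtimes>\<^bsub>K\<^esub> D)" for s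
    by (rule map_param_right[OF vs(2,2,3,1) b that])
  have n: "(\<lambda>d. tensor_map K M C (\<lambda>c. \<kappa> c d) id t) \<in> module_hom K D (M \<boxtimes>\<^bsub>K\<^esub> C)" if "t \<in> carrier (C \<boxtimes>\<^bsub>K\<^esub> C)" for t
    by (rule map_param_left[OF vs(1,1,3,2) b that])
  have nb: "bilinear_on K (C \<boxtimes>\<^bsub>K\<^esub> C) D (M \<boxtimes>\<^bsub>K\<^esub> C) (\<lambda>t d. tensor_map K M C (\<lambda>c. \<kappa> c d) id t)"
    by (rule bilinI[OF map_hom[OF vs(1,1,3,1) b1 lin_id'] n])
  note lhs = lin_comp[OF map_hom[OF vs(1,1) DM vs(1) k[OF s] lin_id'] assoc_right_hom[OF vs(2,3,1)]]
  note rhs = map_param_right[OF vs(2,2) MC tensor_vs[OF vs(1,1)] nb s]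
  show ?thesis
  proof (rule tensor_ext[OF vs(1,1) tensor_vs[OF vs(2) MC] lhs rhs _ t])
    fix c1 c2 assume c: "c1 \<in> carrier C" "c2 \<in> carrier C"
    have cc: "pure_tensor K C C c1 c2 \<in> carrier (C \<boxtimes>\<^bsub>K\<^esub> C)" by (rule pure_closed[OF vs(1,1) c])
    have nc: "tensor_map K M C (\<lambda>c. \<kappa> c d) id (pure_tensor K C C c1 c2) = pure_tensor K M C (\<kappa> c1 d) c2"
      if "d \<in> carrier D" for d
      using map_pure[OF vs(1,1,3,1) b1[OF that] lin_id' c] by simp
    note rhs = map_hom[OF vs(2,2,2) MC lin_id' n[OF cc]]
    note lhs = lin_comp[OF lin_comp[OF map_hom[OF vs(2,2,2,3) lin_id' b2[OF c(1)]] pure_hom_left[OF DM vs(1) c(2)]] assoc_right_hom[OF vs(2,3,1)]]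
    have "assoc_right K D M C (pure_tensor K (D \<boxtimes>\<^bsub>K\<^esub> M) C (tensor_map K D M id (\<kappa> c1) s) c2) =
       tensor_map K D (M \<boxtimes>\<^bsub>K\<^esub> C) id (\<lambda>d. tensor_map K M C (\<lambda>c. \<kappa> c d) id (pure_tensor K C C c1 c2)) s"
    proof (rule tensor_ext[OF vs(2,2) tensor_vs[OF vs(2) MC] lhs rhs _ s])
      fix d1 d2 assume d: "d1 \<in> carrier D" "d2 \<in> carrier D"
      show "assoc_right K D M C (pure_tensor K (D \<boxtimes>\<^bsub>K\<^esub> M) C (tensor_map K D M id (\<kappa> c1) (pure_tensor K D D d1 d2)) c2) =
        tensor_map K D (M \<boxtimes>\<^bsub>K\<^esub> C) id (\<lambda>d. tensor_map K M C (\<lambda>c. \<kappa> c d) id (pure_tensor K C C c1 c2)) (pure_tensor K D D d1 d2)"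
        by (simp add: map_pure[OF vs(2,2,2,3) lin_id' b2[OF c(1)] d] map_pure[OF vs(2,2,2) MC lin_id' n[OF cc] d] nc[OF d(2)]
            assoc_right_pure[OF vs(2,3,1) d(1) lin_closed[OF b1] c(2)] c d)
    qed
    then show "assoc_right K D M C (tensor_map K (D \<boxtimes>\<^bsub>K\<^esub> M) C (\<lambda>c. tensor_map K D M id (\<kappa> c) s) id (pure_tensor K C C c1 c2)) =
      tensor_map K D (M \<boxtimes>\<^bsub>K\<^esub> C) id (\<lambda>d. tensor_map K M C (\<lambda>c. \<kappa> c d) id (pure_tensor K C C c1 c2)) s"
      by (simp only: map_pure[OF vs(1,1) DM vs(1) k[OF s] lin_id' c] id_apply)
  qed
qed

lemma coactions_commute:
  assumes C: "coalgebra K C \<Delta>C \<epsilon>C" and D: "coalgebra K D \<Delta>D \<epsilon>D"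
    and M: "vectorspace K M" and b: "bilinear_on K C D M \<kappa>"
    and l: "l \<in> module_hom K M (D \<boxtimes>\<^bsub>K\<^esub> M)" and r: "r \<in> module_hom K M (M \<boxtimes>\<^bsub>K\<^esub> C)"
    and le: "\<And>c d. c \<in> carrier C \<Longrightarrow> d \<in> carrier D \<Longrightarrow> l (\<kappa> c d) = tensor_map K D M id (\<kappa> c) (\<Delta>D d)"
    and re: "\<And>c d. c \<in> carrier C \<Longrightarrow> d \<in> carrier D \<Longrightarrow> r (\<kappa> c d) = tensor_map K M C (\<lambda>c. \<kappa> c d) id (\<Delta>C c)"
    and c: "c \<in> carrier C" and d: "d \<in> carrier D"
  shows "assoc_right K D M C (tensor_map K (D \<boxtimes>\<^bsub>K\<^esub> M) C l id (r (\<kappa> c d))) =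
        tensor_map K D (M \<boxtimes>\<^bsub>K\<^esub> C) id r (l (\<kappa> c d))"
proof -
  have b1: "\<And>d. d \<in> carrier D \<Longrightarrow> (\<lambda>c. \<kappa> c d) \<in> module_hom K C M"
    and b2: "\<And>c. c \<in> carrier C \<Longrightarrow> \<kappa> c \<in> module_hom K D M" using b by (simp_all add: bilinear_on_def)
  note v = vC[OF C D] vD[OF C D]
  note MC = tensor_vs[OF M v(1)] and DM = tensor_vs[OF v(2) M]
  have t: "\<Delta>C c \<in> carrier (C \<boxtimes>\<^bsub>K\<^esub> C)" by (rule lin_closed[OF hC[OF C D] c])
  have s: "\<Delta>D d \<in> carrier (D \<boxtimes>\<^bsub>K\<^esub> D)" by (rule lin_closed[OF hD[OF C D] d])
  have "tensor_map K (D \<boxtimes>\<^bsub>K\<^esub> M) C l id (r (\<kappa> c d)) = tensor_map K (D \<boxtimes>\<^bsub>K\<^esub> M) C (\<lambda>c. l (\<kappa> c d)) id (\<Delta>C c)"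
    using map_comp[OF v(1,1) M v(1) DM v(1) b1[OF d] lin_id' l lin_id' t] by (simp add: re c d id_def)
  also have "\<dots> = tensor_map K (D \<boxtimes>\<^bsub>K\<^esub> M) C (\<lambda>c. tensor_map K D M id (\<kappa> c) (\<Delta>D d)) id (\<Delta>C c)"
    by (rule map_cong[OF v(1,1) DM v(1) lin_comp[OF b1[OF d] l] lin_id' map_param_right[OF v(2,2) M v(1) b s] lin_id' le[OF _ d] refl t])
  finally have 1: "tensor_map K (D \<boxtimes>\<^bsub>K\<^esub> M) C l id (r (\<kappa> c d)) = \<dots>" .
  have "tensor_map K D (M \<boxtimes>\<^bsub>K\<^esub> C) id r (l (\<kappa> c d)) = tensor_map K D (M \<boxtimes>\<^bsub>K\<^esub> C) id (\<lambda>d. r (\<kappa> c d)) (\<Delta>D d)"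
    using map_comp[OF v(2,2,2) M v(2) MC lin_id' b2[OF c] lin_id' r s] by (simp add: le c d id_def)
  also have "\<dots> = tensor_map K D (M \<boxtimes>\<^bsub>K\<^esub> C) id (\<lambda>d. tensor_map K M C (\<lambda>c. \<kappa> c d) id (\<Delta>C c)) (\<Delta>D d)"
    by (rule map_cong[OF v(2,2,2) MC lin_id' lin_comp[OF b2[OF c] r] lin_id' map_param_left[OF v(1,1) M v(2) b t] refl re[OF c] s])
  finally show ?thesis unfolding 1 using coaction_swap[OF v M b t s] by simp
qed

lemma bilin_flip: "bilinear_on K M N P \<beta> \<Longrightarrow> bilinear_on K N M P (\<lambda>n m. \<beta> m n)"
  by (simp add: bilinear_on_def)

context
  fixes K and C :: "('k, 'c, 'm) module_scheme" and D :: "('k, 'd, 'n) module_scheme"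
    and \<Delta>C \<epsilon>C \<Delta>D \<epsilon>D
  assumes C: "coalgebra K C \<Delta>C \<epsilon>C" and D: "coalgebra K D \<Delta>D \<epsilon>D"
begin

theorem bicomodule_CD:
  "bicomodule K D \<Delta>D \<epsilon>D C \<Delta>C \<epsilon>C (C \<boxtimes>\<^bsub>K\<^esub> D) (left_coaction_CD K C D \<Delta>D) (right_coaction_CD K C D \<Delta>C)"
  unfolding bicomodule_def
proof (intro conjI ballI)
  let ?M = "C \<boxtimes>\<^bsub>K\<^esub> D" and ?l = "left_coaction_CD K C D \<Delta>D" and ?r = "right_coaction_CD K C D \<Delta>C"
  note v = vC[OF C D] vD[OF C D]
  note M = tensor_vs[OF v]
  note l = left_CD_hom[OF C D] and r = right_CD_hom[OF C D]
  note le = left_CD_pure[OF C D] and re = right_CD_pure[OF C D]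
  show "left_comodule K D \<Delta>D \<epsilon>D ?M ?l"
  proof (rule left_comodule_ext[OF v D l], intro bexI conjI ballI)
    fix c d d' assume "c \<in> carrier C" "d' \<in> carrier D"
    then show "?l (pure_tensor K C D c d') = tensor_map K D ?M id (pure_tensor K C D c) (\<Delta>D d')" by (rule le)
  qed (rule refl, assumption, rule pure_hom_right[OF v])
  show "right_comodule K C \<Delta>C \<epsilon>C ?M ?r"
  proof (rule right_comodule_ext[OF v C r], intro bexI conjI ballI)
    fix c d c' assume "d \<in> carrier D" "c' \<in> carrier C"
    then show "?r ((\<lambda>c. pure_tensor K C D c d) c') = tensor_map K ?M C (\<lambda>c. pure_tensor K C D c d) id (\<Delta>C c')"
      by (intro re)
  qed (rule refl, assumption, rule pure_hom_left[OF v])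
  fix x assume x: "x \<in> carrier ?M"
  show "assoc_right K D ?M C (tensor_map K (D \<boxtimes>\<^bsub>K\<^esub> ?M) C ?l id (?r x)) =
        tensor_map K D (?M \<boxtimes>\<^bsub>K\<^esub> C) id ?r (?l x)"
    by (rule tensor_ext[OF v tensor_vs[OF v(2) tensor_vs[OF M v(1)]]
          lin_comp[OF r lin_comp[OF map_hom[OF M v(1) tensor_vs[OF v(2) M] v(1) l lin_id'] assoc_right_hom[OF v(2) M v(1)]]]
          lin_comp[OF l map_hom[OF v(2) M v(2) tensor_vs[OF M v(1)] lin_id' r]]
          coactions_commute[OF C D M pure_bilinear[OF v] l r le re] x])
qed

theorem bicomodule_DC:
  "bicomodule K D \<Delta>D \<epsilon>D C \<Delta>C \<epsilon>C (D \<boxtimes>\<^bsub>K\<^esub> C) (left_coaction_DC K D C \<Delta>D) (right_coaction_DC K D C \<Delta>C)"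
  unfolding bicomodule_def
proof (intro conjI ballI)
  let ?M = "D \<boxtimes>\<^bsub>K\<^esub> C" and ?l = "left_coaction_DC K D C \<Delta>D" and ?r = "right_coaction_DC K D C \<Delta>C"
  note v = vC[OF C D] vD[OF C D]
  note M = tensor_vs[OF v(2,1)]
  note l = left_DC_hom[OF C D] and r = right_DC_hom[OF C D]
  note le = left_DC_pure[OF C D] and re = right_DC_pure[OF C D]
  show "left_comodule K D \<Delta>D \<epsilon>D ?M ?l"
  proof (rule left_comodule_ext[OF v(2,1) D l], intro bexI conjI ballI)
    fix c d d' assume "c \<in> carrier C" "d' \<in> carrier D"
    then show "?l ((\<lambda>d. pure_tensor K D C d c) d') = tensor_map K D ?M id (\<lambda>d. pure_tensor K D C d c) (\<Delta>D d')"
      by (intro le)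
  qed (rule refl, assumption, rule pure_hom_left[OF v(2,1)])
  show "right_comodule K C \<Delta>C \<epsilon>C ?M ?r"
  proof (rule right_comodule_ext[OF v(2,1) C r], intro bexI conjI ballI)
    fix c d c' assume "d \<in> carrier D" "c' \<in> carrier C"
    then show "?r (pure_tensor K D C d c') = tensor_map K ?M C (pure_tensor K D C d) id (\<Delta>C c')"
      by (intro re)
  qed (rule refl, assumption, rule pure_hom_right[OF v(2,1)])
  fix x assume x: "x \<in> carrier ?M"
  show "assoc_right K D ?M C (tensor_map K (D \<boxtimes>\<^bsub>K\<^esub> ?M) C ?l id (?r x)) =
        tensor_map K D (?M \<boxtimes>\<^bsub>K\<^esub> C) id ?r (?l x)"
    by (rule tensor_ext[OF v(2,1) tensor_vs[OF v(2) tensor_vs[OF M v(1)]]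
          lin_comp[OF r lin_comp[OF map_hom[OF M v(1) tensor_vs[OF v(2) M] v(1) l lin_id'] assoc_right_hom[OF v(2) M v(1)]]]
          lin_comp[OF l map_hom[OF v(2) M v(2) tensor_vs[OF M v(1)] lin_id' r]]
          _ x], rule coactions_commute[OF C D M bilin_flip[OF pure_bilinear[OF v(2,1)]] l r le re])
qed

end

end

theory Submission
  imports Defs
begin

text \<open>
  In Sweedler notation, left \<open>D\<close>-colinearity of \<open>\<Psi>\<close> says that comultiplying the \<open>D\<close>-leg of \<open>\<Psi>(c \<otimes> d)\<close> gives \<open>d\<^sub>1 \<otimes> \<Psi>(c \<otimes> d\<^sub>2)\<close>, and right \<open>C\<close>-colinearity says that
  comultiplying its \<open>C\<close>-leg gives \<open>\<Psi>(c\<^sub>1 \<otimes> d) \<otimes> c\<^sub>2\<close> (\<open>eval_\<Psi>_left\<close>, \<open>eval_\<Psi>_right\<close>). So a coproduct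
  that is applied after \<open>\<Psi>\<close> can be moved in front of it.

  The left-hand side of the first identity comultiplies the \<open>C\<close>-leg of \<open>\<Psi>(c \<otimes> d\<^sub>1)\<close>, the right-hand side
  the \<open>D\<close>-leg of \<open>\<Psi>(c\<^sub>2 \<otimes> d)\<close>. Moving these coproducts in front of \<open>\<Psi>\<close> turns both sides into
  \<open>\<Psi>(c\<^sub>1 \<otimes> d\<^sub>1) \<otimes> \<Psi>(c\<^sub>2 \<otimes> d\<^sub>2)\<close> (\<open>twist_then_comultiply_C\<close>, \<open>twist_then_comultiply_D\<close>).

  The twisted coproduct sends \<open>c \<otimes> d\<close> to \<open>c\<^sub>1 \<otimes> \<Psi>(c\<^sub>2 \<otimes> d\<^sub>1) \<otimes> d\<^sub>2\<close>. Applying it again to the first or to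
  the second factor comultiplies one leg of \<open>\<Psi>(c\<^sub>2 \<otimes> d\<^sub>1)\<close>. Moving that coproduct in front of \<open>\<Psi>\<close> gives
  \<open>c\<^sub>1 \<otimes> \<Psi>(c\<^sub>2 \<otimes> d\<^sub>1) \<otimes> \<Psi>(c\<^sub>3 \<otimes> d\<^sub>2) \<otimes> d\<^sub>3\<close> in both cases, where the iterated coproducts of \<open>c\<close> and \<open>d\<close> are
  bracketed one way for the first factor and the other way for the second
  (\<open>comultiply_left_factor\<close>, \<open>comultiply_right_factor\<close>). Coassociativity of \<open>C\<close> and \<open>D\<close> finishes the
  proof.

  Sweedler notation is made formal by \<^const>\<open>tensor_lift\<close>: for bilinear \<open>\<beta>\<close>, the term
  \<open>tensor_lift K P \<beta> (\<Delta> c)\<close> is \<open>\<beta>(c\<^sub>1, c\<^sub>2)\<close>, the implicit sum included. A computation with elements is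
  then a chain of equations between nested lifts. It needs three rules: a linear map is determined
  by its values on pure tensors (\<open>hom_eq_lift\<close>), sums over two tensors can be interchanged
  (\<open>lift_swap\<close>), and coassociativity moves a coproduct from the first factor to the second
  (\<open>lift_coassociative\<close>).
\<close>

section \<open>Linearity of expressions built from tensors\<close>

lemma linear_pure_left:
  assumes "vectorspace K A" "vectorspace K B" "f \<in> module_hom K E A" "b \<in> carrier B"
  shows "(\<lambda>x. pure_tensor K A B (f x) b) \<in> module_hom K E (A \<boxtimes>\<^bsub>K\<^esub> B)"
  by (rule lin_comp[OF assms(3) pure_hom_left[OF assms(1,2,4)]])

lemma linear_pure_right:
  assumes "vectorspace K A" "vectorspace K B" "a \<in> carrier A" "f \<in> module_hom K E B"
  shows "(\<lambda>x. pure_tensor K A B a (f x)) \<in> module_hom K E (A \<boxtimes>\<^bsub>K\<^esub> B)"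
  by (rule lin_comp[OF assms(4) pure_hom_right[OF assms(1,2,3)]])

lemma linear_assoc_right:
  assumes "vectorspace K L" "vectorspace K M" "vectorspace K N"
    "f \<in> module_hom K E ((L \<boxtimes>\<^bsub>K\<^esub> M) \<boxtimes>\<^bsub>K\<^esub> N)"
  shows "(\<lambda>x. assoc_right K L M N (f x)) \<in> module_hom K E (L \<boxtimes>\<^bsub>K\<^esub> (M \<boxtimes>\<^bsub>K\<^esub> N))"
  by (rule lin_comp[OF assms(4) assoc_right_hom[OF assms(1,2,3)]])

lemma linear_assoc_left:
  assumes "vectorspace K L" "vectorspace K M" "vectorspace K N"
    "f \<in> module_hom K E (L \<boxtimes>\<^bsub>K\<^esub> (M \<boxtimes>\<^bsub>K\<^esub> N))"
  shows "(\<lambda>x. assoc_left K L M N (f x)) \<in> module_hom K E ((L \<boxtimes>\<^bsub>K\<^esub> M) \<boxtimes>\<^bsub>K\<^esub> N)"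
  by (rule lin_comp[OF assms(4) assoc_left_hom[OF assms(1,2,3)]])

lemma linear_map:
  assumes "h \<in> module_hom K E (M \<boxtimes>\<^bsub>K\<^esub> N)" "f \<in> module_hom K M M'" "g \<in> module_hom K N N'"
    "vectorspace K M" "vectorspace K N" "vectorspace K M'" "vectorspace K N'"
  shows "(\<lambda>x. tensor_map K M' N' f g (h x)) \<in> module_hom K E (M' \<boxtimes>\<^bsub>K\<^esub> N')"
  by (rule lin_comp[OF assms(1) map_hom[OF assms(4-7,2,3)]])

lemma linear_lift_argument:
  assumes "h \<in> module_hom K E (A \<boxtimes>\<^bsub>K\<^esub> B)" "vectorspace K A" "vectorspace K B" "vectorspace K P"
    "bilinear_on K A B P \<beta>"
  shows "(\<lambda>x. tensor_lift K P \<beta> (h x)) \<in> module_hom K E P"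
  by (rule lin_comp[OF assms(1) lift_hom[OF assms(2-5)]])

lemma linear_lift_parameter:
  assumes "t \<in> carrier (A \<boxtimes>\<^bsub>K\<^esub> B)" "vectorspace K A" "vectorspace K B" "vectorspace K E" "vectorspace K P"
    "\<And>x. x \<in> carrier E \<Longrightarrow> bilinear_on K A B P (\<gamma> x)"
    "\<And>a b. a \<in> carrier A \<Longrightarrow> b \<in> carrier B \<Longrightarrow> (\<lambda>x. \<gamma> x a b) \<in> module_hom K E P"
  shows "(\<lambda>x. tensor_lift K P (\<gamma> x) t) \<in> module_hom K E P"
  using lift_param_right[OF assms(2-5), of \<gamma>] assms(1,6,7) by (simp add: bilinear_on_def)

lemma assoc_right_closed:
  assumes "vectorspace K L" "vectorspace K M" "vectorspace K N" "x \<in> carrier ((L \<boxtimes>\<^bsub>K\<^esub> M) \<boxtimes>\<^bsub>K\<^esub> N)"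
  shows "assoc_right K L M N x \<in> carrier (L \<boxtimes>\<^bsub>K\<^esub> (M \<boxtimes>\<^bsub>K\<^esub> N))"
  by (rule lin_closed[OF assoc_right_hom[OF assms(1-3)] assms(4)])

lemma map_closed:
  assumes "x \<in> carrier (M \<boxtimes>\<^bsub>K\<^esub> N)" "f \<in> module_hom K M M'" "g \<in> module_hom K N N'"
    "vectorspace K M" "vectorspace K N" "vectorspace K M'" "vectorspace K N'"
  shows "tensor_map K M' N' f g x \<in> carrier (M' \<boxtimes>\<^bsub>K\<^esub> N')"
  by (rule lin_closed[OF map_hom[OF assms(4-7,2,3)] assms(1)])

text \<open>
  Applied as introduction rules, these decide whether an expression is linear in a variable by
  following its syntax. In the rules for \<^const>\<open>tensor_map\<close> and \<^const>\<open>tensor_lift\<close> the premise on the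
  tensor argument comes first, because it determines the two factors, which the
  expression itself does not mention.
\<close>

lemmas linear_rules = lin_id lin_id' bilinI linear_pure_left linear_pure_right linear_assoc_right
  linear_assoc_left linear_map linear_lift_argument linear_lift_parameter
  pure_closed assoc_right_closed map_closed tensor_vs

section \<open>Sums over the terms of a tensor\<close>

text \<open>
  Uniqueness in the universal property, read as expanding \<open>h t\<close> over the terms of \<open>t\<close>.
\<close>

lemma hom_eq_lift:
  assumes t: "t \<in> carrier (A \<boxtimes>\<^bsub>K\<^esub> B)" and vs: "vectorspace K A" "vectorspace K B" "vectorspace K P"
    and h: "h \<in> module_hom K (A \<boxtimes>\<^bsub>K\<^esub> B) P" and b: "bilinear_on K A B P \<beta>"
    and eq: "\<And>a b. a \<in> carrier A \<Longrightarrow> b \<in> carrier B \<Longrightarrow> h (pure_tensor K A B a b) = \<beta> a b"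
  shows "h t = tensor_lift K P \<beta> t"
  by (rule tensor_ext[OF vs h lift_hom[OF vs b] _ t]) (simp add: eq lift_pure[OF vs b])

text \<open>
  Both sides are linear in \<open>t\<close>, and on a pure tensor both reduce to one sum over \<open>s\<close>.
\<close>

lemma lift_swap:
  assumes t: "t \<in> carrier (A \<boxtimes>\<^bsub>K\<^esub> B)" and s: "s \<in> carrier (M \<boxtimes>\<^bsub>K\<^esub> N)"
    and vs: "vectorspace K A" "vectorspace K B" "vectorspace K M" "vectorspace K N" "vectorspace K P"
    and 1: "\<And>m n. m \<in> carrier M \<Longrightarrow> n \<in> carrier N \<Longrightarrow> bilinear_on K A B P (\<lambda>a b. \<gamma> a b m n)"
    and 2: "\<And>a b. a \<in> carrier A \<Longrightarrow> b \<in> carrier B \<Longrightarrow> bilinear_on K M N P (\<gamma> a b)"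
  shows "tensor_lift K P (\<lambda>a b. tensor_lift K P (\<gamma> a b) s) t =
    tensor_lift K P (\<lambda>m n. tensor_lift K P (\<lambda>a b. \<gamma> a b m n) t) s"
proof -
  have l: "\<And>b m n. b \<in> carrier B \<Longrightarrow> m \<in> carrier M \<Longrightarrow> n \<in> carrier N \<Longrightarrow> (\<lambda>a. \<gamma> a b m n) \<in> module_hom K A P"
    "\<And>a m n. a \<in> carrier A \<Longrightarrow> m \<in> carrier M \<Longrightarrow> n \<in> carrier N \<Longrightarrow> (\<lambda>b. \<gamma> a b m n) \<in> module_hom K B P"
    "\<And>a b n. a \<in> carrier A \<Longrightarrow> b \<in> carrier B \<Longrightarrow> n \<in> carrier N \<Longrightarrow> (\<lambda>m. \<gamma> a b m n) \<in> module_hom K M P"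
    "\<And>a b m. a \<in> carrier A \<Longrightarrow> b \<in> carrier B \<Longrightarrow> m \<in> carrier M \<Longrightarrow> (\<lambda>n. \<gamma> a b m n) \<in> module_hom K N P"
    using 1 2 by (auto simp: bilinear_on_def)
  have b1: "bilinear_on K A B P (\<lambda>a b. tensor_lift K P (\<gamma> a b) s)"
    by (rule linear_rules vs s 2 l | assumption)+
  have b2: "bilinear_on K M N P (\<lambda>m n. tensor_lift K P (\<lambda>a b. \<gamma> a b m n) t)" if "t \<in> carrier (A \<boxtimes>\<^bsub>K\<^esub> B)" for t
    by (rule linear_rules vs that 1 l | assumption)+
  have r: "(\<lambda>t. tensor_lift K P (\<lambda>m n. tensor_lift K P (\<lambda>a b. \<gamma> a b m n) t) s) \<in> module_hom K (A \<boxtimes>\<^bsub>K\<^esub> B) P"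
    by (rule linear_rules vs s b2 1 | assumption)+
  show ?thesis
  proof (rule tensor_ext[OF vs(1,2,5) lift_hom[OF vs(1,2,5) b1] r _ t])
    fix a b assume ab: "a \<in> carrier A" "b \<in> carrier B"
    show "tensor_lift K P (\<lambda>a b. tensor_lift K P (\<gamma> a b) s) (pure_tensor K A B a b) =
      tensor_lift K P (\<lambda>m n. tensor_lift K P (\<lambda>a b. \<gamma> a b m n) (pure_tensor K A B a b)) s"
      unfolding lift_pure[OF vs(1,2,5) b1 ab]
      by (rule lift_cong[OF vs(3,4,5) 2[OF ab] b2 _ s])
        (simp_all add: pure_closed[OF vs(1,2) ab] lift_pure[OF vs(1,2,5) 1 ab])
  qed
qed

text \<open>
  This is \<open>\<gamma>(c\<^sub>1\<^sub>1, c\<^sub>1\<^sub>2, c\<^sub>2) = \<gamma>(c\<^sub>1, c\<^sub>2\<^sub>1, c\<^sub>2\<^sub>2)\<close>. It follows by applying to both sides of the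
  coassociativity law the linear map \<open>C \<otimes> (C \<otimes> C) \<rightarrow> P\<close> that the trilinear \<open>\<gamma>\<close> induces.
\<close>

lemma lift_coassociative:
  assumes v: "vectorspace K C" and vP: "vectorspace K P" and co: "coassociative_coproduct K C \<Delta>"
    and c: "c \<in> carrier C"
    and 1: "\<And>b. b \<in> carrier C \<Longrightarrow> bilinear_on K C C P (\<lambda>a1 a2. \<gamma> a1 a2 b)"
    and 2: "\<And>a1 a2. a1 \<in> carrier C \<Longrightarrow> a2 \<in> carrier C \<Longrightarrow> \<gamma> a1 a2 \<in> module_hom K C P"
  shows "tensor_lift K P (\<lambda>a b. tensor_lift K P (\<lambda>a1 a2. \<gamma> a1 a2 b) (\<Delta> a)) (\<Delta> c) =
    tensor_lift K P (\<lambda>a b. tensor_lift K P (\<lambda>b1 b2. \<gamma> a b1 b2) (\<Delta> b)) (\<Delta> c)"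
proof -
  let ?G = "tensor_lift K P (\<lambda>a. tensor_lift K P (\<gamma> a))"
  have h: "\<Delta> \<in> module_hom K C (C \<boxtimes>\<^bsub>K\<^esub> C)"
    and eq: "assoc_right K C C C (tensor_map K (C \<boxtimes>\<^bsub>K\<^esub> C) C \<Delta> id (\<Delta> c)) =
      tensor_map K C (C \<boxtimes>\<^bsub>K\<^esub> C) id \<Delta> (\<Delta> c)"
    using co c by (simp_all add: coassociative_coproduct_def)
  have t: "\<Delta> x \<in> carrier (C \<boxtimes>\<^bsub>K\<^esub> C)" if "x \<in> carrier C" for x by (rule lin_closed[OF h that])
  note v2 = tensor_vs[OF v v]
  have l: "(\<lambda>x. \<gamma> x a b) \<in> module_hom K C P" "(\<lambda>x. \<gamma> a x b) \<in> module_hom K C P"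
    if "a \<in> carrier C" "b \<in> carrier C" for a b
    using 1 that by (auto simp: bilinear_on_def)
  have ga: "bilinear_on K C C P (\<gamma> a)" if "a \<in> carrier C" for a
    by (rule bilinI) (rule l 2 that | assumption)+
  have gb: "bilinear_on K C (C \<boxtimes>\<^bsub>K\<^esub> C) P (\<lambda>a. tensor_lift K P (\<gamma> a))"
    by (rule linear_rules v vP ga l | assumption)+
  note g = lift_hom[OF v v2 vP gb]
  have Gp: "?G (pure_tensor K C (C \<boxtimes>\<^bsub>K\<^esub> C) a s) = tensor_lift K P (\<gamma> a) s"
    if "a \<in> carrier C" "s \<in> carrier (C \<boxtimes>\<^bsub>K\<^esub> C)" for a s
    by (rule lift_pure[OF v v2 vP gb that])
  have al: "(\<lambda>t. ?G (assoc_right K C C C (pure_tensor K (C \<boxtimes>\<^bsub>K\<^esub> C) C t b))) \<in> module_hom K (C \<boxtimes>\<^bsub>K\<^esub> C) P"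
    if "b \<in> carrier C" for b
    by (rule lin_comp[OF _ g] linear_rules v that | assumption)+
  have Ga: "?G (assoc_right K C C C (pure_tensor K (C \<boxtimes>\<^bsub>K\<^esub> C) C t b)) = tensor_lift K P (\<lambda>a1 a2. \<gamma> a1 a2 b) t"
    if b: "b \<in> carrier C" and "t \<in> carrier (C \<boxtimes>\<^bsub>K\<^esub> C)" for t b
    by (rule tensor_ext[OF v v vP al[OF b] lift_hom[OF v v vP 1[OF b]] _ that(2)])
      (simp add: assoc_right_pure v b Gp pure_closed lift_pure[OF v v vP ga] lift_pure[OF v v vP 1])
  have bl: "bilinear_on K C C P (\<lambda>a b. ?G (assoc_right K C C C (pure_tensor K (C \<boxtimes>\<^bsub>K\<^esub> C) C (\<Delta> a) b)))"
    by (rule lin_comp[OF _ g] linear_rules v v2 h t | assumption)+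
  have bl': "bilinear_on K C C P (\<lambda>a b. tensor_lift K P (\<lambda>a1 a2. \<gamma> a1 a2 b) (\<Delta> a))"
    by (rule linear_rules v vP v2 h t 1 2 | assumption)+
  have bR: "bilinear_on K (C \<boxtimes>\<^bsub>K\<^esub> C) C P (\<lambda>m n. ?G (assoc_right K C C C (pure_tensor K (C \<boxtimes>\<^bsub>K\<^esub> C) C m n)))"
    by (rule lin_comp[OF _ g] linear_rules v v2 h t | assumption)+
  have "tensor_lift K P (\<lambda>a b. tensor_lift K P (\<lambda>a1 a2. \<gamma> a1 a2 b) (\<Delta> a)) (\<Delta> c) =
      tensor_lift K P (\<lambda>a b. ?G (assoc_right K C C C (pure_tensor K (C \<boxtimes>\<^bsub>K\<^esub> C) C (\<Delta> a) b))) (\<Delta> c)"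
    by (rule lift_cong[OF v v vP bl' bl _ t[OF c]]) (simp add: Ga t)
  also have "\<dots> = ?G (assoc_right K C C C (tensor_map K (C \<boxtimes>\<^bsub>K\<^esub> C) C \<Delta> id (\<Delta> c)))"
  proof -
    have "?G (assoc_right K C C C (tensor_map K (C \<boxtimes>\<^bsub>K\<^esub> C) C \<Delta> id (\<Delta> c))) =
      tensor_lift K P (\<lambda>s b. ?G (assoc_right K C C C (pure_tensor K (C \<boxtimes>\<^bsub>K\<^esub> C) C s b)))
        (tensor_map K (C \<boxtimes>\<^bsub>K\<^esub> C) C \<Delta> id (\<Delta> c))"
      by (rule hom_eq_lift[OF _ v2 v vP lin_comp[OF assoc_right_hom[OF v v v] g] bR refl])
        (rule linear_rules v v2 h t c | assumption)+
    then show ?thesis by (simp add: lift_map[OF v v v2 v vP h lin_id' bR t[OF c]])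
  qed
  also have "\<dots> = tensor_lift K P (\<lambda>a b. tensor_lift K P (\<gamma> a) (\<Delta> b)) (\<Delta> c)"
    unfolding eq by (simp add: lift_map[OF v v v v2 vP lin_id' h gb t[OF c]])
  finally show ?thesis .
qed

section \<open>Twist maps that are bicolinear\<close>

locale bicolinear_twist =
  fixes K :: "('k, 'r) ring_scheme"
    and C :: "('k, 'c, 'm) module_scheme" and D :: "('k, 'd, 'n) module_scheme"
    and \<Delta>\<^sub>C :: "'c \<Rightarrow> ('c \<times> 'c \<Rightarrow> 'k) set" and \<epsilon>\<^sub>C :: "'c \<Rightarrow> 'k"
    and \<Delta>\<^sub>D :: "'d \<Rightarrow> ('d \<times> 'd \<Rightarrow> 'k) set" and \<epsilon>\<^sub>D :: "'d \<Rightarrow> 'k"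
    and \<Psi> :: "('c \<times> 'd \<Rightarrow> 'k) set \<Rightarrow> ('d \<times> 'c \<Rightarrow> 'k) set"
  assumes C: "coalgebra K C \<Delta>\<^sub>C \<epsilon>\<^sub>C"
    and D: "coalgebra K D \<Delta>\<^sub>D \<epsilon>\<^sub>D"
    and bicolinear: "\<Psi> \<in> bicomodule_hom K D C
           (C \<boxtimes>\<^bsub>K\<^esub> D) (left_coaction_CD K C D \<Delta>\<^sub>D) (right_coaction_CD K C D \<Delta>\<^sub>C)
           (D \<boxtimes>\<^bsub>K\<^esub> C) (left_coaction_DC K D C \<Delta>\<^sub>D) (right_coaction_DC K D C \<Delta>\<^sub>C)"
begin

abbreviation "CD \<equiv> C \<boxtimes>\<^bsub>K\<^esub> D"
abbreviation "DC \<equiv> D \<boxtimes>\<^bsub>K\<^esub> C"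
abbreviation "\<psi> c d \<equiv> \<Psi> (pure_tensor K C D c d)"

lemmas vs = vC[OF C D] vD[OF C D]
lemmas \<Delta>C_hom = hC[OF C D] and \<Delta>D_hom = hD[OF C D]
lemmas \<Delta>C_closed = lin_closed[OF \<Delta>C_hom] and \<Delta>D_closed = lin_closed[OF \<Delta>D_hom]

lemma \<Psi>_hom: "\<Psi> \<in> module_hom K CD DC"
  using bicolinear by (simp add: bicomodule_hom_def)

lemmas \<Psi>_closed = lin_closed[OF \<Psi>_hom]

lemma \<Psi>_linear: "f \<in> module_hom K E CD \<Longrightarrow> (\<lambda>x. \<Psi> (f x)) \<in> module_hom K E DC"
  by (rule lin_comp[OF _ \<Psi>_hom])

lemmas twist_rules = linear_rules vs \<Delta>C_hom \<Delta>D_hom \<Delta>C_closed \<Delta>D_closed \<Psi>_linear \<Psi>_closed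

text \<open>
  Left colinearity in the form \<open>p\<^sub>1 \<otimes> (p\<^sub>2 \<otimes> q) = d\<^sub>1 \<otimes> \<Psi>(c \<otimes> d\<^sub>2)\<close> for \<open>p \<otimes> q = \<Psi>(c \<otimes> d)\<close>. The element
  \<open>\<Psi>(c \<otimes> d)\<close> need not be a pure tensor, so the law is stated for a map \<open>h\<close> whose value on a pure tensor
  factors through the coaction: such an \<open>h\<close> factors through the coaction everywhere.
\<close>

lemma eval_\<Psi>_left:
  assumes P: "vectorspace K P" and h: "h \<in> module_hom K DC P" and g: "bilinear_on K D DC P g"
    and hg: "\<And>p q. p \<in> carrier D \<Longrightarrow> q \<in> carrier C \<Longrightarrow>
      h (pure_tensor K D C p q) = tensor_lift K P (\<lambda>p\<^sub>1 p\<^sub>2. g p\<^sub>1 (pure_tensor K D C p\<^sub>2 q)) (\<Delta>\<^sub>D p)"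
    and c: "c \<in> carrier C" and d: "d \<in> carrier D"
  shows "h (\<psi> c d) = tensor_lift K P (\<lambda>d\<^sub>1 d\<^sub>2. g d\<^sub>1 (\<psi> c d\<^sub>2)) (\<Delta>\<^sub>D d)"
proof -
  note v = vs tensor_vs[OF vs] tensor_vs[OF vs(2,1)]
  note G = lift_hom[OF v(2,4) P g] and l = left_DC_hom[OF C D]
  have cd: "pure_tensor K C D c d \<in> carrier CD" by (rule twist_rules c d)+
  have "h u = tensor_lift K P g (left_coaction_DC K D C \<Delta>\<^sub>D u)" if "u \<in> carrier DC" for u
    by (rule tensor_ext[OF v(2,1) P h lin_comp[OF l G] _ that])
      (simp add: hg left_DC_pure[OF C D] lift_map[OF v(2,2,2,4) P lin_id' pure_hom_left[OF v(2,1)] g \<Delta>D_closed])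
  then have "h (\<psi> c d) = tensor_lift K P g (left_coaction_DC K D C \<Delta>\<^sub>D (\<psi> c d))"
    using \<Psi>_closed[OF cd] by simp
  also have "left_coaction_DC K D C \<Delta>\<^sub>D (\<psi> c d) =
      tensor_map K D DC id \<Psi> (tensor_map K D CD id (pure_tensor K C D c) (\<Delta>\<^sub>D d))"
    using bicolinear cd by (simp add: bicomodule_hom_def left_CD_pure[OF C D c d])
  also have "\<dots> = tensor_map K D DC id (\<psi> c) (\<Delta>\<^sub>D d)"
    using map_comp[OF v(2,2,2,3,2,4) lin_id' pure_hom_right[OF v(1,2) c] lin_id' \<Psi>_hom \<Delta>D_closed[OF d]]
    by (simp add: id_def)
  finally show ?thesis
    by (simp add: lift_map[OF v(2,2,2,4) P lin_id' lin_comp[OF pure_hom_right[OF v(1,2) c] \<Psi>_hom] g \<Delta>D_closed[OF d]])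
qed

lemma eval_\<Psi>_right:
  assumes P: "vectorspace K P" and h: "h \<in> module_hom K DC P" and g: "bilinear_on K DC C P g"
    and hg: "\<And>p q. p \<in> carrier D \<Longrightarrow> q \<in> carrier C \<Longrightarrow>
      h (pure_tensor K D C p q) = tensor_lift K P (\<lambda>q\<^sub>1. g (pure_tensor K D C p q\<^sub>1)) (\<Delta>\<^sub>C q)"
    and c: "c \<in> carrier C" and d: "d \<in> carrier D"
  shows "h (\<psi> c d) = tensor_lift K P (\<lambda>c\<^sub>1. g (\<psi> c\<^sub>1 d)) (\<Delta>\<^sub>C c)"
proof -
  note v = vs tensor_vs[OF vs] tensor_vs[OF vs(2,1)]
  note G = lift_hom[OF v(4,1) P g] and r = right_DC_hom[OF C D]
  have cd: "pure_tensor K C D c d \<in> carrier CD" by (rule twist_rules c d)+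
  have "h u = tensor_lift K P g (right_coaction_DC K D C \<Delta>\<^sub>C u)" if "u \<in> carrier DC" for u
    by (rule tensor_ext[OF v(2,1) P h lin_comp[OF r G] _ that])
      (simp add: hg right_DC_pure[OF C D] lift_map[OF v(1,1,4,1) P pure_hom_right[OF v(2,1)] lin_id' g \<Delta>C_closed])
  then have "h (\<psi> c d) = tensor_lift K P g (right_coaction_DC K D C \<Delta>\<^sub>C (\<psi> c d))"
    using \<Psi>_closed[OF cd] by simp
  also have "right_coaction_DC K D C \<Delta>\<^sub>C (\<psi> c d) =
      tensor_map K DC C \<Psi> id (tensor_map K CD C (\<lambda>c. pure_tensor K C D c d) id (\<Delta>\<^sub>C c))"
    using bicolinear cd by (simp add: bicomodule_hom_def right_CD_pure[OF C D c d])
  also have "\<dots> = tensor_map K DC C (\<lambda>c. \<psi> c d) id (\<Delta>\<^sub>C c)"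
    using map_comp[OF v(1,1,3,1,4,1) pure_hom_left[OF v(1,2) d] lin_id' \<Psi>_hom lin_id' \<Delta>C_closed[OF c]]
    by (simp add: id_def)
  finally show ?thesis
    by (simp add: lift_map[OF v(1,1,4,1) P lin_comp[OF pure_hom_left[OF v(1,2) d] \<Psi>_hom] lin_id' g \<Delta>C_closed[OF c]])
qed

lemmas hom_simps = map_hom assoc_right_hom assoc_left_hom lin_id lin_id' \<Delta>C_hom \<Delta>D_hom \<Psi>_hom vs
lemmas pure_simps = map_pure[of K] assoc_left_pure[of K] assoc_right_pure[of K]
  assoc_right_closed pure_closed \<Delta>C_closed \<Delta>D_closed \<Psi>_closed hom_simps

text \<open>
  The common value of both sides of the first identity, before summing over the coproducts of \<open>c\<close>
  and \<open>d\<close>.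
\<close>

abbreviation "\<psi>\<psi> c\<^sub>1 c\<^sub>2 d\<^sub>1 d\<^sub>2 \<equiv> assoc_right K D C DC (pure_tensor K DC DC (\<psi> c\<^sub>1 d\<^sub>1) (\<psi> c\<^sub>2 d\<^sub>2))"

text \<open>
  Expand \<open>\<Delta>\<^sub>D d\<close> first; the maps after \<open>\<Psi> \<otimes> id\<close> comultiply the \<open>C\<close>-leg of \<open>\<Psi>(c \<otimes> d\<^sub>1)\<close>, so right
  colinearity applies to their composite \<open>?h\<close>.
\<close>

lemma twist_then_comultiply_C:
  assumes c: "c \<in> carrier C" and d: "d \<in> carrier D"
  shows "tensor_map K D (C \<boxtimes>\<^bsub>K\<^esub> DC) id (tensor_map K C DC id \<Psi>)
      (tensor_map K D (C \<boxtimes>\<^bsub>K\<^esub> CD) id (assoc_right K C C D)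
      (tensor_map K D ((C \<boxtimes>\<^bsub>K\<^esub> C) \<boxtimes>\<^bsub>K\<^esub> D) id (tensor_map K (C \<boxtimes>\<^bsub>K\<^esub> C) D \<Delta>\<^sub>C id)
      (assoc_right K D C D
      (tensor_map K DC D \<Psi> id
      (assoc_left K C D D
      (tensor_map K C (D \<boxtimes>\<^bsub>K\<^esub> D) id \<Delta>\<^sub>D (pure_tensor K C D c d))))))) =
    tensor_lift K (D \<boxtimes>\<^bsub>K\<^esub> (C \<boxtimes>\<^bsub>K\<^esub> DC))
      (\<lambda>d\<^sub>1 d\<^sub>2. tensor_lift K (D \<boxtimes>\<^bsub>K\<^esub> (C \<boxtimes>\<^bsub>K\<^esub> DC)) (\<lambda>c\<^sub>1 c\<^sub>2. \<psi>\<psi> c\<^sub>1 c\<^sub>2 d\<^sub>1 d\<^sub>2) (\<Delta>\<^sub>C c)) (\<Delta>\<^sub>D d)"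
proof -
  let ?P = "D \<boxtimes>\<^bsub>K\<^esub> (C \<boxtimes>\<^bsub>K\<^esub> DC)"
  let ?h = "\<lambda>x. tensor_map K D (C \<boxtimes>\<^bsub>K\<^esub> DC) id (tensor_map K C DC id \<Psi>)
      (tensor_map K D (C \<boxtimes>\<^bsub>K\<^esub> CD) id (assoc_right K C C D)
      (tensor_map K D ((C \<boxtimes>\<^bsub>K\<^esub> C) \<boxtimes>\<^bsub>K\<^esub> D) id (tensor_map K (C \<boxtimes>\<^bsub>K\<^esub> C) D \<Delta>\<^sub>C id)
      (assoc_right K D C D x)))"
  have h: "?h (pure_tensor K DC D (\<psi> c d\<^sub>1) d\<^sub>2) = tensor_lift K ?P (\<lambda>c\<^sub>1 c\<^sub>2. \<psi>\<psi> c\<^sub>1 c\<^sub>2 d\<^sub>1 d\<^sub>2) (\<Delta>\<^sub>C c)"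
    if d12: "d\<^sub>1 \<in> carrier D" "d\<^sub>2 \<in> carrier D" for d\<^sub>1 d\<^sub>2
  proof (rule eval_\<Psi>_right[where g="\<lambda>v c. assoc_right K D C DC (pure_tensor K DC DC v (\<psi> c d\<^sub>2))"])
    fix p q assume pq: "p \<in> carrier D" "q \<in> carrier C"
    have "?h (pure_tensor K DC D (pure_tensor K D C p q) d\<^sub>2) =
        pure_tensor K D (C \<boxtimes>\<^bsub>K\<^esub> DC) p (tensor_map K C DC id \<Psi> (assoc_right K C C D (pure_tensor K (C \<boxtimes>\<^bsub>K\<^esub> C) D (\<Delta>\<^sub>C q) d\<^sub>2)))"
      by (simp add: pure_simps pq d12)
    also have "\<dots> = tensor_lift K ?P (\<lambda>q\<^sub>1 q\<^sub>2. assoc_right K D C DC (pure_tensor K DC DC (pure_tensor K D C p q\<^sub>1) (\<psi> q\<^sub>2 d\<^sub>2))) (\<Delta>\<^sub>C q)"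
      by (rule hom_eq_lift, (rule twist_rules \<Psi>_hom pq d12 | assumption)+)
        (simp add: pure_simps pq d12)
    finally show "?h (pure_tensor K DC D (pure_tensor K D C p q) d\<^sub>2) =
      tensor_lift K ?P (\<lambda>q\<^sub>1 q\<^sub>2. assoc_right K D C DC (pure_tensor K DC DC (pure_tensor K D C p q\<^sub>1) (\<psi> q\<^sub>2 d\<^sub>2))) (\<Delta>\<^sub>C q)" .
  qed (rule twist_rules \<Psi>_hom hom_simps c d12 | assumption)+
  have "?h (tensor_map K DC D \<Psi> id (assoc_left K C D D (pure_tensor K C (D \<boxtimes>\<^bsub>K\<^esub> D) c (\<Delta>\<^sub>D d)))) = tensor_lift K ?P (\<lambda>d\<^sub>1 d\<^sub>2. tensor_lift K ?P (\<lambda>c\<^sub>1 c\<^sub>2. \<psi>\<psi> c\<^sub>1 c\<^sub>2 d\<^sub>1 d\<^sub>2) (\<Delta>\<^sub>C c)) (\<Delta>\<^sub>D d)"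
  proof (rule hom_eq_lift)
    fix d\<^sub>1 d\<^sub>2 assume "d\<^sub>1 \<in> carrier D" "d\<^sub>2 \<in> carrier D"
    then show "?h (tensor_map K DC D \<Psi> id (assoc_left K C D D (pure_tensor K C (D \<boxtimes>\<^bsub>K\<^esub> D) c (pure_tensor K D D d\<^sub>1 d\<^sub>2)))) =
      tensor_lift K ?P (\<lambda>c\<^sub>1 c\<^sub>2. \<psi>\<psi> c\<^sub>1 c\<^sub>2 d\<^sub>1 d\<^sub>2) (\<Delta>\<^sub>C c)"
      by (simp add: h[symmetric] assoc_left_pure map_pure[of K] pure_closed vs \<Psi>_hom lin_id' c)
  qed (rule twist_rules \<Psi>_hom hom_simps c d | assumption)+
  then show ?thesis by (simp add: map_pure[of K] vs lin_id' \<Delta>D_hom c d)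
qed

text \<open>
  Expand \<open>\<Delta>\<^sub>C c\<close> first; the maps after \<open>id \<otimes> \<Psi>\<close> comultiply the \<open>D\<close>-leg of \<open>\<Psi>(c\<^sub>2 \<otimes> d)\<close>, so left
  colinearity applies to their composite \<open>?h\<close>.
\<close>

lemma twist_then_comultiply_D:
  assumes c: "c \<in> carrier C" and d: "d \<in> carrier D"
  shows "assoc_right K D C DC
      (tensor_map K DC DC \<Psi> id
      (assoc_left K C D DC
      (tensor_map K C (D \<boxtimes>\<^bsub>K\<^esub> DC) id (assoc_right K D D C)
      (tensor_map K C ((D \<boxtimes>\<^bsub>K\<^esub> D) \<boxtimes>\<^bsub>K\<^esub> C) id (tensor_map K (D \<boxtimes>\<^bsub>K\<^esub> D) C \<Delta>\<^sub>D id)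
      (tensor_map K C DC id \<Psi>
      (assoc_right K C C D
      (tensor_map K (C \<boxtimes>\<^bsub>K\<^esub> C) D \<Delta>\<^sub>C id (pure_tensor K C D c d)))))))) =
    tensor_lift K (D \<boxtimes>\<^bsub>K\<^esub> (C \<boxtimes>\<^bsub>K\<^esub> DC))
      (\<lambda>c\<^sub>1 c\<^sub>2. tensor_lift K (D \<boxtimes>\<^bsub>K\<^esub> (C \<boxtimes>\<^bsub>K\<^esub> DC)) (\<psi>\<psi> c\<^sub>1 c\<^sub>2) (\<Delta>\<^sub>D d)) (\<Delta>\<^sub>C c)"
proof -
  let ?P = "D \<boxtimes>\<^bsub>K\<^esub> (C \<boxtimes>\<^bsub>K\<^esub> DC)"
  let ?h = "\<lambda>x. assoc_right K D C DC
      (tensor_map K DC DC \<Psi> id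
      (assoc_left K C D DC
      (tensor_map K C (D \<boxtimes>\<^bsub>K\<^esub> DC) id (assoc_right K D D C)
      (tensor_map K C ((D \<boxtimes>\<^bsub>K\<^esub> D) \<boxtimes>\<^bsub>K\<^esub> C) id (tensor_map K (D \<boxtimes>\<^bsub>K\<^esub> D) C \<Delta>\<^sub>D id) x))))"
  have h: "?h (pure_tensor K C DC c\<^sub>1 (\<psi> c\<^sub>2 d)) = tensor_lift K ?P (\<psi>\<psi> c\<^sub>1 c\<^sub>2) (\<Delta>\<^sub>D d)"
    if c12: "c\<^sub>1 \<in> carrier C" "c\<^sub>2 \<in> carrier C" for c\<^sub>1 c\<^sub>2
  proof (rule eval_\<Psi>_left[where g="\<lambda>d v. assoc_right K D C DC (pure_tensor K DC DC (\<psi> c\<^sub>1 d) v)"])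
    fix p q assume pq: "p \<in> carrier D" "q \<in> carrier C"
    have "?h (pure_tensor K C DC c\<^sub>1 (pure_tensor K D C p q)) =
        assoc_right K D C DC (tensor_map K DC DC \<Psi> id (assoc_left K C D DC
          (pure_tensor K C (D \<boxtimes>\<^bsub>K\<^esub> DC) c\<^sub>1 (assoc_right K D D C (pure_tensor K (D \<boxtimes>\<^bsub>K\<^esub> D) C (\<Delta>\<^sub>D p) q)))))"
      by (simp add: pure_simps pq c12)
    also have "\<dots> = tensor_lift K ?P (\<lambda>p\<^sub>1 p\<^sub>2. assoc_right K D C DC (pure_tensor K DC DC (\<psi> c\<^sub>1 p\<^sub>1) (pure_tensor K D C p\<^sub>2 q))) (\<Delta>\<^sub>D p)"
      by (rule hom_eq_lift, (rule twist_rules \<Psi>_hom pq c12 | assumption)+)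
        (simp add: pure_simps pq c12)
    finally show "?h (pure_tensor K C DC c\<^sub>1 (pure_tensor K D C p q)) =
      tensor_lift K ?P (\<lambda>p\<^sub>1 p\<^sub>2. assoc_right K D C DC (pure_tensor K DC DC (\<psi> c\<^sub>1 p\<^sub>1) (pure_tensor K D C p\<^sub>2 q))) (\<Delta>\<^sub>D p)" .
  qed (rule twist_rules \<Psi>_hom hom_simps d c12 | assumption)+
  have "?h (tensor_map K C DC id \<Psi> (assoc_right K C C D (pure_tensor K (C \<boxtimes>\<^bsub>K\<^esub> C) D (\<Delta>\<^sub>C c) d))) = tensor_lift K ?P (\<lambda>c\<^sub>1 c\<^sub>2. tensor_lift K ?P (\<psi>\<psi> c\<^sub>1 c\<^sub>2) (\<Delta>\<^sub>D d)) (\<Delta>\<^sub>C c)"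
  proof (rule hom_eq_lift)
    fix c\<^sub>1 c\<^sub>2 assume "c\<^sub>1 \<in> carrier C" "c\<^sub>2 \<in> carrier C"
    then show "?h (tensor_map K C DC id \<Psi> (assoc_right K C C D (pure_tensor K (C \<boxtimes>\<^bsub>K\<^esub> C) D (pure_tensor K C C c\<^sub>1 c\<^sub>2) d))) =
      tensor_lift K ?P (\<psi>\<psi> c\<^sub>1 c\<^sub>2) (\<Delta>\<^sub>D d)"
      by (simp add: h[symmetric] assoc_right_pure map_pure[of K] pure_closed vs \<Psi>_hom lin_id' d)
  qed (rule twist_rules \<Psi>_hom hom_simps c d | assumption)+
  then show ?thesis by (simp add: map_pure[of K] vs lin_id' \<Delta>C_hom c d)
qed

lemma twist_comultiply_commute:
  assumes x: "x \<in> carrier CD"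
  shows "tensor_map K D (C \<boxtimes>\<^bsub>K\<^esub> DC) id (tensor_map K C DC id \<Psi>)
      (tensor_map K D (C \<boxtimes>\<^bsub>K\<^esub> CD) id (assoc_right K C C D)
      (tensor_map K D ((C \<boxtimes>\<^bsub>K\<^esub> C) \<boxtimes>\<^bsub>K\<^esub> D) id (tensor_map K (C \<boxtimes>\<^bsub>K\<^esub> C) D \<Delta>\<^sub>C id)
      (assoc_right K D C D
      (tensor_map K DC D \<Psi> id
      (assoc_left K C D D
      (tensor_map K C (D \<boxtimes>\<^bsub>K\<^esub> D) id \<Delta>\<^sub>D x)))))) =
    assoc_right K D C DC
      (tensor_map K DC DC \<Psi> id
      (assoc_left K C D DC
      (tensor_map K C (D \<boxtimes>\<^bsub>K\<^esub> DC) id (assoc_right K D D C)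
      (tensor_map K C ((D \<boxtimes>\<^bsub>K\<^esub> D) \<boxtimes>\<^bsub>K\<^esub> C) id (tensor_map K (D \<boxtimes>\<^bsub>K\<^esub> D) C \<Delta>\<^sub>D id)
      (tensor_map K C DC id \<Psi>
      (assoc_right K C C D
      (tensor_map K (C \<boxtimes>\<^bsub>K\<^esub> C) D \<Delta>\<^sub>C id x)))))))"
    (is "?L x = ?R x")
proof (rule tensor_ext[OF vs _ _ _ _ x])
  fix c d assume cd: "c \<in> carrier C" "d \<in> carrier D"
  show "?L (pure_tensor K C D c d) = ?R (pure_tensor K C D c d)"
    unfolding twist_then_comultiply_C[OF cd] twist_then_comultiply_D[OF cd]
    by (rule lift_swap) (rule twist_rules cd | assumption)+
qed (rule twist_rules \<Psi>_hom hom_simps | assumption)+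

section \<open>The twisted coproduct\<close>

abbreviation "\<Delta>\<Psi> \<equiv> twisted_coproduct K C D \<Delta>\<^sub>C \<Delta>\<^sub>D \<Psi>"

text \<open>
  The rebracketing \<open>a \<otimes> (p \<otimes> q) \<otimes> b \<mapsto> (a \<otimes> p) \<otimes> (q \<otimes> b)\<close>. The middle argument is a
  tensor rather than a pair because it will be a value of \<open>\<Psi>\<close>.
\<close>

definition "regroup2 a u b = assoc_left K C D CD (pure_tensor K C (D \<boxtimes>\<^bsub>K\<^esub> CD) a (assoc_right K D C D (pure_tensor K DC D u b)))"

text \<open>
  The rebracketing \<open>a \<otimes> (p \<otimes> q) \<otimes> (r \<otimes> s) \<otimes> b \<mapsto> (a \<otimes> p) \<otimes> ((q \<otimes> r) \<otimes> (s \<otimes> b))\<close>.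
\<close>

definition "regroup3 a u v b = assoc_left K C D (CD \<boxtimes>\<^bsub>K\<^esub> CD) (pure_tensor K C (D \<boxtimes>\<^bsub>K\<^esub> (CD \<boxtimes>\<^bsub>K\<^esub> CD)) a
    (tensor_map K D (CD \<boxtimes>\<^bsub>K\<^esub> CD) id (assoc_left K C D CD)
      (assoc_right K D C (D \<boxtimes>\<^bsub>K\<^esub> CD) (pure_tensor K DC (D \<boxtimes>\<^bsub>K\<^esub> CD) u (assoc_right K D C D (pure_tensor K DC D v b))))))"

lemma regroup2_linear:
  "\<lbrakk>f \<in> module_hom K E C; u \<in> carrier DC; b \<in> carrier D\<rbrakk> \<Longrightarrow> (\<lambda>x. regroup2 (f x) u b) \<in> module_hom K E (CD \<boxtimes>\<^bsub>K\<^esub> CD)"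
  "\<lbrakk>a \<in> carrier C; g \<in> module_hom K E DC; b \<in> carrier D\<rbrakk> \<Longrightarrow> (\<lambda>x. regroup2 a (g x) b) \<in> module_hom K E (CD \<boxtimes>\<^bsub>K\<^esub> CD)"
  "\<lbrakk>a \<in> carrier C; u \<in> carrier DC; h \<in> module_hom K E D\<rbrakk> \<Longrightarrow> (\<lambda>x. regroup2 a u (h x)) \<in> module_hom K E (CD \<boxtimes>\<^bsub>K\<^esub> CD)"
  unfolding regroup2_def by ((rule twist_rules hom_simps | assumption)+)

lemma regroup3_linear:
  "\<lbrakk>f \<in> module_hom K E C; u \<in> carrier DC; v \<in> carrier DC; b \<in> carrier D\<rbrakk> \<Longrightarrow>
    (\<lambda>x. regroup3 (f x) u v b) \<in> module_hom K E (CD \<boxtimes>\<^bsub>K\<^esub> (CD \<boxtimes>\<^bsub>K\<^esub> CD))"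
  "\<lbrakk>a \<in> carrier C; g \<in> module_hom K E DC; v \<in> carrier DC; b \<in> carrier D\<rbrakk> \<Longrightarrow>
    (\<lambda>x. regroup3 a (g x) v b) \<in> module_hom K E (CD \<boxtimes>\<^bsub>K\<^esub> (CD \<boxtimes>\<^bsub>K\<^esub> CD))"
  "\<lbrakk>a \<in> carrier C; u \<in> carrier DC; h \<in> module_hom K E DC; b \<in> carrier D\<rbrakk> \<Longrightarrow>
    (\<lambda>x. regroup3 a u (h x) b) \<in> module_hom K E (CD \<boxtimes>\<^bsub>K\<^esub> (CD \<boxtimes>\<^bsub>K\<^esub> CD))"
  "\<lbrakk>a \<in> carrier C; u \<in> carrier DC; v \<in> carrier DC; k \<in> module_hom K E D\<rbrakk> \<Longrightarrow>
    (\<lambda>x. regroup3 a u v (k x)) \<in> module_hom K E (CD \<boxtimes>\<^bsub>K\<^esub> (CD \<boxtimes>\<^bsub>K\<^esub> CD))"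
  unfolding regroup3_def by ((rule twist_rules hom_simps | assumption)+)

lemma regroup2_closed: "\<lbrakk>a \<in> carrier C; u \<in> carrier DC; b \<in> carrier D\<rbrakk> \<Longrightarrow> regroup2 a u b \<in> carrier (CD \<boxtimes>\<^bsub>K\<^esub> CD)"
  by (rule lin_closed[OF regroup2_linear(1)[OF lin_id]])

lemma regroup2_pure:
  "\<lbrakk>a \<in> carrier C; p \<in> carrier D; q \<in> carrier C; b \<in> carrier D\<rbrakk> \<Longrightarrow>
    regroup2 a (pure_tensor K D C p q) b = pure_tensor K CD CD (pure_tensor K C D a p) (pure_tensor K C D q b)"
  by (simp add: regroup2_def pure_simps)

text \<open>
  The next two lemmas are trivial when the remaining argument in \<open>D \<otimes> C\<close> is pure; they hold in
  general because both sides are linear in it. They put the two ways of iterating the twisted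
  coproduct into the same shape.
\<close>

lemma regroup2_before_pure:
  assumes "a \<in> carrier C" "u \<in> carrier DC" "p \<in> carrier D" "q \<in> carrier C" "b \<in> carrier D"
  shows "assoc_right K CD CD CD (pure_tensor K (CD \<boxtimes>\<^bsub>K\<^esub> CD) CD (regroup2 a u p) (pure_tensor K C D q b)) =
    regroup3 a u (pure_tensor K D C p q) b"
  by (rule tensor_ext[OF vs(2,1) _ _ _ _ assms(2)], (rule twist_rules regroup2_linear regroup3_linear assms | assumption)+)
    (simp add: regroup2_pure regroup3_def pure_simps assms)

lemma regroup2_after_pure:
  assumes "a \<in> carrier C" "v \<in> carrier DC" "p \<in> carrier D" "q \<in> carrier C" "b \<in> carrier D"
  shows "pure_tensor K CD (CD \<boxtimes>\<^bsub>K\<^esub> CD) (pure_tensor K C D a p) (regroup2 q v b) = regroup3 a (pure_tensor K D C p q) v b"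
  by (rule tensor_ext[OF vs(2,1) _ _ _ _ assms(2)], (rule twist_rules regroup2_linear regroup3_linear assms | assumption)+)
    (simp add: regroup2_pure regroup3_def pure_simps assms)

lemma twisted_coproduct_hom: "\<Delta>\<Psi> \<in> module_hom K CD (CD \<boxtimes>\<^bsub>K\<^esub> CD)"
  unfolding twisted_coproduct_def comp_def by (rule twist_rules hom_simps | assumption)+

text \<open>
  The formula \<open>c \<otimes> d \<mapsto> c\<^sub>1 \<otimes> \<Psi>(c\<^sub>2 \<otimes> d\<^sub>1) \<otimes> d\<^sub>2\<close>, composed with a linear map \<open>H\<close>: every use
  of the twisted coproduct below is followed by such a map.
\<close>

lemma eval_twisted_coproduct:
  assumes P: "vectorspace K P" and H: "H \<in> module_hom K (CD \<boxtimes>\<^bsub>K\<^esub> CD) P"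
    and eq: "\<And>c\<^sub>1 c\<^sub>2 d\<^sub>1 d\<^sub>2. \<lbrakk>c\<^sub>1 \<in> carrier C; c\<^sub>2 \<in> carrier C; d\<^sub>1 \<in> carrier D; d\<^sub>2 \<in> carrier D\<rbrakk> \<Longrightarrow>
      H (regroup2 c\<^sub>1 (\<psi> c\<^sub>2 d\<^sub>1) d\<^sub>2) = \<gamma> c\<^sub>1 c\<^sub>2 d\<^sub>1 d\<^sub>2"
    and 1: "\<And>d\<^sub>1 d\<^sub>2. \<lbrakk>d\<^sub>1 \<in> carrier D; d\<^sub>2 \<in> carrier D\<rbrakk> \<Longrightarrow> bilinear_on K C C P (\<lambda>c\<^sub>1 c\<^sub>2. \<gamma> c\<^sub>1 c\<^sub>2 d\<^sub>1 d\<^sub>2)"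
    and 2: "\<And>c\<^sub>1 c\<^sub>2. \<lbrakk>c\<^sub>1 \<in> carrier C; c\<^sub>2 \<in> carrier C\<rbrakk> \<Longrightarrow> bilinear_on K D D P (\<gamma> c\<^sub>1 c\<^sub>2)"
    and c: "c \<in> carrier C" and d: "d \<in> carrier D"
  shows "H (\<Delta>\<Psi> (pure_tensor K C D c d)) = tensor_lift K P (\<lambda>c\<^sub>1 c\<^sub>2. tensor_lift K P (\<gamma> c\<^sub>1 c\<^sub>2) (\<Delta>\<^sub>D d)) (\<Delta>\<^sub>C c)"
proof -
  note H' = lin_comp[OF _ H]
  have l: "\<And>c\<^sub>2 d\<^sub>1 d\<^sub>2. \<lbrakk>c\<^sub>2 \<in> carrier C; d\<^sub>1 \<in> carrier D; d\<^sub>2 \<in> carrier D\<rbrakk> \<Longrightarrow> (\<lambda>c\<^sub>1. \<gamma> c\<^sub>1 c\<^sub>2 d\<^sub>1 d\<^sub>2) \<in> module_hom K C P"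
    "\<And>c\<^sub>1 d\<^sub>1 d\<^sub>2. \<lbrakk>c\<^sub>1 \<in> carrier C; d\<^sub>1 \<in> carrier D; d\<^sub>2 \<in> carrier D\<rbrakk> \<Longrightarrow> (\<lambda>c\<^sub>2. \<gamma> c\<^sub>1 c\<^sub>2 d\<^sub>1 d\<^sub>2) \<in> module_hom K C P"
    using 1 by (auto simp: bilinear_on_def)
  let ?k = "\<lambda>x. assoc_left K C D CD (tensor_map K C (D \<boxtimes>\<^bsub>K\<^esub> CD) id (assoc_right K D C D)
    (tensor_map K C (DC \<boxtimes>\<^bsub>K\<^esub> D) id (tensor_map K DC D \<Psi> id)
    (tensor_map K C (CD \<boxtimes>\<^bsub>K\<^esub> D) id (assoc_left K C D D) (assoc_right K C C (D \<boxtimes>\<^bsub>K\<^esub> D) x))))"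
  have k: "H (?k (pure_tensor K (C \<boxtimes>\<^bsub>K\<^esub> C) (D \<boxtimes>\<^bsub>K\<^esub> D) (pure_tensor K C C c\<^sub>1 c\<^sub>2) (\<Delta>\<^sub>D d))) = tensor_lift K P (\<gamma> c\<^sub>1 c\<^sub>2) (\<Delta>\<^sub>D d)"
    if c12: "c\<^sub>1 \<in> carrier C" "c\<^sub>2 \<in> carrier C" for c\<^sub>1 c\<^sub>2
  proof (rule hom_eq_lift)
    fix d\<^sub>1 d\<^sub>2 assume d12: "d\<^sub>1 \<in> carrier D" "d\<^sub>2 \<in> carrier D"
    show "H (?k (pure_tensor K (C \<boxtimes>\<^bsub>K\<^esub> C) (D \<boxtimes>\<^bsub>K\<^esub> D) (pure_tensor K C C c\<^sub>1 c\<^sub>2) (pure_tensor K D D d\<^sub>1 d\<^sub>2))) = \<gamma> c\<^sub>1 c\<^sub>2 d\<^sub>1 d\<^sub>2"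
      by (simp add: eq[OF c12 d12, symmetric] regroup2_def pure_simps c12 d12)
  qed (rule twist_rules hom_simps P H' 2 c12 d | assumption)+
  have "H (?k (pure_tensor K (C \<boxtimes>\<^bsub>K\<^esub> C) (D \<boxtimes>\<^bsub>K\<^esub> D) (\<Delta>\<^sub>C c) (\<Delta>\<^sub>D d))) =
      tensor_lift K P (\<lambda>c\<^sub>1 c\<^sub>2. tensor_lift K P (\<gamma> c\<^sub>1 c\<^sub>2) (\<Delta>\<^sub>D d)) (\<Delta>\<^sub>C c)"
    by (rule hom_eq_lift) (rule k twist_rules hom_simps P H' 2 l c d | assumption)+
  then show ?thesis by (simp add: twisted_coproduct_def map_pure[of K] hom_simps c d)
qed

abbreviation "CD3 \<equiv> CD \<boxtimes>\<^bsub>K\<^esub> (CD \<boxtimes>\<^bsub>K\<^esub> CD)"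

lemmas regroup_rules = twist_rules regroup2_linear regroup2_closed regroup3_linear
lemmas regroup_hom_rules = regroup_rules hom_simps twisted_coproduct_hom lin_closed[OF twisted_coproduct_hom]

text \<open>
  On \<open>(c\<^sub>1 \<otimes> p) \<otimes> (q \<otimes> d\<^sub>2)\<close> with \<open>p \<otimes> q = \<Psi>(c\<^sub>2 \<otimes> d\<^sub>1)\<close>, the twisted coproduct of \<open>c\<^sub>1 \<otimes> p\<close> comultiplies \<open>p\<close>;
  left colinearity turns this into a coproduct of \<open>d\<^sub>1\<close>.
\<close>

lemma comultiply_left_factor:
  assumes c: "c \<in> carrier C" and d: "d \<in> carrier D"
  shows "assoc_right K CD CD CD (tensor_map K (CD \<boxtimes>\<^bsub>K\<^esub> CD) CD \<Delta>\<Psi> id (\<Delta>\<Psi> (pure_tensor K C D c d))) =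
    tensor_lift K CD3 (\<lambda>c\<^sub>1 c\<^sub>2. tensor_lift K CD3 (\<lambda>d\<^sub>1 d\<^sub>2.
      tensor_lift K CD3 (\<lambda>e\<^sub>1 e\<^sub>2. tensor_lift K CD3 (\<lambda>a\<^sub>1 a\<^sub>2. regroup3 a\<^sub>1 (\<psi> a\<^sub>2 e\<^sub>1) (\<psi> c\<^sub>2 e\<^sub>2) d\<^sub>2) (\<Delta>\<^sub>C c\<^sub>1))
        (\<Delta>\<^sub>D d\<^sub>1)) (\<Delta>\<^sub>D d)) (\<Delta>\<^sub>C c)"
proof (rule eval_twisted_coproduct)
  fix c\<^sub>1 c\<^sub>2 d\<^sub>1 d\<^sub>2 assume m: "c\<^sub>1 \<in> carrier C" "c\<^sub>2 \<in> carrier C" "d\<^sub>1 \<in> carrier D" "d\<^sub>2 \<in> carrier D"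
  show "assoc_right K CD CD CD (tensor_map K (CD \<boxtimes>\<^bsub>K\<^esub> CD) CD \<Delta>\<Psi> id (regroup2 c\<^sub>1 (\<psi> c\<^sub>2 d\<^sub>1) d\<^sub>2)) =
    tensor_lift K CD3 (\<lambda>e\<^sub>1 e\<^sub>2. tensor_lift K CD3 (\<lambda>a\<^sub>1 a\<^sub>2. regroup3 a\<^sub>1 (\<psi> a\<^sub>2 e\<^sub>1) (\<psi> c\<^sub>2 e\<^sub>2) d\<^sub>2) (\<Delta>\<^sub>C c\<^sub>1)) (\<Delta>\<^sub>D d\<^sub>1)"
  proof (rule eval_\<Psi>_left[where g="\<lambda>e v. tensor_lift K CD3 (\<lambda>a\<^sub>1 a\<^sub>2. regroup3 a\<^sub>1 (\<psi> a\<^sub>2 e) v d\<^sub>2) (\<Delta>\<^sub>C c\<^sub>1)"])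
    fix p q assume "p \<in> carrier D" "q \<in> carrier C"
    note m = m this
    have "assoc_right K CD CD CD (tensor_map K (CD \<boxtimes>\<^bsub>K\<^esub> CD) CD \<Delta>\<Psi> id (regroup2 c\<^sub>1 (pure_tensor K D C p q) d\<^sub>2)) =
        assoc_right K CD CD CD (pure_tensor K (CD \<boxtimes>\<^bsub>K\<^esub> CD) CD (\<Delta>\<Psi> (pure_tensor K C D c\<^sub>1 p)) (pure_tensor K C D q d\<^sub>2))"
      by (simp add: regroup2_pure pure_simps twisted_coproduct_hom m)
    also have "\<dots> = tensor_lift K CD3 (\<lambda>a\<^sub>1 a\<^sub>2. tensor_lift K CD3 (\<lambda>p\<^sub>1 p\<^sub>2.
        regroup3 a\<^sub>1 (\<psi> a\<^sub>2 p\<^sub>1) (pure_tensor K D C p\<^sub>2 q) d\<^sub>2) (\<Delta>\<^sub>D p)) (\<Delta>\<^sub>C c\<^sub>1)"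
      by (rule eval_twisted_coproduct) (rule regroup2_before_pure regroup_rules m | assumption)+
    also have "\<dots> = tensor_lift K CD3 (\<lambda>p\<^sub>1 p\<^sub>2. tensor_lift K CD3 (\<lambda>a\<^sub>1 a\<^sub>2.
        regroup3 a\<^sub>1 (\<psi> a\<^sub>2 p\<^sub>1) (pure_tensor K D C p\<^sub>2 q) d\<^sub>2) (\<Delta>\<^sub>C c\<^sub>1)) (\<Delta>\<^sub>D p)"
      by (rule lift_swap) (rule regroup_rules m | assumption)+
    finally show "assoc_right K CD CD CD (tensor_map K (CD \<boxtimes>\<^bsub>K\<^esub> CD) CD \<Delta>\<Psi> id (regroup2 c\<^sub>1 (pure_tensor K D C p q) d\<^sub>2)) =
      tensor_lift K CD3 (\<lambda>p\<^sub>1 p\<^sub>2. tensor_lift K CD3 (\<lambda>a\<^sub>1 a\<^sub>2.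
        regroup3 a\<^sub>1 (\<psi> a\<^sub>2 p\<^sub>1) (pure_tensor K D C p\<^sub>2 q) d\<^sub>2) (\<Delta>\<^sub>C c\<^sub>1)) (\<Delta>\<^sub>D p)" .
  qed (rule regroup_hom_rules m | assumption)+
qed (rule regroup_hom_rules c d | assumption)+

text \<open>
  Here the twisted coproduct of \<open>q \<otimes> d\<^sub>2\<close> comultiplies \<open>q\<close>; right colinearity turns this into a coproduct
  of \<open>c\<^sub>2\<close>.
\<close>

lemma comultiply_right_factor:
  assumes c: "c \<in> carrier C" and d: "d \<in> carrier D"
  shows "tensor_map K CD (CD \<boxtimes>\<^bsub>K\<^esub> CD) id \<Delta>\<Psi> (\<Delta>\<Psi> (pure_tensor K C D c d)) =
    tensor_lift K CD3 (\<lambda>c\<^sub>1 c\<^sub>2. tensor_lift K CD3 (\<lambda>d\<^sub>1 d\<^sub>2.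
      tensor_lift K CD3 (\<lambda>b\<^sub>1 b\<^sub>2. tensor_lift K CD3 (\<lambda>e\<^sub>1 e\<^sub>2. regroup3 c\<^sub>1 (\<psi> b\<^sub>1 d\<^sub>1) (\<psi> b\<^sub>2 e\<^sub>1) e\<^sub>2) (\<Delta>\<^sub>D d\<^sub>2))
        (\<Delta>\<^sub>C c\<^sub>2)) (\<Delta>\<^sub>D d)) (\<Delta>\<^sub>C c)"
proof (rule eval_twisted_coproduct)
  fix c\<^sub>1 c\<^sub>2 d\<^sub>1 d\<^sub>2 assume m: "c\<^sub>1 \<in> carrier C" "c\<^sub>2 \<in> carrier C" "d\<^sub>1 \<in> carrier D" "d\<^sub>2 \<in> carrier D"
  show "tensor_map K CD (CD \<boxtimes>\<^bsub>K\<^esub> CD) id \<Delta>\<Psi> (regroup2 c\<^sub>1 (\<psi> c\<^sub>2 d\<^sub>1) d\<^sub>2) =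
    tensor_lift K CD3 (\<lambda>b\<^sub>1 b\<^sub>2. tensor_lift K CD3 (\<lambda>e\<^sub>1 e\<^sub>2. regroup3 c\<^sub>1 (\<psi> b\<^sub>1 d\<^sub>1) (\<psi> b\<^sub>2 e\<^sub>1) e\<^sub>2) (\<Delta>\<^sub>D d\<^sub>2)) (\<Delta>\<^sub>C c\<^sub>2)"
  proof (rule eval_\<Psi>_right[where g="\<lambda>u b. tensor_lift K CD3 (\<lambda>e\<^sub>1 e\<^sub>2. regroup3 c\<^sub>1 u (\<psi> b e\<^sub>1) e\<^sub>2) (\<Delta>\<^sub>D d\<^sub>2)"])
    fix p q assume "p \<in> carrier D" "q \<in> carrier C"
    note m = m this
    have "tensor_map K CD (CD \<boxtimes>\<^bsub>K\<^esub> CD) id \<Delta>\<Psi> (regroup2 c\<^sub>1 (pure_tensor K D C p q) d\<^sub>2) =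
        pure_tensor K CD (CD \<boxtimes>\<^bsub>K\<^esub> CD) (pure_tensor K C D c\<^sub>1 p) (\<Delta>\<Psi> (pure_tensor K C D q d\<^sub>2))"
      by (simp add: regroup2_pure pure_simps twisted_coproduct_hom m)
    also have "\<dots> = tensor_lift K CD3 (\<lambda>q\<^sub>1 q\<^sub>2. tensor_lift K CD3 (\<lambda>e\<^sub>1 e\<^sub>2.
        regroup3 c\<^sub>1 (pure_tensor K D C p q\<^sub>1) (\<psi> q\<^sub>2 e\<^sub>1) e\<^sub>2) (\<Delta>\<^sub>D d\<^sub>2)) (\<Delta>\<^sub>C q)"
      by (rule eval_twisted_coproduct) (rule regroup2_after_pure regroup_rules m | assumption)+
    finally show "tensor_map K CD (CD \<boxtimes>\<^bsub>K\<^esub> CD) id \<Delta>\<Psi> (regroup2 c\<^sub>1 (pure_tensor K D C p q) d\<^sub>2) =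
      tensor_lift K CD3 (\<lambda>q\<^sub>1 q\<^sub>2. tensor_lift K CD3 (\<lambda>e\<^sub>1 e\<^sub>2.
        regroup3 c\<^sub>1 (pure_tensor K D C p q\<^sub>1) (\<psi> q\<^sub>2 e\<^sub>1) e\<^sub>2) (\<Delta>\<^sub>D d\<^sub>2)) (\<Delta>\<^sub>C q)" .
  qed (rule regroup_hom_rules m | assumption)+
qed (rule regroup_hom_rules c d | assumption)+

lemma coassoc: "coassociative_coproduct K C \<Delta>\<^sub>C" "coassociative_coproduct K D \<Delta>\<^sub>D"
  using C D by (simp_all add: coalgebra_def coalgebra_axioms_def)

text \<open>
  The iterated sums of the two preceding lemmas differ only in which factor the inner coproducts split. Coassociativity of \<open>D\<close> moves
  the inner coproduct from \<open>d\<^sub>1\<close> to \<open>d\<^sub>2\<close>, then coassociativity of \<open>C\<close> moves the one from \<open>c\<^sub>1\<close> to \<open>c\<^sub>2\<close>. Each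
  law needs the sums over its own coalgebra to be adjacent; the interchanges arrange this.
\<close>

lemma twisted_coproduct_coassociative: "coassociative_coproduct K CD \<Delta>\<Psi>"
  unfolding coassociative_coproduct_def
proof (intro conjI ballI twisted_coproduct_hom)
  fix x assume x: "x \<in> carrier CD"
  show "assoc_right K CD CD CD (tensor_map K (CD \<boxtimes>\<^bsub>K\<^esub> CD) CD \<Delta>\<Psi> id (\<Delta>\<Psi> x)) =
    tensor_map K CD (CD \<boxtimes>\<^bsub>K\<^esub> CD) id \<Delta>\<Psi> (\<Delta>\<Psi> x)"
  proof (rule tensor_ext[OF vs _ _ _ _ x])
    fix c d assume cd: "c \<in> carrier C" "d \<in> carrier D"
    \<comment> \<open>The premise on the tensor goes first, so that it fixes the factors before the others are tried.\<close>
    note cong = lift_cong[rotated 6]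
    have "assoc_right K CD CD CD (tensor_map K (CD \<boxtimes>\<^bsub>K\<^esub> CD) CD \<Delta>\<Psi> id (\<Delta>\<Psi> (pure_tensor K C D c d))) =
      tensor_lift K CD3 (\<lambda>c\<^sub>1 c\<^sub>2. tensor_lift K CD3 (\<lambda>d\<^sub>1 d\<^sub>2.
        tensor_lift K CD3 (\<lambda>e\<^sub>1 e\<^sub>2. tensor_lift K CD3 (\<lambda>a\<^sub>1 a\<^sub>2. regroup3 a\<^sub>1 (\<psi> a\<^sub>2 e\<^sub>1) (\<psi> c\<^sub>2 e\<^sub>2) d\<^sub>2) (\<Delta>\<^sub>C c\<^sub>1))
          (\<Delta>\<^sub>D d\<^sub>1)) (\<Delta>\<^sub>D d)) (\<Delta>\<^sub>C c)"
      by (rule comultiply_left_factor[OF cd])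
    also have "\<dots> = tensor_lift K CD3 (\<lambda>c\<^sub>1 c\<^sub>2. tensor_lift K CD3 (\<lambda>d\<^sub>1 d\<^sub>2.
        tensor_lift K CD3 (\<lambda>e\<^sub>1 e\<^sub>2. tensor_lift K CD3 (\<lambda>a\<^sub>1 a\<^sub>2. regroup3 a\<^sub>1 (\<psi> a\<^sub>2 d\<^sub>1) (\<psi> c\<^sub>2 e\<^sub>1) e\<^sub>2) (\<Delta>\<^sub>C c\<^sub>1))
          (\<Delta>\<^sub>D d\<^sub>2)) (\<Delta>\<^sub>D d)) (\<Delta>\<^sub>C c)"
      by (rule cong, (rule regroup_rules cd | assumption)+,
        rule lift_coassociative[OF _ _ coassoc(2)]) (rule regroup_rules cd | assumption)+
    also have "\<dots> = tensor_lift K CD3 (\<lambda>c\<^sub>1 c\<^sub>2. tensor_lift K CD3 (\<lambda>d\<^sub>1 d\<^sub>2.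
        tensor_lift K CD3 (\<lambda>a\<^sub>1 a\<^sub>2. tensor_lift K CD3 (\<lambda>e\<^sub>1 e\<^sub>2. regroup3 a\<^sub>1 (\<psi> a\<^sub>2 d\<^sub>1) (\<psi> c\<^sub>2 e\<^sub>1) e\<^sub>2) (\<Delta>\<^sub>D d\<^sub>2))
          (\<Delta>\<^sub>C c\<^sub>1)) (\<Delta>\<^sub>D d)) (\<Delta>\<^sub>C c)"
      by (rule cong, (rule regroup_rules cd | assumption)+, rule cong, (rule regroup_rules cd | assumption)+,
        rule lift_swap) (rule regroup_rules | assumption)+
    also have "\<dots> = tensor_lift K CD3 (\<lambda>c\<^sub>1 c\<^sub>2. tensor_lift K CD3 (\<lambda>a\<^sub>1 a\<^sub>2.
        tensor_lift K CD3 (\<lambda>d\<^sub>1 d\<^sub>2. tensor_lift K CD3 (\<lambda>e\<^sub>1 e\<^sub>2. regroup3 a\<^sub>1 (\<psi> a\<^sub>2 d\<^sub>1) (\<psi> c\<^sub>2 e\<^sub>1) e\<^sub>2) (\<Delta>\<^sub>D d\<^sub>2))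
          (\<Delta>\<^sub>D d)) (\<Delta>\<^sub>C c\<^sub>1)) (\<Delta>\<^sub>C c)"
      by (rule cong, (rule regroup_rules cd | assumption)+, rule lift_swap) (rule regroup_rules cd | assumption)+
    also have "\<dots> = tensor_lift K CD3 (\<lambda>c\<^sub>1 c\<^sub>2. tensor_lift K CD3 (\<lambda>b\<^sub>1 b\<^sub>2.
        tensor_lift K CD3 (\<lambda>d\<^sub>1 d\<^sub>2. tensor_lift K CD3 (\<lambda>e\<^sub>1 e\<^sub>2. regroup3 c\<^sub>1 (\<psi> b\<^sub>1 d\<^sub>1) (\<psi> b\<^sub>2 e\<^sub>1) e\<^sub>2) (\<Delta>\<^sub>D d\<^sub>2))
          (\<Delta>\<^sub>D d)) (\<Delta>\<^sub>C c\<^sub>2)) (\<Delta>\<^sub>C c)"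
      by (rule lift_coassociative[OF _ _ coassoc(1)]) (rule regroup_rules cd | assumption)+
    also have "\<dots> = tensor_map K CD (CD \<boxtimes>\<^bsub>K\<^esub> CD) id \<Delta>\<Psi> (\<Delta>\<Psi> (pure_tensor K C D c d))"
      unfolding comultiply_right_factor[OF cd]
      by (rule cong, (rule regroup_rules cd | assumption)+, rule lift_swap) (rule regroup_rules cd | assumption)+
    finally show "assoc_right K CD CD CD (tensor_map K (CD \<boxtimes>\<^bsub>K\<^esub> CD) CD \<Delta>\<Psi> id (\<Delta>\<Psi> (pure_tensor K C D c d))) =
      tensor_map K CD (CD \<boxtimes>\<^bsub>K\<^esub> CD) id \<Delta>\<Psi> (\<Delta>\<Psi> (pure_tensor K C D c d))" .
  qed (rule regroup_hom_rules | assumption)+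
qed

end

theorem theorem4p1:
  fixes K :: "('k, 'r) ring_scheme"
    and C :: "('k, 'c, 'm) module_scheme" and D :: "('k, 'd, 'n) module_scheme"
    and \<Delta>\<^sub>C :: "'c \<Rightarrow> ('c \<times> 'c \<Rightarrow> 'k) set" and \<epsilon>\<^sub>C :: "'c \<Rightarrow> 'k"
    and \<Delta>\<^sub>D :: "'d \<Rightarrow> ('d \<times> 'd \<Rightarrow> 'k) set" and \<epsilon>\<^sub>D :: "'d \<Rightarrow> 'k"
    and \<Psi> :: "('c \<times> 'd \<Rightarrow> 'k) set \<Rightarrow> ('d \<times> 'c \<Rightarrow> 'k) set"
  assumes "field K"
    and "coalgebra K C \<Delta>\<^sub>C \<epsilon>\<^sub>C"
    and "coalgebra K D \<Delta>\<^sub>D \<epsilon>\<^sub>D"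
    and "\<Psi> \<in> bicomodule_hom K D C
           (C \<boxtimes>\<^bsub>K\<^esub> D) (left_coaction_CD K C D \<Delta>\<^sub>D) (right_coaction_CD K C D \<Delta>\<^sub>C)
           (D \<boxtimes>\<^bsub>K\<^esub> C) (left_coaction_DC K D C \<Delta>\<^sub>D) (right_coaction_DC K D C \<Delta>\<^sub>C)"
  shows "(\<forall>x\<in>carrier (C \<boxtimes>\<^bsub>K\<^esub> D).
           (tensor_map K D (C \<boxtimes>\<^bsub>K\<^esub> D \<boxtimes>\<^bsub>K\<^esub> C) id (tensor_map K C (D \<boxtimes>\<^bsub>K\<^esub> C) id \<Psi>) \<circ>
            tensor_map K D (C \<boxtimes>\<^bsub>K\<^esub> C \<boxtimes>\<^bsub>K\<^esub> D) id (assoc_right K C C D) \<circ>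
            tensor_map K D ((C \<boxtimes>\<^bsub>K\<^esub> C) \<boxtimes>\<^bsub>K\<^esub> D) id (tensor_map K (C \<boxtimes>\<^bsub>K\<^esub> C) D \<Delta>\<^sub>C id) \<circ>
            assoc_right K D C D \<circ>
            tensor_map K (D \<boxtimes>\<^bsub>K\<^esub> C) D \<Psi> id \<circ>
            assoc_left K C D D \<circ>
            tensor_map K C (D \<boxtimes>\<^bsub>K\<^esub> D) id \<Delta>\<^sub>D) x =
           (assoc_right K D C (D \<boxtimes>\<^bsub>K\<^esub> C) \<circ>
            tensor_map K (D \<boxtimes>\<^bsub>K\<^esub> C) (D \<boxtimes>\<^bsub>K\<^esub> C) \<Psi> id \<circ>
            assoc_left K C D (D \<boxtimes>\<^bsub>K\<^esub> C) \<circ>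
            tensor_map K C (D \<boxtimes>\<^bsub>K\<^esub> D \<boxtimes>\<^bsub>K\<^esub> C) id (assoc_right K D D C) \<circ>
            tensor_map K C ((D \<boxtimes>\<^bsub>K\<^esub> D) \<boxtimes>\<^bsub>K\<^esub> C) id (tensor_map K (D \<boxtimes>\<^bsub>K\<^esub> D) C \<Delta>\<^sub>D id) \<circ>
            tensor_map K C (D \<boxtimes>\<^bsub>K\<^esub> C) id \<Psi> \<circ>
            assoc_right K C C D \<circ>
            tensor_map K (C \<boxtimes>\<^bsub>K\<^esub> C) D \<Delta>\<^sub>C id) x) \<and>
         coassociative_coproduct K (C \<boxtimes>\<^bsub>K\<^esub> D) (twisted_coproduct K C D \<Delta>\<^sub>C \<Delta>\<^sub>D \<Psi>)"
proof -
  interpret bicolinear_twist K C D \<Delta>\<^sub>C \<epsilon>\<^sub>C \<Delta>\<^sub>D \<epsilon>\<^sub>D \<Psi> by (rule bicolinear_twist.intro) fact+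
  show ?thesis
    using twist_comultiply_commute twisted_coproduct_coassociative by simp
qed

end
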